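(* Let $G$ be a connected graph on the vertex set $[n]$ that is not bipartite and let $I=I(G)$ be its edge ideal. Set $t_0:=\max\{t(G),c(G)\}+3$. The following are equivalent: (1) $I^{(t)}/I^t$ is Cohen-Macaulay for all $t\ge1$; (2) $I^{(t)}/I^t$ is Cohen-Macaulay for some $t\ge t_0$; (3) for all $t\ge1$, either $I^{(t)}/I^t=(0)$ or $\dim(I^{(t)}/I^t)=0$; (4) for any induced odd cycle $C$ in $G$, we have $N[C]=[n]$.
   Context: Graphs are simple, $[n]=\{1,\dots,n\}$. The edge ideal is $I(G)=(x_ix_j:\{i,j\}\in E(G))\subseteq S=k[x_1,\dots,x_n]$, $k$ an arbitrary field. The $t$-th symbolic power is $I^{(t)}=\bigcap_{\mathfrak p\in\mathrm{Ass}(I)}(I^tS_{\mathfrak p}\cap S)$. For a set (or cycle, identified with its vertex set) $F$ of vertices, $N(F)$ is the set of vertices adjacent to at least one vertex of $F$ and $N[F]=N(F)\cup F$. By convention the zero module has dimension $-1$, and it is regarded as Cohen-Macaulay. The function $t\mapsto\dim(I^{(t)}/I^t)$ is eventually constant (known); $t(G)$ denotes the smallest integer $t_1$ such that $\dim(I^{(t)}/I^t)=\dim(I^{(t_1)}/I^{t_1})$ for all $t\ge t_1$. The number $c(G)\in\mathbb{N}$ is defined by: $2c(G)+1$ is the maximum length of an induced odd cycle in $G$ (and $c(G)=0$ if $G$ is bipartite). *)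

theory Defs
  imports
    "HOL-Algebra.Module"
    "HOL-Algebra.QuotRing"
    "HOL-Algebra.Ideal_Product"
    "HOL-Library.Poly_Mapping"
    "HOL-Library.Extended_Real"
begin

section \<open>Simple graphs\<close>

text \<open>A graph is given by its vertex set \<open>V\<close> and its set \<open>E\<close> of two-element edges.\<close>

definition simple_graph :: "'v set \<Rightarrow> 'v set set \<Rightarrow> bool" where
  "simple_graph V E \<longleftrightarrow> finite V \<and> (\<forall>e\<in>E. e \<subseteq> V \<and> card e = 2)"

definition graph_connected :: "'v set \<Rightarrow> 'v set set \<Rightarrow> bool" where
  "graph_connected V E \<longleftrightarrow> V \<noteq> {} \<and> (\<forall>u\<in>V. \<forall>v\<in>V. (u, v) \<in> {(a, b). {a, b} \<in> E}\<^sup>*)"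

definition bipartite :: "'v set \<Rightarrow> 'v set set \<Rightarrow> bool" where
  "bipartite V E \<longleftrightarrow>
     (\<exists>A B. A \<union> B = V \<and> A \<inter> B = {} \<and> (\<forall>e\<in>E. \<exists>a\<in>A. \<exists>b\<in>B. e = {a, b}))"

text \<open>
  A cycle is identified with its vertex set, so that its length is \<open>card C\<close>. It is induced if
  the vertices of \<open>C\<close> can be listed cyclically such that the edges of the graph inside \<open>C\<close> are
  exactly those between cyclically consecutive vertices.
\<close>

definition induced_cycle :: "'v set \<Rightarrow> 'v set set \<Rightarrow> 'v set \<Rightarrow> bool" where
  "induced_cycle V E C \<longleftrightarrow>
     (\<exists>vs. distinct vs \<and> set vs = C \<and> C \<subseteq> V \<and> length vs \<ge> 3 \<and>
        (\<forall>i j. i < j \<and> j < length vs \<longrightarrow>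
           ({vs ! i, vs ! j} \<in> E \<longleftrightarrow> j = Suc i \<or> i = 0 \<and> j = length vs - 1)))"

definition induced_odd_cycle :: "'v set \<Rightarrow> 'v set set \<Rightarrow> 'v set \<Rightarrow> bool" where
  "induced_odd_cycle V E C \<longleftrightarrow> induced_cycle V E C \<and> odd (card C)"

definition open_nbhd :: "'v set \<Rightarrow> 'v set set \<Rightarrow> 'v set \<Rightarrow> 'v set" where
  "open_nbhd V E F = {v \<in> V. \<exists>u\<in>F. {u, v} \<in> E}"

definition closed_nbhd :: "'v set \<Rightarrow> 'v set set \<Rightarrow> 'v set \<Rightarrow> 'v set" where
  "closed_nbhd V E F = open_nbhd V E F \<union> F"

definition c_number :: "'v set \<Rightarrow> 'v set set \<Rightarrow> nat" where
  "c_number V E =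
     (if bipartite V E then 0
      else (THE c. 2 * c + 1 = Max {card C | C. induced_odd_cycle V E C}))"


section \<open>Modules over a commutative ring\<close>

definition zero_module :: "('b, 'a, 'm) module_scheme \<Rightarrow> bool" where
  "zero_module M \<longleftrightarrow> carrier M = {\<zero>\<^bsub>M\<^esub>}"

text \<open>
  The \<open>R\<close>-module \<open>J / K\<close> for ideals \<open>K \<subseteq> J\<close> of \<open>R\<close>. The fields \<open>mult\<close> and \<open>one\<close>, which the
  record type inherits from rings, play no role for modules.
\<close>

definition quot_module :: "('a, 'm) ring_scheme \<Rightarrow> 'a set \<Rightarrow> 'a set \<Rightarrow> ('a, 'a set) module" where
  "quot_module R J K =
     \<lparr>carrier = {K +>\<^bsub>R\<^esub> x | x. x \<in> J}, monoid.mult = undefined, one = undefined,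
      zero = K, add = set_add R, smult = (\<lambda>a A. \<Union>x\<in>A. K +>\<^bsub>R\<^esub> (a \<otimes>\<^bsub>R\<^esub> x))\<rparr>"

definition annihilator ::
  "('a, 'm) ring_scheme \<Rightarrow> ('a, 'b, 'n) module_scheme \<Rightarrow> 'a set" where
  "annihilator R M = {r \<in> carrier R. \<forall>x\<in>carrier M. r \<odot>\<^bsub>M\<^esub> x = \<zero>\<^bsub>M\<^esub>}"

definition associated_primes ::
  "('a, 'm) ring_scheme \<Rightarrow> ('a, 'b, 'n) module_scheme \<Rightarrow> 'a set set" where
  "associated_primes R M =
     {P. primeideal P R \<and> (\<exists>x\<in>carrier M. P = {r \<in> carrier R. r \<odot>\<^bsub>M\<^esub> x = \<zero>\<^bsub>M\<^esub>})}"

text \<open>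
  The supremum of the lengths \<open>l\<close> of chains of prime ideals with \<open>l + 1\<close> members.
\<close>

definition krull_dim :: "('a, 'm) ring_scheme \<Rightarrow> ereal" where
  "krull_dim R =
     (SUP C \<in> {C. finite C \<and> C \<noteq> {} \<and> (\<forall>P\<in>C. primeideal P R) \<and>
                  (\<forall>P\<in>C. \<forall>Q\<in>C. P \<subseteq> Q \<or> Q \<subseteq> P)}. ereal (real (card C - 1)))"

definition module_dim ::
  "('a, 'm) ring_scheme \<Rightarrow> ('a, 'b, 'n) module_scheme \<Rightarrow> ereal" where
  "module_dim R M = (if zero_module M then -1 else krull_dim (R Quot (annihilator R M)))"

text \<open>The submodule \<open>A M\<close> generated by all products of elements of \<open>A\<close> and of \<open>M\<close>.\<close>

definition set_times_module ::
  "('a, 'm) ring_scheme \<Rightarrow> 'a set \<Rightarrow> ('a, 'b, 'n) module_scheme \<Rightarrow> 'b set" where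
  "set_times_module R A M =
     \<Inter>{N. submodule N R M \<and> (\<forall>a\<in>A. \<forall>x\<in>carrier M. a \<odot>\<^bsub>M\<^esub> x \<in> N)}"

text \<open>
  \<open>f\<^sub>1, \<dots>, f\<^sub>r\<close> is \<open>M\<close>-regular if \<open>f\<^sub>i\<close> is a nonzerodivisor on \<open>M / (f\<^sub>1, \<dots>, f\<^bsub>i-1\<^esub>) M\<close>
  for all \<open>i\<close>, and \<open>M \<noteq> (f\<^sub>1, \<dots>, f\<^sub>r) M\<close>.
\<close>

definition regular_sequence ::
  "('a, 'm) ring_scheme \<Rightarrow> ('a, 'b, 'n) module_scheme \<Rightarrow> 'a list \<Rightarrow> bool" where
  "regular_sequence R M fs \<longleftrightarrow>
     set fs \<subseteq> carrier R \<and>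
     (\<forall>i<length fs. \<forall>x\<in>carrier M.
        fs ! i \<odot>\<^bsub>M\<^esub> x \<in> set_times_module R (set (take i fs)) M \<longrightarrow>
        x \<in> set_times_module R (set (take i fs)) M) \<and>
     set_times_module R (set fs) M \<noteq> carrier M"

definition depth ::
  "('a, 'm) ring_scheme \<Rightarrow> 'a set \<Rightarrow> ('a, 'b, 'n) module_scheme \<Rightarrow> ereal" where
  "depth R \<mm> M =
     (SUP fs \<in> {fs. set fs \<subseteq> \<mm> \<and> regular_sequence R M fs}. ereal (real (length fs)))"

text \<open>
  Cohen-Macaulayness of a finitely generated graded module \<open>M\<close> over a standard graded
  polynomial ring \<open>R\<close> with graded maximal ideal \<open>\<mm>\<close>, with respect to which the depth is taken.
\<close>

definition cohen_macaulay ::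
  "('a, 'm) ring_scheme \<Rightarrow> 'a set \<Rightarrow> ('a, 'b, 'n) module_scheme \<Rightarrow> bool" where
  "cohen_macaulay R \<mm> M \<longleftrightarrow> zero_module M \<or> depth R \<mm> M = module_dim R M"


section \<open>Localization and symbolic powers\<close>

text \<open>The fraction \<open>a / s\<close> in the localization of \<open>R\<close> at a prime ideal \<open>P\<close>.\<close>

definition loc_frac :: "('a, 'm) ring_scheme \<Rightarrow> 'a set \<Rightarrow> 'a \<Rightarrow> 'a \<Rightarrow> ('a \<times> 'a) set" where
  "loc_frac R P a s =
     {(b, t). b \<in> carrier R \<and> t \<in> carrier R - P \<and>
        (\<exists>u\<in>carrier R - P. u \<otimes>\<^bsub>R\<^esub> (t \<otimes>\<^bsub>R\<^esub> a \<ominus>\<^bsub>R\<^esub> s \<otimes>\<^bsub>R\<^esub> b) = \<zero>\<^bsub>R\<^esub>)}"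

text \<open>The extension \<open>J R\<^sub>P\<close> of an ideal \<open>J\<close> of \<open>R\<close>, and its contraction \<open>J R\<^sub>P \<inter> R\<close>.\<close>

definition loc_ideal :: "('a, 'm) ring_scheme \<Rightarrow> 'a set \<Rightarrow> 'a set \<Rightarrow> ('a \<times> 'a) set set" where
  "loc_ideal R P J = {loc_frac R P a s | a s. a \<in> J \<and> s \<in> carrier R - P}"

definition loc_contraction :: "('a, 'm) ring_scheme \<Rightarrow> 'a set \<Rightarrow> 'a set \<Rightarrow> 'a set" where
  "loc_contraction R P J = {f \<in> carrier R. loc_frac R P f \<one>\<^bsub>R\<^esub> \<in> loc_ideal R P J}"

definition ideal_power :: "('a, 'm) ring_scheme \<Rightarrow> 'a set \<Rightarrow> nat \<Rightarrow> 'a set" where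
  "ideal_power R I t = I [^]\<^bsub>ideals_set R\<^esub> t"

text \<open>As usual, \<open>Ass(I)\<close> denotes the set of associated primes of the module \<open>R / I\<close>.\<close>

definition symbolic_power :: "('a, 'm) ring_scheme \<Rightarrow> 'a set \<Rightarrow> nat \<Rightarrow> 'a set" where
  "symbolic_power R I t =
     {f \<in> carrier R. \<forall>P \<in> associated_primes R (quot_module R (carrier R) I).
        f \<in> loc_contraction R P (ideal_power R I t)}"

definition symbolic_quotient ::
  "('a, 'm) ring_scheme \<Rightarrow> 'a set \<Rightarrow> nat \<Rightarrow> ('a, 'a set) module" where
  "symbolic_quotient R I t = quot_module R (symbolic_power R I t) (ideal_power R I t)"

definition t_number :: "('a, 'm) ring_scheme \<Rightarrow> 'a set \<Rightarrow> nat" where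
  "t_number R I =
     (LEAST t\<^sub>1. t\<^sub>1 \<ge> 1 \<and> (\<forall>t\<ge>t\<^sub>1. module_dim R (symbolic_quotient R I t) =
                                 module_dim R (symbolic_quotient R I t\<^sub>1)))"


section \<open>Polynomial rings and edge ideals\<close>

text \<open>
  The type \<open>('v \<Rightarrow>\<^sub>0 nat) \<Rightarrow>\<^sub>0 'k\<close> consists of the polynomials over \<open>'k\<close> in the variables indexed
  by all of \<open>'v\<close>; the carrier of \<open>mpoly_ring V\<close> consists of those involving only variables
  indexed by \<open>V\<close>.
\<close>

definition mpoly_ring :: "'v set \<Rightarrow> (('v \<Rightarrow>\<^sub>0 nat) \<Rightarrow>\<^sub>0 'k::field) ring" where
  "mpoly_ring V =
     \<lparr>carrier = {p. \<forall>m\<in>Poly_Mapping.keys p. Poly_Mapping.keys m \<subseteq> V},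
      monoid.mult = (*), one = 1, zero = 0, add = (+)\<rparr>"

definition mpoly_var :: "'v \<Rightarrow> ('v \<Rightarrow>\<^sub>0 nat) \<Rightarrow>\<^sub>0 'k::field" where
  "mpoly_var i = Poly_Mapping.single (Poly_Mapping.single i 1) 1"

definition irrelevant_ideal :: "'v set \<Rightarrow> (('v \<Rightarrow>\<^sub>0 nat) \<Rightarrow>\<^sub>0 'k::field) set" where
  "irrelevant_ideal V = Idl\<^bsub>mpoly_ring V\<^esub> (mpoly_var ` V)"

definition edge_ideal :: "'v set \<Rightarrow> 'v set set \<Rightarrow> (('v \<Rightarrow>\<^sub>0 nat) \<Rightarrow>\<^sub>0 'k::field) set" where
  "edge_ideal V E = Idl\<^bsub>mpoly_ring V\<^esub> {mpoly_var i * mpoly_var j | i j. {i, j} \<in> E}"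

end

theory Submission
  imports Defs
begin

text \<open>
  The quotient \<open>M\<^sub>t\<close> of the symbolic by the ordinary \<open>t\<close>-th power of the edge ideal is spanned by
  monomials. A monomial lies in the ordinary power if it is a multiple of a product of \<open>t\<close> edges
  (\<open>edge_ideal_power_eq\<close>), and in the symbolic power if its degree in the variables of every
  vertex cover is at least \<open>t\<close> (\<open>symbolic_power_eq\<close>). Hence \<open>M\<^sub>t\<close> measures by how much packing
  edges falls short of covering them, and the reason for such a gap is always an odd cycle.

  Suppose that every induced odd cycle dominates the graph. Then the graph without the closed
  neighbourhood of a vertex \<open>i\<close> has no odd cycle, so it is bipartite, and by the weighted theorem
  of Koenig packing and covering agree there (\<open>bipartite_koenig\<close>). The neighbours of \<open>i\<close> become
  generators once \<open>x\<^sub>i\<close> is inverted, so they cause no gap either, and \<open>x\<^sub>i\<^sup>t\<close> kills \<open>M\<^sub>t\<close>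
  (\<open>edge_mult_after_inverting_vertex\<close>). As this holds for all \<open>i\<close>, the module is zero, or it
  has dimension and depth zero.

  Conversely let \<open>C\<close> be an induced odd cycle of length \<open>2c + 1\<close> with \<open>N[C] \<noteq> V\<close>. The product \<open>g\<close>
  of its variables has too small a degree to lie in the power with exponent \<open>c + 1\<close>, but it falls
  into that power as soon as it is multiplied by a variable of \<open>N[C]\<close>. Multiplying \<open>g\<close> by an edge
  \<open>vw\<close> with \<open>v \<in> C\<close> raises the exponent by one and replaces \<open>C\<close> by \<open>C \<union> {w}\<close>; this can be
  repeated (\<open>core_extend\<close>). Let \<open>g\<close> be obtained in this way for a vertex set \<open>T\<close> and exponent \<open>t\<close>.
  Two things follow. No monomial in the variables of an independent set \<open>F\<close> outside \<open>N[T]\<close>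
  moves \<open>g\<close> into the ordinary power, so \<open>dim M\<^sub>t \<ge> |F|\<close>. If moreover \<open>F\<close> is maximal with this
  property, then the product of \<open>g\<close> and the variables of \<open>F\<close> is a nonzero element of \<open>M\<^sub>t\<close> that
  all variables outside \<open>F\<close> kill, so \<open>depth M\<^sub>t \<le> |F|\<close>. Now choose an edge \<open>wu\<close> with
  \<open>w \<in> N(C)\<close> and \<open>u \<notin> N[C]\<close>. For \<open>t \<ge> c + 3\<close> there is room for the edges that lead to
  \<open>T = C \<union> {w, u}\<close>. For a maximal independent set \<open>F\<close> outside \<open>N[T]\<close>, the set \<open>F \<union> {u}\<close> is
  independent outside \<open>N[C]\<close>, whence \<open>depth M\<^sub>t \<le> |F| < |F| + 1 \<le> dim M\<^sub>t\<close>.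

  The bound on the depth is the inequality \<open>depth M \<le> dim R/P\<close> for an associated prime \<open>P\<close>. It is
  derived here from Koszul cohomology. If \<open>M\<close> has a regular sequence of length \<open>r\<close> in the
  irrelevant ideal, then \<open>H\<^sup>k(x\<^sub>1, \<dots>, x\<^sub>n; M) = 0\<close> for \<open>k < r\<close> (\<open>exact_of_regular_sequence\<close>).
  Omitting one variable shortens the range of vanishing by one only
  (\<open>exact_remove_variable\<close>), so omitting the variables of \<open>F\<close> leaves \<open>H\<^sup>0 = 0\<close> if \<open>|F| < r\<close>. But
  \<open>H\<^sup>0\<close> consists of the elements that the remaining variables kill.
\<close>

section \<open>Koszul cohomology of a subquotient\<close>

text \<open>
  Subsets of a ring that are modules over a subset \<open>S\<close> of scalars. All modules below are quotients
  \<open>J/K\<close> of two such sets, and their elements are represented by elements of \<open>J\<close>: passing to a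
  further quotient only enlarges \<open>K\<close>.
\<close>

definition submod :: "'a::comm_ring_1 set \<Rightarrow> 'a set \<Rightarrow> bool" where
  "submod S X \<longleftrightarrow> 0 \<in> X \<and> (\<forall>p\<in>X. \<forall>q\<in>X. p + q \<in> X) \<and> (\<forall>s\<in>S. \<forall>p\<in>X. s * p \<in> X)"

text \<open>The submodule \<open>K + fJ\<close>: the quotient of \<open>J/K\<close> by \<open>f\<close> is \<open>J\<close> modulo this set.\<close>

definition add_mult :: "'a::comm_ring_1 set \<Rightarrow> 'a set \<Rightarrow> 'a \<Rightarrow> 'a set" where
  "add_mult J K f = {p + f * q | p q. p \<in> K \<and> q \<in> J}"

text \<open>The first half of regularity of a sequence on \<open>J/K\<close>, without the condition that the last quotient is nonzero.\<close>

fun reg_on :: "'a::comm_ring_1 set \<Rightarrow> 'a set \<Rightarrow> 'a list \<Rightarrow> bool" where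
  "reg_on J K [] = True"
| "reg_on J K (f # fs) = ((\<forall>y\<in>J. f * y \<in> K \<longrightarrow> y \<in> K) \<and> reg_on J (add_mult J K f) fs)"

text \<open>The sign with which \<open>i\<close> enters the set \<open>A\<close> in the exterior algebra: it counts the transpositions that move \<open>i\<close> to its place.\<close>

definition ksign :: "'v::linorder \<Rightarrow> 'v set \<Rightarrow> 'a::comm_ring_1" where
  "ksign i A = (- 1) ^ card {j\<in>A. j < i}"

lemma ksign_square [simp]: "ksign i A * ksign i A = 1"
  unfolding ksign_def by (simp flip: power_add mult_2)

lemma ksign_square_left [simp]: "ksign i A * (ksign i A * p) = p"
  by (simp flip: mult.assoc)

lemma ksign_remove_self [simp]: "ksign i (A - {i}) = ksign i A"
  unfolding ksign_def by (rule arg_cong[where f = "\<lambda>B. (-1) ^ card B"]) auto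

lemma ksign_insert_self [simp]: "ksign i (insert i A) = ksign i A"
  unfolding ksign_def by (rule arg_cong[where f = "\<lambda>B. (-1) ^ card B"]) auto

lemma ksign_remove:
  assumes "finite A" "i \<in> A"
  shows "ksign v (A - {i}) = (if i < v then - ksign v A else ksign v A)"
proof (cases "i < v")
  case True
  have "{j\<in>A. j < v} = insert i {j \<in> A - {i}. j < v}" using True assms by auto
  then have "card {j\<in>A. j < v} = Suc (card {j \<in> A - {i}. j < v})"
    using assms by simp
  then show ?thesis using True by (simp add: ksign_def)
next
  case False
  then have "{j\<in>A - {i}. j < v} = {j\<in>A. j < v}" by auto
  then show ?thesis using False by (simp add: ksign_def)
qed

text \<open>
  Removing \<open>i\<close> and inserting \<open>v\<close> anticommute. Both cases come down to the fact that exactly one of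
  \<open>i\<close> and \<open>v\<close> is the smaller element. The homotopy and the mapping cone below both rest on this
  sign rule.
\<close>

lemma ksign_swap:
  assumes "finite A" "i \<in> A" "v \<notin> A"
  shows "(ksign v A :: 'a::comm_ring_1) * ksign i (insert v A) = - (ksign i A * ksign v (A - {i}))"
proof -
  have "(ksign i A :: 'a) = ksign i (insert v A - {v})" using assms by simp
  also have "\<dots> = (if v < i then - ksign i (insert v A) else ksign i (insert v A))"
    by (rule ksign_remove) (use assms in auto)
  finally have "(ksign i (insert v A) :: 'a) = (if v < i then - ksign i A else ksign i A)"
    by (metis minus_minus)
  moreover have "v < i \<longleftrightarrow> \<not> i < v" using assms by (metis not_less_iff_gr_or_eq)
  ultimately show ?thesis using assms by (simp add: ksign_remove mult.commute)
qed

lemma submod_0: "submod S X \<Longrightarrow> 0 \<in> X"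
  and submod_add: "submod S X \<Longrightarrow> p \<in> X \<Longrightarrow> q \<in> X \<Longrightarrow> p + q \<in> X"
  and submod_mult: "submod S X \<Longrightarrow> s \<in> S \<Longrightarrow> p \<in> X \<Longrightarrow> s * p \<in> X"
  by (auto simp: submod_def)

lemma submod_sum: "submod S X \<Longrightarrow> (\<And>i. i \<in> A \<Longrightarrow> g i \<in> X) \<Longrightarrow> sum g A \<in> X"
  by (induction A rule: infinite_finite_induct) (auto intro: submod_0 submod_add)

locale koszul =
  fixes S :: "'a::comm_ring_1 set" and x :: "'v::linorder \<Rightarrow> 'a" and V :: "'v set"
  assumes finite_V: "finite V"
    and neg_one: "- 1 \<in> S"
    and x_in: "\<And>v. v \<in> V \<Longrightarrow> x v \<in> S"
    and S_mult: "\<And>p q. p \<in> S \<Longrightarrow> q \<in> S \<Longrightarrow> p * q \<in> S"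
begin

text \<open>
  The Koszul differential on cochains, which are functions from finite sets of variables to the
  ring. Cochains are total functions; their degree is only recorded by the cardinality of the sets
  at which they are looked at.
\<close>

definition koszul_d :: "('v set \<Rightarrow> 'a) \<Rightarrow> 'v set \<Rightarrow> 'a" where
  "koszul_d \<omega> B = (\<Sum>i\<in>B. ksign i B * x i * \<omega> (B - {i}))"

definition cocycle :: "'v set \<Rightarrow> nat \<Rightarrow> 'a set \<Rightarrow> 'a set \<Rightarrow> ('v set \<Rightarrow> 'a) \<Rightarrow> bool" where
  "cocycle W k J K \<omega> \<longleftrightarrow> (\<forall>A. \<omega> A \<in> J) \<and> (\<forall>B. B \<subseteq> W \<and> card B = Suc k \<longrightarrow> koszul_d \<omega> B \<in> K)"

definition coboundary :: "'v set \<Rightarrow> nat \<Rightarrow> 'a set \<Rightarrow> 'a set \<Rightarrow> ('v set \<Rightarrow> 'a) \<Rightarrow> bool" where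
  "coboundary W k J K \<omega> \<longleftrightarrow>
     (\<exists>\<eta>. (\<forall>A. \<eta> A \<in> J) \<and> (\<forall>A. A \<subseteq> W \<and> card A = k \<longrightarrow> \<omega> A - koszul_d \<eta> A \<in> K))"

definition koszul_exact :: "'v set \<Rightarrow> nat \<Rightarrow> 'a set \<Rightarrow> 'a set \<Rightarrow> bool" where
  "koszul_exact W k J K \<longleftrightarrow> (\<forall>\<omega>. cocycle W k J K \<omega> \<longrightarrow> coboundary W k J K \<omega>)"

lemma koszul_exactD:
  assumes "koszul_exact W k J K" "cocycle W k J K \<omega>"
  obtains \<eta> where "\<And>A. \<eta> A \<in> J" "\<And>A. A \<subseteq> W \<Longrightarrow> card A = k \<Longrightarrow> \<omega> A - koszul_d \<eta> A \<in> K"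
proof -
  have "coboundary W k J K \<omega>" using assms unfolding koszul_exact_def by blast
  then show ?thesis using that unfolding coboundary_def by blast
qed

lemma neg_mem: "submod S X \<Longrightarrow> p \<in> X \<Longrightarrow> - p \<in> X"
  using submod_mult[OF _ neg_one] by fastforce

lemma diff_mem: "submod S X \<Longrightarrow> p \<in> X \<Longrightarrow> q \<in> X \<Longrightarrow> p - q \<in> X"
  using submod_add[of S X p "- q"] neg_mem by simp

lemma one_in: "1 \<in> S"
  using S_mult[OF neg_one neg_one] by simp

lemma ksign_in: "ksign i A \<in> S"
proof -
  have "(- 1) ^ n \<in> S" for n
  proof (induction n)
    case (Suc n)
    then show ?case using S_mult[OF neg_one Suc] by simp
  qed (simp add: one_in)
  then show ?thesis by (simp add: ksign_def)
qed

lemma ksign_mem: "submod S X \<Longrightarrow> ksign i A * p \<in> X \<longleftrightarrow> p \<in> X"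
  by (metis ksign_in ksign_square_left submod_mult)

lemma finite_sub: "A \<subseteq> V \<Longrightarrow> finite A"
  using finite_V finite_subset by blast

lemma koszul_d_mem: "submod S X \<Longrightarrow> B \<subseteq> V \<Longrightarrow> (\<And>A. A \<subseteq> B \<Longrightarrow> \<omega> A \<in> X) \<Longrightarrow> koszul_d \<omega> B \<in> X"
  unfolding koszul_d_def
  by (rule submod_sum) (auto intro!: submod_mult[of S X] S_mult ksign_in x_in simp: mult.assoc)

lemma koszul_d_add: "koszul_d (\<lambda>A. \<omega> A + \<eta> A) B = koszul_d \<omega> B + koszul_d \<eta> B"
  by (simp add: koszul_d_def distrib_left sum.distrib)

lemma koszul_d_mult: "koszul_d (\<lambda>A. p * \<omega> A) B = p * koszul_d \<omega> B"
  by (simp add: koszul_d_def sum_distrib_left mult_ac)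

lemma koszul_d_insert:
  assumes "A \<subseteq> V" "v \<notin> A"
  shows "koszul_d \<omega> (insert v A) = ksign v A * x v * \<omega> A +
     (\<Sum>i\<in>A. ksign i (insert v A) * x i * \<omega> (insert v (A - {i})))"
proof -
  have *: "insert v A - {i} = insert v (A - {i})" if "i \<in> A" for i
    using that assms by auto
  have **: "insert v A - {v} = A" using assms by auto
  show ?thesis
    unfolding koszul_d_def by (subst sum.insert) (use assms finite_sub in \<open>auto simp: * **\<close>)
qed

text \<open>
  The summands for \<open>(i, j)\<close> and \<open>(j, i)\<close> cancel. The sum is split along \<open>i < j\<close>, as equality with
  its own negative would prove nothing in characteristic two.
\<close>

lemma koszul_d_square:
  assumes "B \<subseteq> V"
  shows "koszul_d (koszul_d \<omega>) B = 0"
proof -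
  have fin: "finite B" using assms finite_sub by blast
  define g where "g = (\<lambda>(i, j). ksign i B * x i * (ksign j (B - {i}) * x j * \<omega> (B - {i} - {j})))"
  have anti: "g (j, i) = - g (i, j)" if "i \<in> B" "j \<in> B" "i < j" for i j
  proof -
    have "B - {i} - {j} = B - {j} - {i}" "\<not> j < i" using that by auto
    then show ?thesis
      using that fin by (simp add: g_def ksign_remove mult_ac)
  qed
  have "koszul_d (koszul_d \<omega>) B = (\<Sum>i\<in>B. \<Sum>j\<in>B - {i}. g (i, j))"
    by (simp add: koszul_d_def sum_distrib_left g_def)
  also have "\<dots> = sum g (Sigma B (\<lambda>i. B - {i}))"
    using fin by (subst sum.Sigma) auto
  also have "Sigma B (\<lambda>i. B - {i}) =
      {p \<in> B \<times> B. fst p < snd p} \<union> prod.swap ` {p \<in> B \<times> B. fst p < snd p}"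
    by (force simp: image_iff)
  also have "sum g \<dots> = sum g {p \<in> B \<times> B. fst p < snd p} +
      sum g (prod.swap ` {p \<in> B \<times> B. fst p < snd p})"
    using fin by (intro sum.union_disjoint) auto
  also have "sum g (prod.swap ` {p \<in> B \<times> B. fst p < snd p}) =
      (\<Sum>p\<in>{p \<in> B \<times> B. fst p < snd p}. - g p)"
    by (subst sum.reindex) (auto intro!: sum.cong simp: anti)
  finally show ?thesis by (simp add: sum_negf)
qed

text \<open>
  Contraction with \<open>v\<close> is a homotopy from multiplication by \<open>x\<^sub>v\<close> to zero.
\<close>

lemma variable_kills_cohomology:
  assumes K: "submod S K" and J: "submod S J"
    and "W \<subseteq> V" "v \<in> W" and \<omega>: "cocycle W k J K \<omega>"
  shows "coboundary W k J K (\<lambda>A. x v * \<omega> A)"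
proof -
  define \<eta> where "\<eta> A = (if v \<in> A then 0 else ksign v A * \<omega> (insert v A))" for A
  have \<eta>J: "\<eta> A \<in> J" for A
    using \<omega> J by (auto simp: \<eta>_def cocycle_def ksign_mem submod_0)
  have "x v * \<omega> A - koszul_d \<eta> A \<in> K" if A: "A \<subseteq> W" "card A = k" for A
  proof (cases "v \<in> A")
    case True
    have fin: "finite A" using A assms finite_sub by blast
    have "koszul_d \<eta> A = (\<Sum>i\<in>A. if i = v then x v * \<omega> A else 0)"
      unfolding koszul_d_def
      by (rule sum.cong) (use True in \<open>auto simp: \<eta>_def insert_absorb mult_ac\<close>)
    also have "\<dots> = x v * \<omega> A" using fin True by simp
    finally show ?thesis using submod_0[OF K] by simp
  next
    case False
    have fin: "finite A" and AV: "A \<subseteq> V" using A assms finite_sub by blast+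
    have "ksign v A * koszul_d \<omega> (insert v A) = x v * \<omega> A +
       (\<Sum>i\<in>A. (ksign v A * ksign i (insert v A)) * x i * \<omega> (insert v (A - {i})))"
      unfolding koszul_d_insert[OF AV False]
      by (simp add: distrib_left sum_distrib_left mult_ac)
    also have "(\<Sum>i\<in>A. (ksign v A * ksign i (insert v A)) * x i * \<omega> (insert v (A - {i}))) = - koszul_d \<eta> A"
      unfolding koszul_d_def sum_negf[symmetric]
      by (rule sum.cong) (use False fin in \<open>auto simp: \<eta>_def ksign_swap mult_ac\<close>)
    finally have eq: "x v * \<omega> A - koszul_d \<eta> A = ksign v A * koszul_d \<omega> (insert v A)" by simp
    have "koszul_d \<omega> (insert v A) \<in> K"
      using \<omega> False A fin assms unfolding cocycle_def by auto
    then show ?thesis using eq K by (simp add: ksign_mem)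
  qed
  then show ?thesis using \<eta>J unfolding coboundary_def by blast
qed

lemma coboundary_add:
  assumes "submod S J" "submod S K" "coboundary W k J K \<omega>" "coboundary W k J K \<omega>'"
  shows "coboundary W k J K (\<lambda>A. \<omega> A + \<omega>' A)"
proof -
  obtain \<eta> \<eta>' where \<eta>: "\<forall>A. \<eta> A \<in> J" "\<forall>A. A \<subseteq> W \<and> card A = k \<longrightarrow> \<omega> A - koszul_d \<eta> A \<in> K"
    and \<eta>': "\<forall>A. \<eta>' A \<in> J" "\<forall>A. A \<subseteq> W \<and> card A = k \<longrightarrow> \<omega>' A - koszul_d \<eta>' A \<in> K"
    using assms unfolding coboundary_def by blast
  have "\<omega> A + \<omega>' A - koszul_d (\<lambda>A. \<eta> A + \<eta>' A) A \<in> K" if "A \<subseteq> W \<and> card A = k" for A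
  proof -
    have "\<omega> A + \<omega>' A - koszul_d (\<lambda>A. \<eta> A + \<eta>' A) A = (\<omega> A - koszul_d \<eta> A) + (\<omega>' A - koszul_d \<eta>' A)"
      by (simp add: koszul_d_add)
    moreover have "\<omega> A - koszul_d \<eta> A \<in> K" "\<omega>' A - koszul_d \<eta>' A \<in> K" using that \<eta> \<eta>' by blast+
    ultimately show ?thesis using submod_add[OF assms(2)] by metis
  qed
  then show ?thesis using \<eta> \<eta>' submod_add[OF assms(1)]
    unfolding coboundary_def by (intro exI[of _ "\<lambda>A. \<eta> A + \<eta>' A"]) auto
qed

lemma coboundary_mult:
  assumes "submod S J" "submod S K" "coboundary W k J K \<omega>" "s \<in> S"
  shows "coboundary W k J K (\<lambda>A. s * \<omega> A)"
proof -
  obtain \<eta> where \<eta>: "\<forall>A. \<eta> A \<in> J" "\<forall>A. A \<subseteq> W \<and> card A = k \<longrightarrow> \<omega> A - koszul_d \<eta> A \<in> K"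
    using assms unfolding coboundary_def by blast
  then have "\<forall>A. A \<subseteq> W \<and> card A = k \<longrightarrow> s * \<omega> A - koszul_d (\<lambda>A. s * \<eta> A) A \<in> K"
    using submod_mult[OF assms(2,4)] by (simp add: koszul_d_mult flip: right_diff_distrib)
  then show ?thesis using \<eta> submod_mult[OF assms(1,4)]
    unfolding coboundary_def by (intro exI[of _ "\<lambda>A. s * \<eta> A"]) auto
qed

lemma coboundary_zero:
  assumes "submod S J" "submod S K"
  shows "coboundary W k J K (\<lambda>A. 0)"
  unfolding coboundary_def
  by (rule exI[of _ "\<lambda>A. 0"]) (use assms in \<open>auto simp: koszul_d_def submod_0\<close>)

lemma add_mult_submod:
  assumes "submod S J" "submod S K"
  shows "submod S (add_mult J K f)"
  unfolding submod_def add_mult_def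
proof (intro conjI ballI)
  show "0 \<in> {p + f * q |p q. p \<in> K \<and> q \<in> J}"
    using submod_0[OF assms(1)] submod_0[OF assms(2)] by force
next
  fix a b assume "a \<in> {p + f * q |p q. p \<in> K \<and> q \<in> J}" "b \<in> {p + f * q |p q. p \<in> K \<and> q \<in> J}"
  then obtain p q p' q' where "a = p + f * q" "b = p' + f * q'" "p \<in> K" "q \<in> J" "p' \<in> K" "q' \<in> J"
    by blast
  then show "a + b \<in> {p + f * q |p q. p \<in> K \<and> q \<in> J}"
    using submod_add[OF assms(1)] submod_add[OF assms(2)]
    by (intro CollectI exI[of _ "p + p'"] exI[of _ "q + q'"]) (auto simp: algebra_simps)
next
  fix s a assume "s \<in> S" "a \<in> {p + f * q |p q. p \<in> K \<and> q \<in> J}"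
  then obtain p q where "a = p + f * q" "p \<in> K" "q \<in> J" by blast
  then show "s * a \<in> {p + f * q |p q. p \<in> K \<and> q \<in> J}"
    using submod_mult[OF assms(1) \<open>s \<in> S\<close>] submod_mult[OF assms(2) \<open>s \<in> S\<close>]
    by (intro CollectI exI[of _ "s * p"] exI[of _ "s * q"]) (auto simp: algebra_simps)
qed

text \<open>
  This is the piece \<open>H\<^sup>k\<^sup>-\<^sup>1(J/(K + fJ)) \<rightarrow> H\<^sup>k(J/K) \<rightarrow> H\<^sup>k(J/K)\<close> of the long exact sequence, the last
  map being multiplication by \<open>f\<close>. It is injective since the first group vanishes, and zero since
  \<open>f\<close> kills cohomology. In degree zero, injectivity is the regularity of \<open>f\<close> itself.
\<close>

lemma exact_lift:
  assumes J: "submod S J" and K: "submod S K" and WV: "W \<subseteq> V"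
    and reg: "\<And>y. y \<in> J \<Longrightarrow> f * y \<in> K \<Longrightarrow> y \<in> K" 
    and kill: "\<And>\<omega>. cocycle W k J K \<omega> \<Longrightarrow> coboundary W k J K (\<lambda>A. f * \<omega> A)"
    and prev: "\<And>k'. k = Suc k' \<Longrightarrow> koszul_exact W k' J (add_mult J K f)"
  shows "koszul_exact W k J K"
  unfolding koszul_exact_def
proof (intro allI impI)
  fix \<omega> assume \<omega>: "cocycle W k J K \<omega>"
  then obtain \<eta> where \<eta>J: "\<forall>A. \<eta> A \<in> J"
    and \<eta>: "\<And>A. A \<subseteq> W \<Longrightarrow> card A = k \<Longrightarrow> f * \<omega> A - koszul_d \<eta> A \<in> K"
    using kill[OF \<omega>] unfolding coboundary_def by blast
  show "coboundary W k J K \<omega>"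
  proof (cases k)
    case 0
    have "\<omega> A - koszul_d (\<lambda>A. 0) A \<in> K" if "A \<subseteq> W" "card A = k" for A
    proof -
      have "A = {}" using that 0 WV finite_sub[of A] by auto
      then have "f * \<omega> A \<in> K" using \<eta>[OF that] by (simp add: koszul_d_def)
      then show ?thesis using reg \<omega> by (auto simp: cocycle_def koszul_d_def)
    qed
    then show ?thesis using submod_0[OF J] unfolding coboundary_def by auto
  next
    case (Suc k')
    have "koszul_d \<eta> A \<in> add_mult J K f" if "A \<subseteq> W" "card A = Suc k'" for A
    proof -
      have "koszul_d \<eta> A = - (f * \<omega> A - koszul_d \<eta> A) + f * \<omega> A" by simp
      then show ?thesis
        using neg_mem[OF K \<eta>] that Suc \<omega> unfolding add_mult_def cocycle_def by blast
    qed
    then have "cocycle W k' J (add_mult J K f) \<eta>"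
      using \<eta>J by (auto simp: cocycle_def)
    from koszul_exactD[OF prev[OF Suc] this] obtain \<zeta> where \<zeta>: "\<And>A. \<zeta> A \<in> J"
      "\<And>A. A \<subseteq> W \<Longrightarrow> card A = k' \<Longrightarrow> \<eta> A - koszul_d \<zeta> A \<in> add_mult J K f"
      by metis
    have "\<exists>p q. A \<subseteq> W \<longrightarrow> card A = k' \<longrightarrow> p \<in> K \<and> q \<in> J \<and> \<eta> A - koszul_d \<zeta> A = p + f * q" for A
      using \<zeta>(2)[of A] unfolding add_mult_def by blast
    then obtain \<kappa> \<theta> where *: "\<And>A. A \<subseteq> W \<Longrightarrow> card A = k' \<Longrightarrow>
        \<kappa> A \<in> K \<and> \<theta> A \<in> J \<and> \<eta> A - koszul_d \<zeta> A = \<kappa> A + f * \<theta> A"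
      by metis
    \<comment> \<open>outside the relevant sets the chosen values are arbitrary, so they are replaced by zero\<close>
  define \<theta>' where "\<theta>' A = (if A \<subseteq> W \<and> card A = k' then \<theta> A else 0)" for A
    define \<kappa>' where "\<kappa>' A = (if A \<subseteq> W \<and> card A = k' then \<kappa> A else 0)" for A
    have \<theta>'J: "\<theta>' A \<in> J" for A using * submod_0[OF J] by (auto simp: \<theta>'_def)
    have \<kappa>'K: "\<kappa>' A \<in> K" for A using * submod_0[OF K] by (auto simp: \<kappa>'_def)
    have "\<omega> A - koszul_d \<theta>' A \<in> K" if A: "A \<subseteq> W" "card A = k" for A
    proof -
      have AV: "A \<subseteq> V" using A WV by blast
      have "koszul_d \<eta> A = koszul_d (\<lambda>B. (\<kappa>' B + f * \<theta>' B) + koszul_d \<zeta> B) A"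
        unfolding koszul_d_def[of \<eta>] koszul_d_def[of "\<lambda>B. (\<kappa>' B + f * \<theta>' B) + koszul_d \<zeta> B"]
      proof (rule sum.cong)
        fix i assume "i \<in> A"
        then have "A - {i} \<subseteq> W" "card (A - {i}) = k'"
          using A Suc finite_sub[OF AV] by auto
        then show "ksign i A * x i * \<eta> (A - {i}) =
           ksign i A * x i * (\<kappa>' (A - {i}) + f * \<theta>' (A - {i}) + koszul_d \<zeta> (A - {i}))"
          using *[of "A - {i}"] by (simp add: \<theta>'_def \<kappa>'_def algebra_simps)
      qed simp
      then have "koszul_d \<eta> A = koszul_d \<kappa>' A + f * koszul_d \<theta>' A"
        by (simp add: koszul_d_add koszul_d_mult koszul_d_square[OF AV])
      then have "f * (\<omega> A - koszul_d \<theta>' A) = (f * \<omega> A - koszul_d \<eta> A) + koszul_d \<kappa>' A"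
        by (simp add: algebra_simps)
      then have "f * (\<omega> A - koszul_d \<theta>' A) \<in> K"
        using \<eta>[OF A] koszul_d_mem[OF K AV \<kappa>'K] submod_add[OF K] by auto
      moreover have "\<omega> A - koszul_d \<theta>' A \<in> J"
        using \<omega> koszul_d_mem[OF J AV \<theta>'J] diff_mem[OF J] by (auto simp: cocycle_def)
      ultimately show ?thesis using reg by blast
    qed
    then show ?thesis using \<theta>'J unfolding coboundary_def by blast
  qed
qed

lemma exact_of_regular_sequence:
  assumes J: "submod S J" and K: "submod S K"
    and "reg_on J K fs" "k < length fs"
    and kill: "\<And>f k K \<omega>. f \<in> set fs \<Longrightarrow> submod S K \<Longrightarrow> cocycle V k J K \<omega> \<Longrightarrow>
      coboundary V k J K (\<lambda>A. f * \<omega> A)"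
  shows "koszul_exact V k J K"
  using assms(2-)
proof (induction fs arbitrary: K k)
  case Nil
  then show ?case by simp
next
  case (Cons f fs)
  show ?case
  proof (rule exact_lift[OF J Cons.prems(1), of _ f])
    show "koszul_exact V k' J (add_mult J K f)" if "k = Suc k'" for k'
      by (rule Cons.IH[OF add_mult_submod[OF J Cons.prems(1)]])
        (use Cons.prems that in auto)
  qed (use Cons.prems in auto)
qed

text \<open>
  The complex on \<open>W \<union> {v}\<close> is the mapping cone of \<open>x\<^sub>v\<close> on the complex on \<open>W\<close>. If the cone is exact
  in degree \<open>k + 1\<close>, then \<open>x\<^sub>v\<close> is surjective on the cohomology of \<open>W\<close> in degree \<open>k\<close>: a cocycle \<open>b\<close>
  becomes the cocycle \<open>(0, b)\<close> of the cone, and a primitive of the latter exhibits \<open>b\<close> as \<open>x\<^sub>v a\<close>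
  up to a coboundary.
\<close>

lemma exact_imp_divisible:
  assumes J: "submod S J" and K: "submod S K" and W: "insert v W \<subseteq> V" "v \<notin> W"
    and ex: "koszul_exact (insert v W) (Suc k) J K"
    and b: "cocycle W k J K b"
  obtains a b' where "cocycle W k J K a" "\<And>A. b' A \<in> J"
    "\<And>A. A \<subseteq> W \<Longrightarrow> card A = k \<Longrightarrow> b A - x v * a A - koszul_d b' A \<in> K"
proof -
  define \<omega> where "\<omega> A = (if v \<in> A then ksign v A * b (A - {v}) else 0)" for A
  have "koszul_d \<omega> B \<in> K" if B: "B \<subseteq> insert v W" "card B = Suc (Suc k)" for B
  proof (cases "v \<in> B")
    case False
    then have "koszul_d \<omega> B = 0" by (simp add: koszul_d_def \<omega>_def)
    then show ?thesis using submod_0[OF K] by simp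
  next
    case True
    define A where "A = B - {v}"
    have A: "B = insert v A" "v \<notin> A" "A \<subseteq> W" "A \<subseteq> V" using True B W by (auto simp: A_def)
    then have fin: "finite A" using finite_sub by blast
    have "koszul_d \<omega> B = (\<Sum>i\<in>A. ksign i (insert v A) * x i * \<omega> (insert v (A - {i})))"
      unfolding A(1) koszul_d_insert[OF A(4,2)] using A by (simp add: \<omega>_def)
    also have "\<dots> = (\<Sum>i\<in>A. - (ksign v A * (ksign i A * x i * b (A - {i}))))"
    proof (rule sum.cong)
      fix i assume i: "i \<in> A"
      have "insert v (A - {i}) - {v} = A - {i}" using A by auto
      then have "ksign i (insert v A) * x i * \<omega> (insert v (A - {i})) =
         ksign v A * (ksign v A * ksign i (insert v A)) * ksign v (A - {i}) * x i * b (A - {i})"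
        by (simp add: \<omega>_def mult_ac)
      then show "ksign i (insert v A) * x i * \<omega> (insert v (A - {i})) =
         - (ksign v A * (ksign i A * x i * b (A - {i})))"
        unfolding ksign_swap[OF fin i A(2)] by (simp add: mult_ac)
    qed simp
    also have "\<dots> = - (ksign v A * koszul_d b A)"
      by (simp add: koszul_d_def sum_negf sum_distrib_left)
    finally have "koszul_d \<omega> B = - (ksign v A * koszul_d b A)" .
    moreover have "koszul_d b A \<in> K" using b A B fin by (auto simp: cocycle_def)
    ultimately show ?thesis using neg_mem[OF K] ksign_mem[OF K] by metis
  qed
  moreover have "\<omega> A \<in> J" for A
    using b J by (auto simp: \<omega>_def cocycle_def ksign_mem submod_0)
  ultimately have "cocycle (insert v W) (Suc k) J K \<omega>" by (auto simp: cocycle_def)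
  from koszul_exactD[OF ex this] obtain \<eta> where \<eta>J: "\<And>A. \<eta> A \<in> J"
    and \<eta>: "\<And>A. A \<subseteq> insert v W \<Longrightarrow> card A = Suc k \<Longrightarrow> \<omega> A - koszul_d \<eta> A \<in> K"
    by metis
  define b' where "b' A = - (ksign v A * \<eta> (insert v A))" for A
  show ?thesis
  proof
    have "koszul_d \<eta> A \<in> K" if "A \<subseteq> W" "card A = Suc k" for A
    proof -
      have "\<omega> A = 0" using that W by (auto simp: \<omega>_def)
      then show ?thesis using \<eta>[of A] neg_mem[OF K, of "- koszul_d \<eta> A"] that by auto
    qed
    then show "cocycle W k J K \<eta>" using \<eta>J by (auto simp: cocycle_def)
    show "b' A \<in> J" for A unfolding b'_def using \<eta>J neg_mem[OF J] ksign_mem[OF J] by blast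
    fix A assume A: "A \<subseteq> W" "card A = k"
    have AV: "A \<subseteq> V" and vA: "v \<notin> A" and fin: "finite A" using A W finite_sub by blast+
    have "insert v A - {v} = A" using vA by auto
    then have "ksign v A * (\<omega> (insert v A) - koszul_d \<eta> (insert v A)) = b A - x v * \<eta> A -
       (\<Sum>i\<in>A. (ksign v A * ksign i (insert v A)) * x i * \<eta> (insert v (A - {i})))"
      unfolding koszul_d_insert[OF AV vA]
      by (simp add: \<omega>_def algebra_simps sum_distrib_left)
    also have "(\<Sum>i\<in>A. (ksign v A * ksign i (insert v A)) * x i * \<eta> (insert v (A - {i}))) = koszul_d b' A"
      unfolding koszul_d_def
      by (rule sum.cong) (use vA fin in \<open>auto simp: b'_def ksign_swap mult_ac\<close>)
    finally show "b A - x v * \<eta> A - koszul_d b' A \<in> K"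
      using \<eta>[of "insert v A"] A vA fin ksign_mem[OF K] by (metis card_insert_disjoint insert_mono)
  qed
qed

text \<open>
  A Nakayama argument: the cohomology on \<open>W\<close> equals \<open>x\<^sub>v\<^sup>N\<close> times itself for every \<open>N\<close>. The operator
  \<open>T N\<close> stands for truncation at degree \<open>N\<close> in \<open>x\<^sub>v\<close>. For large \<open>N\<close> it fixes a given cocycle and
  kills the part divisible by \<open>x\<^sub>v\<^sup>N\<close>, so only a coboundary remains. Grading thus takes the place of
  finite generation.
\<close>

lemma exact_remove_variable:
  fixes T :: "nat \<Rightarrow> 'a \<Rightarrow> 'a"
  assumes J: "submod S J" and K: "submod S K" and W: "insert v W \<subseteq> V" "v \<notin> W"
    and ex: "koszul_exact (insert v W) (Suc k) J K"
    and T_diff: "\<And>N p q. T N (p - q) = T N p - T N q"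
    and T_x: "\<And>N i p. i \<in> W \<Longrightarrow> T N (x i * p) = x i * T N p"
    and T_high: "\<And>N p. T N (x v ^ N * p) = 0"
    and T_low: "\<And>p. \<exists>N0. \<forall>N\<ge>N0. T N p = p"
    and TJ: "\<And>N p. p \<in> J \<Longrightarrow> T N p \<in> J"
    and TK: "\<And>N p. p \<in> K \<Longrightarrow> T N p \<in> K"
  shows "koszul_exact W k J K"
  unfolding koszul_exact_def
proof (intro allI impI)
  fix b assume b: "cocycle W k J K b"
  have finW: "finite W" using W finite_sub by blast
  have step: "\<exists>a b'. cocycle W k J K a \<and> (\<forall>A. b' A \<in> J) \<and>
      (\<forall>A. A \<subseteq> W \<and> card A = k \<longrightarrow> b A - x v ^ N * a A - koszul_d b' A \<in> K)" for N
  proof (induction N)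
    case 0
    show ?case
      by (rule exI[of _ b], rule exI[of _ "\<lambda>A. 0"])
        (use b J K in \<open>auto simp: koszul_d_def submod_0\<close>)
  next
    case (Suc N)
    then obtain a b' where a: "cocycle W k J K a" and b': "\<forall>A. b' A \<in> J"
      "\<forall>A. A \<subseteq> W \<and> card A = k \<longrightarrow> b A - x v ^ N * a A - koszul_d b' A \<in> K" by blast
    obtain a2 b2 where a2: "cocycle W k J K a2" and b2: "\<And>A. b2 A \<in> J"
      "\<And>A. A \<subseteq> W \<Longrightarrow> card A = k \<Longrightarrow> a A - x v * a2 A - koszul_d b2 A \<in> K"
      using exact_imp_divisible[OF J K W ex a] by metis
    have xS: "x v ^ N \<in> S" by (induction N) (use W x_in one_in S_mult in auto)
    define b3 where "b3 A = b' A + x v ^ N * b2 A" for A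
    have "\<forall>A. b3 A \<in> J" using b' b2 submod_add[OF J] submod_mult[OF J xS] by (auto simp: b3_def)
    moreover have "b A - x v ^ Suc N * a2 A - koszul_d b3 A \<in> K" if A: "A \<subseteq> W" "card A = k" for A
    proof -
      have "b A - x v ^ Suc N * a2 A - koszul_d b3 A =
        (b A - x v ^ N * a A - koszul_d b' A) + x v ^ N * (a A - x v * a2 A - koszul_d b2 A)"
        unfolding b3_def[abs_def] koszul_d_add koszul_d_mult by (simp add: algebra_simps)
      moreover have "b A - x v ^ N * a A - koszul_d b' A \<in> K" using b' A by blast
      ultimately show ?thesis
        using submod_add[OF K] submod_mult[OF K xS b2(2)[OF A]] by metis
    qed
    ultimately show ?case using a2 by blast
  qed
  have "\<exists>N. \<forall>A\<in>Pow W. T N (b A) = b A"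
  proof -
    define N0 where "N0 A = (SOME n. \<forall>N\<ge>n. T N (b A) = b A)" for A
    have N0: "T N (b A) = b A" if "N \<ge> N0 A" for A N
      using someI_ex[OF T_low[of "b A"]] that by (simp add: N0_def)
    have "N0 A \<le> Max (N0 ` Pow W)" if "A \<in> Pow W" for A
      using finW that by (intro Max_ge) auto
    then show ?thesis using N0 by blast
  qed
  then obtain N where N: "\<And>A. A \<subseteq> W \<Longrightarrow> T N (b A) = b A" by blast
  obtain a b' where b': "\<And>A. b' A \<in> J"
      "\<And>A. A \<subseteq> W \<Longrightarrow> card A = k \<Longrightarrow> b A - x v ^ N * a A - koszul_d b' A \<in> K"
    using step[of N] by blast
  have T0: "T N 0 = 0" using T_diff[of N 0 0] by simp
  have T_uminus: "T N (- p) = - T N p" for p using T_diff[of N 0 p] T0 by simp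
  have T_add: "T N (p + q) = T N p + T N q" for p q using T_diff[of N p "- q"] T_uminus by simp
  have T_sum: "T N (sum g A) = (\<Sum>i\<in>A. T N (g i))" for A :: "'v set" and g
    by (induction A rule: infinite_finite_induct) (auto simp: T0 T_add)
  have T_sign: "T N (ksign i A * p) = ksign i A * T N p" for i p and A :: "'v set"
  proof -
    have "T N ((-1) ^ n * p) = (-1) ^ n * T N p" for n by (induction n) (auto simp: T_uminus)
    then show ?thesis by (simp add: ksign_def)
  qed
  have T_koszul_d: "T N (koszul_d b' A) = koszul_d (\<lambda>A. T N (b' A)) A" if "A \<subseteq> W" for A
    unfolding koszul_d_def T_sum
  proof (rule sum.cong)
    fix i assume "i \<in> A"
    then have "i \<in> W" using that by blast
    then show "T N (ksign i A * x i * b' (A - {i})) = ksign i A * x i * T N (b' (A - {i}))"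
      by (simp only: mult.assoc T_sign T_x)
  qed simp
  have "b A - koszul_d (\<lambda>A. T N (b' A)) A \<in> K" if A: "A \<subseteq> W" "card A = k" for A
  proof -
    have "T N (b A - x v ^ N * a A - koszul_d b' A) = b A - koszul_d (\<lambda>A. T N (b' A)) A"
      unfolding T_diff T_high T_koszul_d[OF A(1)] N[OF A(1)] by simp
    then show ?thesis using TK[OF b'(2)[OF A], of N] by simp
  qed
  then show "coboundary W k J K b"
    unfolding coboundary_def
    by (intro exI[of _ "\<lambda>A. T N (b' A)"]) (simp add: TJ b'(1))
qed

end

section \<open>Monomial ideals in polynomial rings\<close>

abbreviation lookup :: "('a \<Rightarrow>\<^sub>0 'b::zero) \<Rightarrow> 'a \<Rightarrow> 'b" where "lookup \<equiv> Poly_Mapping.lookup"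
abbreviation keys :: "('a \<Rightarrow>\<^sub>0 'b::zero) \<Rightarrow> 'a set" where "keys \<equiv> Poly_Mapping.keys"
abbreviation single :: "'a \<Rightarrow> 'b \<Rightarrow> 'a \<Rightarrow>\<^sub>0 'b::zero" where "single \<equiv> Poly_Mapping.single"

lemma poly_mapping_monomials:
  fixes p :: "'a \<Rightarrow>\<^sub>0 'b::comm_monoid_add"
  shows "p = (\<Sum>m\<in>keys p. single m (lookup p m))"
  by (rule poly_mapping_eqI)
    (auto simp: lookup_sum lookup_single when_def not_in_keys_iff_lookup_eq_zero)

lemma lookup_single_mult:
  fixes p :: "'a::cancel_comm_monoid_add \<Rightarrow>\<^sub>0 'b::comm_semiring_0"
  shows "lookup (single a c * p) (a + m) = c * lookup p m"
proof -
  have "lookup (single a c * p) (a + m) =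
     (\<Sum>m'\<in>keys p. lookup (single (a + m') (c * lookup p m')) (a + m))"
    by (subst (1) poly_mapping_monomials[of p])
      (simp add: sum_distrib_left lookup_sum mult_single)
  also have "\<dots> = (\<Sum>m'\<in>keys p. if m' = m then c * lookup p m else 0)"
    by (rule sum.cong) (auto simp: lookup_single when_def)
  also have "\<dots> = c * lookup p m"
    by (auto simp: not_in_keys_iff_lookup_eq_zero)
  finally show ?thesis .
qed

text \<open>
  The part of a polynomial whose monomials satisfy a predicate. It provides the homogeneous
  components and the truncations with respect to any grading.
\<close>

lift_definition restrict_keys :: "('a \<Rightarrow> bool) \<Rightarrow> ('a \<Rightarrow>\<^sub>0 'b::zero) \<Rightarrow> ('a \<Rightarrow>\<^sub>0 'b)"
  is "\<lambda>P f k. if P k then f k else 0"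
  by (erule rev_finite_subset) auto

lemma lookup_restrict_keys: "lookup (restrict_keys P p) k = (if P k then lookup p k else 0)"
  by transfer simp

lemma keys_restrict_keys: "keys (restrict_keys P p) = {m \<in> keys p. P m}"
  by (auto simp: in_keys_iff lookup_restrict_keys split: if_splits)

lemma restrict_keys_diff:
  "restrict_keys P (p - q) = restrict_keys P p - restrict_keys P (q :: 'a \<Rightarrow>\<^sub>0 'b::ab_group_add)"
  by (rule poly_mapping_eqI) (simp add: lookup_restrict_keys lookup_minus)

lemma restrict_keys_split:
  "restrict_keys P p + restrict_keys (\<lambda>k. \<not> P k) p = (p :: 'a \<Rightarrow>\<^sub>0 'b::monoid_add)"
  by (rule poly_mapping_eqI) (simp add: lookup_restrict_keys lookup_add)

lemma restrict_keys_single_mult: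
  fixes p :: "'a::cancel_comm_monoid_add \<Rightarrow>\<^sub>0 'b::comm_semiring_0"
  assumes "\<And>m. P (a + m) \<longleftrightarrow> Q m"
  shows "restrict_keys P (single a c * p) = single a c * restrict_keys Q p"
proof (rule poly_mapping_eqI)
  fix k
  show "lookup (restrict_keys P (single a c * p)) k =
    lookup (single a c * restrict_keys Q p) k"
  proof (cases "\<exists>m. k = a + m")
    case True
    then show ?thesis by (auto simp: lookup_restrict_keys lookup_single_mult assms)
  next
    case False
    have "lookup (single a c * r) k = 0" for r :: "'a \<Rightarrow>\<^sub>0 'b"
      using keys_mult[of "single a c" r] False
      by (auto simp: not_in_keys_iff_lookup_eq_zero[symmetric] split: if_splits)
    then show ?thesis by (simp add: lookup_restrict_keys)
  qed
qed

definition wdeg :: "('v \<Rightarrow> nat) \<Rightarrow> ('v \<Rightarrow>\<^sub>0 nat) \<Rightarrow> nat" where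
  "wdeg w m = (\<Sum>v\<in>keys m. w v * lookup m v)"

lemma wdeg_add [simp]: "wdeg w (m + m') = wdeg w m + wdeg w m'"
  unfolding wdeg_def
  by (rule setsum_keys_plus_distrib) (auto simp: distrib_left)

lemma wdeg_single [simp]: "wdeg w (single v k) = w v * k"
  by (simp add: wdeg_def)

lemma wdeg_zero [simp]: "wdeg w 0 = 0"
  by (simp add: wdeg_def)

lemma wdeg_eq_0_iff: "wdeg w m = 0 \<longleftrightarrow> (\<forall>v\<in>keys m. w v = 0)"
  by (auto simp: wdeg_def in_keys_iff)

lemma wdeg_cong: "(\<And>v. v \<in> keys m \<Longrightarrow> w v = w' v) \<Longrightarrow> wdeg w m = wdeg w' m"
  by (simp add: wdeg_def)

text \<open>
  The product of the components of lowest weight is nonzero, since there are no zero divisors, and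
  it is the component of lowest weight of the product. Applied to the weight that counts the
  variables of a set, this shows that monomial primes are prime and that a symbolic power can be
  tested on single monomials.
\<close>

lemma low_weight_in_product:
  fixes s p :: "('v::linorder \<Rightarrow>\<^sub>0 nat) \<Rightarrow>\<^sub>0 'k::idom"
  assumes "\<exists>m\<in>keys s. wdeg w m = 0" "\<exists>m\<in>keys p. wdeg w m < d"
  shows "\<exists>m\<in>keys (s * p). wdeg w m < d"
proof -
  define e where "e = Min (wdeg w ` keys p)"
  have ne: "wdeg w ` keys p \<noteq> {}" using assms(2) by auto
  have e_le: "e \<le> wdeg w m" if "m \<in> keys p" for m
    unfolding e_def using that by (intro Min_le) auto
  have "e \<in> wdeg w ` keys p" unfolding e_def using ne by (intro Min_in) auto
  then obtain m0 where m0: "m0 \<in> keys p" "wdeg w m0 = e" by blast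
  have "e < d" using assms(2) e_le by fastforce
  define s0 s1 where "s0 = restrict_keys (\<lambda>m. wdeg w m = 0) s"
    and "s1 = restrict_keys (\<lambda>m. wdeg w m \<noteq> 0) s"
  define p0 p1 where "p0 = restrict_keys (\<lambda>m. wdeg w m = e) p"
    and "p1 = restrict_keys (\<lambda>m. wdeg w m \<noteq> e) p"
  have "keys s0 \<noteq> {}" "keys p0 \<noteq> {}"
    using assms(1) m0 by (auto simp: s0_def p0_def keys_restrict_keys)
  then have "s0 * p0 \<noteq> 0" by auto
  then obtain k where k: "k \<in> keys (s0 * p0)" by (metis ex_in_conv keys_eq_empty)
  have key: "\<exists>a b. m = a + b \<and> a \<in> keys f \<and> b \<in> keys g"
    if "m \<in> keys (f * g)" for m and f g :: "('v \<Rightarrow>\<^sub>0 nat) \<Rightarrow>\<^sub>0 'k"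
    using keys_mult that by blast
  have wk: "wdeg w k = e"
    using key[OF k] by (auto simp: s0_def p0_def keys_restrict_keys)
  have "k \<notin> keys (s0 * p1)"
  proof
    assume "k \<in> keys (s0 * p1)"
    then obtain a b where "k = a + b" "wdeg w a = 0" "wdeg w b \<noteq> e"
      using key[of k s0 p1] by (auto simp: s0_def p1_def keys_restrict_keys)
    then show False using wk by simp
  qed
  moreover have "k \<notin> keys (s1 * p)"
  proof
    assume "k \<in> keys (s1 * p)"
    then obtain a b where "k = a + b" "wdeg w a \<noteq> 0" "b \<in> keys p"
      using key[of k s1 p] by (auto simp: s1_def keys_restrict_keys)
    then show False using wk e_le[of b] by simp
  qed
  moreover have "s * p = s0 * p0 + (s0 * p1 + s1 * p)"
  proof -
    have "s * p = (s0 + s1) * p" unfolding s0_def s1_def by (simp only: restrict_keys_split)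
    also have "\<dots> = s0 * p + s1 * p" by (rule distrib_right)
    also have "s0 * p = s0 * (p0 + p1)" unfolding p0_def p1_def by (simp only: restrict_keys_split)
    also have "\<dots> = s0 * p0 + s0 * p1" by (rule distrib_left)
    finally show ?thesis by (simp only: add.assoc)
  qed
  ultimately have "k \<in> keys (s * p)"
    using k by (simp add: in_keys_iff lookup_add)
  then show ?thesis using wk \<open>e < d\<close> by blast
qed

lemma mpoly_ring_simps [simp]:
  "p \<otimes>\<^bsub>mpoly_ring V\<^esub> q = p * q" "p \<oplus>\<^bsub>mpoly_ring V\<^esub> q = p + q"
  "\<one>\<^bsub>mpoly_ring V\<^esub> = 1" "\<zero>\<^bsub>mpoly_ring V\<^esub> = 0"
  by (simp_all add: mpoly_ring_def)

lemma mpoly_carrier: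
  "p \<in> carrier (mpoly_ring V) \<longleftrightarrow> (\<forall>m\<in>keys p. keys m \<subseteq> V)"
  by (simp add: mpoly_ring_def)

lemma keys_add_nat: "keys (m + m') = keys m \<union> keys (m' :: 'v \<Rightarrow>\<^sub>0 nat)"
  by (auto simp: in_keys_iff lookup_add)

lemma mpoly_carrier_add: "p \<in> carrier (mpoly_ring V) \<Longrightarrow> q \<in> carrier (mpoly_ring V) \<Longrightarrow> p + q \<in> carrier (mpoly_ring V)"
  unfolding mpoly_carrier using keys_add[of p q] by blast

lemma mpoly_carrier_mult: "p \<in> carrier (mpoly_ring V) \<Longrightarrow> q \<in> carrier (mpoly_ring V) \<Longrightarrow> p * q \<in> carrier (mpoly_ring V)"
  unfolding mpoly_carrier using keys_mult[of p q] by (fastforce simp: keys_add_nat)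

lemma mpoly_carrier_single [simp]:
  "single m c \<in> carrier (mpoly_ring V) \<longleftrightarrow> c = 0 \<or> keys m \<subseteq> V"
  by (auto simp: mpoly_carrier)

lemma keys_uminus: "keys (- p) = keys (p :: 'a \<Rightarrow>\<^sub>0 'b::ab_group_add)"
  by (auto simp: in_keys_iff)

lemma mpoly_carrier_uminus: "p \<in> carrier (mpoly_ring V) \<Longrightarrow> - p \<in> carrier (mpoly_ring V)"
  by (simp add: mpoly_carrier keys_uminus)

lemma mpoly_cring: "cring (mpoly_ring V :: (('v \<Rightarrow>\<^sub>0 nat) \<Rightarrow>\<^sub>0 'k::field) ring)"
proof (rule cringI)
  show "abelian_group (mpoly_ring V :: (('v \<Rightarrow>\<^sub>0 nat) \<Rightarrow>\<^sub>0 'k) ring)"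
  proof (rule abelian_groupI)
    show "\<exists>q\<in>carrier (mpoly_ring V). q \<oplus>\<^bsub>mpoly_ring V\<^esub> p = \<zero>\<^bsub>mpoly_ring V\<^esub>"
      if "p \<in> carrier (mpoly_ring V :: (('v \<Rightarrow>\<^sub>0 nat) \<Rightarrow>\<^sub>0 'k) ring)" for p
      using mpoly_carrier_uminus[OF that] by force
  qed (auto simp: mpoly_carrier_add add.assoc add.commute, auto simp: mpoly_carrier)
  show "Group.comm_monoid (mpoly_ring V :: (('v \<Rightarrow>\<^sub>0 nat) \<Rightarrow>\<^sub>0 'k) ring)"
    by (rule comm_monoidI)
      (auto simp: mpoly_carrier_mult mult_ac, auto simp: mpoly_carrier)
qed (simp add: distrib_right)

lemma mpoly_uminus:
  fixes p :: "('v \<Rightarrow>\<^sub>0 nat) \<Rightarrow>\<^sub>0 'k::field"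
  assumes "p \<in> carrier (mpoly_ring V)"
  shows "\<ominus>\<^bsub>mpoly_ring V\<^esub> p = - p"
proof -
  interpret cring "mpoly_ring V :: (('v \<Rightarrow>\<^sub>0 nat) \<Rightarrow>\<^sub>0 'k) ring" by (rule mpoly_cring)
  show ?thesis by (rule minus_equality) (use assms mpoly_carrier_uminus in auto)
qed

lemma mpoly_minus:
  fixes p q :: "('v \<Rightarrow>\<^sub>0 nat) \<Rightarrow>\<^sub>0 'k::field"
  assumes "q \<in> carrier (mpoly_ring V)"
  shows "p \<ominus>\<^bsub>mpoly_ring V\<^esub> q = p - q"
  using assms by (simp add: a_minus_def mpoly_uminus)

lemma mpoly_idealI:
  fixes I :: "(('v \<Rightarrow>\<^sub>0 nat) \<Rightarrow>\<^sub>0 'k::field) set"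
  assumes "I \<subseteq> carrier (mpoly_ring V)" "0 \<in> I" "\<And>p q. p \<in> I \<Longrightarrow> q \<in> I \<Longrightarrow> p + q \<in> I"
    "\<And>r p. r \<in> carrier (mpoly_ring V) \<Longrightarrow> p \<in> I \<Longrightarrow> r * p \<in> I"
  shows "ideal I (mpoly_ring V)"
proof -
  interpret cring "mpoly_ring V :: (('v \<Rightarrow>\<^sub>0 nat) \<Rightarrow>\<^sub>0 'k) ring" by (rule mpoly_cring)
  have neg: "- p \<in> I" if "p \<in> I" for p
  proof -
    have "-1 \<in> carrier (mpoly_ring V :: (('v \<Rightarrow>\<^sub>0 nat) \<Rightarrow>\<^sub>0 'k) ring)"
      using mpoly_carrier_uminus[OF one_closed] by simp
    then show ?thesis using assms(4)[of "-1" p] that by simp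
  qed
  show ?thesis
  proof (rule idealI)
    show "subgroup I (add_monoid (mpoly_ring V))"
    proof (rule add.subgroupI)
      show "I \<noteq> {}" using assms by blast
      show "\<ominus>\<^bsub>mpoly_ring V\<^esub> p \<in> I" if "p \<in> I" for p
        using that neg mpoly_uminus[of p V] assms(1) by auto
    qed (use assms in auto)
    show "p \<otimes>\<^bsub>mpoly_ring V\<^esub> r \<in> I" if "p \<in> I" "r \<in> carrier (mpoly_ring V)" for p r
      using assms(4)[OF that(2,1)] by (simp add: mult.commute)
  qed (use assms in \<open>auto simp: ring_axioms\<close>)
qed

lemma mpoly_ideal_submod:
  assumes "ideal I (mpoly_ring V)"
  shows "submod (carrier (mpoly_ring V)) I"
proof -
  interpret ideal I "mpoly_ring V" by fact
  show ?thesis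
    using I_l_closed additive_subgroup.a_closed[OF is_additive_subgroup]
      additive_subgroup.zero_closed[OF is_additive_subgroup] by (auto simp: submod_def)
qed

text \<open>The span of a set of monomials, which is an ideal if the set is closed under multiplication.\<close>

definition mono_ideal :: "'v set \<Rightarrow> (('v \<Rightarrow>\<^sub>0 nat) \<Rightarrow> bool) \<Rightarrow> (('v \<Rightarrow>\<^sub>0 nat) \<Rightarrow>\<^sub>0 'k::field) set" where
  "mono_ideal V X = {p \<in> carrier (mpoly_ring V). \<forall>m\<in>keys p. X m}"

lemma mono_ideal_ideal:
  assumes "\<And>m m'. X m \<Longrightarrow> X (m' + m)"
  shows "ideal (mono_ideal V X :: (('v \<Rightarrow>\<^sub>0 nat) \<Rightarrow>\<^sub>0 'k::field) set) (mpoly_ring V)"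
proof (rule mpoly_idealI)
  show "0 \<in> (mono_ideal V X :: (('v \<Rightarrow>\<^sub>0 nat) \<Rightarrow>\<^sub>0 'k) set)"
    by (auto simp: mono_ideal_def mpoly_carrier)
  show "p + q \<in> mono_ideal V X" if "p \<in> mono_ideal V X" "q \<in> mono_ideal V X"
    for p q :: "('v \<Rightarrow>\<^sub>0 nat) \<Rightarrow>\<^sub>0 'k"
    using that keys_add[of p q] by (auto simp: mono_ideal_def mpoly_carrier_add)
  show "r * p \<in> mono_ideal V X" if "r \<in> carrier (mpoly_ring V)" "p \<in> mono_ideal V X"
    for r p :: "('v \<Rightarrow>\<^sub>0 nat) \<Rightarrow>\<^sub>0 'k"
    using that keys_mult[of r p] assms by (force simp: mono_ideal_def mpoly_carrier_mult)
qed (auto simp: mono_ideal_def)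

lemma single_in_mono_ideal:
  "single m c \<in> mono_ideal V X \<longleftrightarrow> c = 0 \<or> keys m \<subseteq> V \<and> X m"
  by (auto simp: mono_ideal_def)

lemma restrict_keys_mono_ideal: "p \<in> mono_ideal V X \<Longrightarrow> restrict_keys P p \<in> mono_ideal V X"
  by (auto simp: mono_ideal_def mpoly_carrier keys_restrict_keys)

lemma ideal_contains_if_monomials:
  fixes p :: "('v \<Rightarrow>\<^sub>0 nat) \<Rightarrow>\<^sub>0 'k::field"
  assumes "ideal I (mpoly_ring V)" "\<And>m. m \<in> keys p \<Longrightarrow> single m (lookup p m) \<in> I"
  shows "p \<in> I"
  by (subst poly_mapping_monomials[of p])
    (rule submod_sum[OF mpoly_ideal_submod[OF assms(1)]], rule assms(2))

lemma shift_in_keys: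
  fixes p :: "('v \<Rightarrow>\<^sub>0 nat) \<Rightarrow>\<^sub>0 'k::field"
  assumes "m \<in> keys p"
  shows "a + m \<in> keys (single a 1 * p)"
  using assms by (simp add: in_keys_iff lookup_single_mult)

lemma mono_ideal_single_mult:
  fixes p :: "('v \<Rightarrow>\<^sub>0 nat) \<Rightarrow>\<^sub>0 'k::field"
  assumes "p \<in> carrier (mpoly_ring V)" "keys a \<subseteq> V"
  shows "single a 1 * p \<in> mono_ideal V X \<longleftrightarrow> (\<forall>m\<in>keys p. X (a + m))"
proof
  assume "single a 1 * p \<in> mono_ideal V X"
  then show "\<forall>m\<in>keys p. X (a + m)"
    using shift_in_keys[of _ p a] by (auto simp: mono_ideal_def)
next
  assume "\<forall>m\<in>keys p. X (a + m)"
  then show "single a 1 * p \<in> mono_ideal V X"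
    using assms keys_mult[of "single a 1" p]
    by (auto simp: mono_ideal_def intro!: mpoly_carrier_mult)
qed

subsection \<open>Primes generated by variables\<close>

text \<open>The prime generated by the variables outside \<open>F\<close>, so that its residue ring has dimension \<open>|F|\<close>.\<close>

definition var_prime :: "'v set \<Rightarrow> 'v set \<Rightarrow> (('v \<Rightarrow>\<^sub>0 nat) \<Rightarrow>\<^sub>0 'k::field) set" where
  "var_prime V F = mono_ideal V (\<lambda>m. \<not> keys m \<subseteq> F)"

lemma var_prime_primeideal:
  "primeideal (var_prime V F :: (('v::linorder \<Rightarrow>\<^sub>0 nat) \<Rightarrow>\<^sub>0 'k::field) set) (mpoly_ring V)"
proof (rule primeidealI)
  show "ideal (var_prime V F :: (('v \<Rightarrow>\<^sub>0 nat) \<Rightarrow>\<^sub>0 'k) set) (mpoly_ring V)"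
    unfolding var_prime_def by (rule mono_ideal_ideal) (auto simp: keys_add_nat)
  show "cring (mpoly_ring V :: (('v \<Rightarrow>\<^sub>0 nat) \<Rightarrow>\<^sub>0 'k) ring)" by (rule mpoly_cring)
  have "(1 :: ('v \<Rightarrow>\<^sub>0 nat) \<Rightarrow>\<^sub>0 'k) \<in> carrier (mpoly_ring V)" by (simp add: mpoly_carrier)
  moreover have "(1 :: ('v \<Rightarrow>\<^sub>0 nat) \<Rightarrow>\<^sub>0 'k) \<notin> var_prime V F"
    by (simp add: var_prime_def mono_ideal_def)
  ultimately show "carrier (mpoly_ring V) \<noteq> (var_prime V F :: (('v \<Rightarrow>\<^sub>0 nat) \<Rightarrow>\<^sub>0 'k) set)" by blast
  fix a b :: "('v \<Rightarrow>\<^sub>0 nat) \<Rightarrow>\<^sub>0 'k"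
  assume ab: "a \<in> carrier (mpoly_ring V)" "b \<in> carrier (mpoly_ring V)"
    "a \<otimes>\<^bsub>mpoly_ring V\<^esub> b \<in> var_prime V F"
  have w: "keys m \<subseteq> F \<longleftrightarrow> wdeg (\<lambda>v. of_bool (v \<notin> F)) m = 0" for m
    by (auto simp: wdeg_eq_0_iff)
  show "a \<in> var_prime V F \<or> b \<in> var_prime V F"
  proof (rule ccontr)
    assume "\<not> ?thesis"
    then have "\<exists>m\<in>keys a. keys m \<subseteq> F" "\<exists>m\<in>keys b. keys m \<subseteq> F"
      using ab by (auto simp: var_prime_def mono_ideal_def)
    then have "\<exists>m\<in>keys (a * b). keys m \<subseteq> F"
      using low_weight_in_product[of a "\<lambda>v. of_bool (v \<notin> F)" b 1] by (simp add: w)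
    then show False using ab by (auto simp: var_prime_def mono_ideal_def)
  qed
qed

lemma mpoly_var_mult: "mpoly_var v * p = single (single v 1) 1 * p"
  by (simp add: mpoly_var_def)

lemma mpoly_var_in: "mpoly_var v \<in> carrier (mpoly_ring V) \<longleftrightarrow> v \<in> V"
  by (simp add: mpoly_var_def)

lemma mpoly_var_in_var_prime: "v \<in> V \<Longrightarrow> mpoly_var v \<in> var_prime V F \<longleftrightarrow> v \<notin> F"
  by (simp add: mpoly_var_def var_prime_def single_in_mono_ideal)

lemma monomial_in_prime:
  fixes P :: "(('v \<Rightarrow>\<^sub>0 nat) \<Rightarrow>\<^sub>0 'k::field) set"
  assumes "primeideal P (mpoly_ring V)"
  shows "keys m \<subseteq> V \<Longrightarrow> single m 1 \<in> P \<Longrightarrow> \<exists>v\<in>keys m. mpoly_var v \<in> P"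
proof (induction "wdeg (\<lambda>_. 1) m" arbitrary: m)
  case 0
  interpret primeideal P "mpoly_ring V" by fact
  have "m = 0" using 0(1) wdeg_eq_0_iff[of "\<lambda>_. 1" m] by simp
  then have "\<one>\<^bsub>mpoly_ring V\<^esub> \<in> P" using 0(3) by simp
  then show ?case using one_imp_carrier I_notcarr by simp
next
  case (Suc n)
  interpret primeideal P "mpoly_ring V" by fact
  obtain v where v: "v \<in> keys m" using Suc(2) by (metis wdeg_eq_0_iff nat.distinct(1))
  define m' where "m' = m - single v 1"
  have m: "m = single v 1 + m'"
    using v by (intro poly_mapping_eqI) (auto simp: m'_def lookup_add lookup_minus lookup_single when_def in_keys_iff)
  have keys: "keys m' \<subseteq> keys m" "v \<in> V"
    using m v Suc(3) by (auto simp: keys_add_nat)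
  have eq: "single m 1 = mpoly_var v * (single m' 1 :: ('v \<Rightarrow>\<^sub>0 nat) \<Rightarrow>\<^sub>0 'k)"
    by (simp add: mpoly_var_def mult_single m)
  have "mpoly_var v \<in> P \<or> single m' 1 \<in> P"
    using I_prime[of "mpoly_var v" "single m' 1"] Suc(3,4) keys
    by (auto simp: mpoly_var_in eq)
  moreover have "n = wdeg (\<lambda>_. 1) m'" using Suc(2) by (subst (asm) m) simp
  ultimately have "mpoly_var v \<in> P \<or> (\<exists>u\<in>keys m'. mpoly_var u \<in> P)"
    using Suc(1)[OF _ subset_trans[OF keys(1) Suc(3)]] by auto
  then show ?case using keys(1) v by auto
qed

section \<open>Quotients of ideals\<close>

locale ideal_pair =
  fixes V :: "'v::linorder set" and J K :: "(('v \<Rightarrow>\<^sub>0 nat) \<Rightarrow>\<^sub>0 'k::field) set"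
  assumes J: "ideal J (mpoly_ring V)" and K: "ideal K (mpoly_ring V)" and KJ: "K \<subseteq> J"
begin

abbreviation R :: "(('v \<Rightarrow>\<^sub>0 nat) \<Rightarrow>\<^sub>0 'k) ring" where "R \<equiv> mpoly_ring V"
abbreviation M :: "(('v \<Rightarrow>\<^sub>0 nat) \<Rightarrow>\<^sub>0 'k, (('v \<Rightarrow>\<^sub>0 nat) \<Rightarrow>\<^sub>0 'k) set) module"
  where "M \<equiv> quot_module R J K"

lemmas K_sub = mpoly_ideal_submod[OF K]
lemmas J_sub = mpoly_ideal_submod[OF J]

lemma neg_one_carrier: "- 1 \<in> carrier R"
  by (rule mpoly_carrier_uminus) (simp add: mpoly_carrier)

lemma sub_neg: "submod (carrier R) X \<Longrightarrow> p \<in> X \<Longrightarrow> - p \<in> X"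
  using submod_mult[OF _ neg_one_carrier] by fastforce

lemma sub_diff: "submod (carrier R) X \<Longrightarrow> p \<in> X \<Longrightarrow> q \<in> X \<Longrightarrow> p - q \<in> X"
  using submod_add[of "carrier R" X p "- q"] sub_neg by simp

lemma coset_mem: "y \<in> K +>\<^bsub>R\<^esub> x \<longleftrightarrow> y - x \<in> K"
proof -
  have "y \<in> K +>\<^bsub>R\<^esub> x \<longleftrightarrow> (\<exists>k\<in>K. y = k + x)"
    by (auto simp: a_r_coset_def')
  also have "\<dots> \<longleftrightarrow> y - x \<in> K" by (metis add_diff_cancel diff_add_cancel)
  finally show ?thesis .
qed

lemma coset_eq: "K +>\<^bsub>R\<^esub> x = K +>\<^bsub>R\<^esub> y \<longleftrightarrow> x - y \<in> K"
proof
  assume "K +>\<^bsub>R\<^esub> x = K +>\<^bsub>R\<^esub> y"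
  moreover have "x \<in> K +>\<^bsub>R\<^esub> x" using submod_0[OF K_sub] by (simp add: coset_mem)
  ultimately show "x - y \<in> K" by (simp add: coset_mem)
next
  assume xy: "x - y \<in> K"
  have "z - x \<in> K \<longleftrightarrow> z - y \<in> K" for z
    using submod_add[OF K_sub _ xy, of "z - x"] sub_diff[OF K_sub _ xy, of "z - y"] by auto
  then show "K +>\<^bsub>R\<^esub> x = K +>\<^bsub>R\<^esub> y" by (simp add: set_eq_iff coset_mem)
qed

lemma coset_zero: "K +>\<^bsub>R\<^esub> 0 = K"
  by (simp add: set_eq_iff coset_mem)

lemma coset_eq_zero: "K +>\<^bsub>R\<^esub> x = K \<longleftrightarrow> x \<in> K"
  using coset_eq[of x 0] by (simp add: coset_zero)

lemma coset_add: "(K +>\<^bsub>R\<^esub> x) <+>\<^bsub>R\<^esub> (K +>\<^bsub>R\<^esub> y) = K +>\<^bsub>R\<^esub> (x + y)"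
proof -
  have "z \<in> (K +>\<^bsub>R\<^esub> x) <+>\<^bsub>R\<^esub> (K +>\<^bsub>R\<^esub> y) \<longleftrightarrow> z - (x + y) \<in> K" for z
  proof
    assume "z \<in> (K +>\<^bsub>R\<^esub> x) <+>\<^bsub>R\<^esub> (K +>\<^bsub>R\<^esub> y)"
    then obtain a b where "z = a + b" "a - x \<in> K" "b - y \<in> K"
      by (auto simp: set_add_def' coset_mem)
    then show "z - (x + y) \<in> K"
      using submod_add[OF K_sub, of "a - x" "b - y"] by (simp add: algebra_simps)
  next
    assume "z - (x + y) \<in> K"
    then have "z - y \<in> K +>\<^bsub>R\<^esub> x" "y \<in> K +>\<^bsub>R\<^esub> y"
      using submod_0[OF K_sub] by (simp_all add: coset_mem algebra_simps)
    then show "z \<in> (K +>\<^bsub>R\<^esub> x) <+>\<^bsub>R\<^esub> (K +>\<^bsub>R\<^esub> y)"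
      by (force simp: set_add_def')
  qed
  then show ?thesis by (simp add: set_eq_iff coset_mem)
qed

lemma M_simps [simp]:
  "carrier M = {K +>\<^bsub>R\<^esub> x | x. x \<in> J}" "\<zero>\<^bsub>M\<^esub> = K"
  "(K +>\<^bsub>R\<^esub> x) \<oplus>\<^bsub>M\<^esub> (K +>\<^bsub>R\<^esub> y) = K +>\<^bsub>R\<^esub> (x + y)"
  by (simp_all add: quot_module_def coset_add)

lemma M_smult [simp]:
  assumes "a \<in> carrier R"
  shows "a \<odot>\<^bsub>M\<^esub> (K +>\<^bsub>R\<^esub> x) = K +>\<^bsub>R\<^esub> (a * x)"
proof -
  have "K +>\<^bsub>R\<^esub> (a * y) = K +>\<^bsub>R\<^esub> (a * x)" if "y \<in> K +>\<^bsub>R\<^esub> x" for y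
    using submod_mult[OF K_sub assms, of "y - x"] that
    by (simp add: coset_eq coset_mem right_diff_distrib)
  moreover have "x \<in> K +>\<^bsub>R\<^esub> x" using submod_0[OF K_sub] by (simp add: coset_mem)
  ultimately have "(\<Union>y\<in>K +>\<^bsub>R\<^esub> x. K +>\<^bsub>R\<^esub> (a * y)) = K +>\<^bsub>R\<^esub> (a * x)" by blast
  then show ?thesis by (simp only: quot_module_def module.simps mpoly_ring_simps)
qed

lemma M_abelian_group: "abelian_group M"
proof (rule abelian_groupI)
  fix x assume "x \<in> carrier M"
  then obtain p where "x = K +>\<^bsub>R\<^esub> p" "p \<in> J" by auto
  then show "\<exists>y\<in>carrier M. y \<oplus>\<^bsub>M\<^esub> x = \<zero>\<^bsub>M\<^esub>"
    by (intro bexI[of _ "K +>\<^bsub>R\<^esub> (- p)"]) (auto simp: coset_zero intro: sub_neg[OF J_sub])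
next
  show "\<zero>\<^bsub>M\<^esub> \<in> carrier M" using submod_0[OF J_sub] coset_zero by force
next
  fix x assume "x \<in> carrier M"
  then obtain p where "x = K +>\<^bsub>R\<^esub> p" "p \<in> J" by auto
  then show "\<zero>\<^bsub>M\<^esub> \<oplus>\<^bsub>M\<^esub> x = x"
    using M_simps(3)[of 0 p] by (simp add: coset_zero del: M_simps(3))
qed (auto simp: add_ac intro: submod_add[OF J_sub])

lemma coset_submodule:
  assumes L: "submod (carrier R) L" "K \<subseteq> L" "L \<subseteq> J"
  shows "submodule {K +>\<^bsub>R\<^esub> x | x. x \<in> L} R M"
proof -
  interpret abelian_group M by (rule M_abelian_group)
  show ?thesis
  proof (intro submodule.intro submodule_axioms.intro)
    show "subgroup {K +>\<^bsub>R\<^esub> x | x. x \<in> L} (add_monoid M)"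
    proof (rule add.subgroupI)
      show "{K +>\<^bsub>R\<^esub> x | x. x \<in> L} \<noteq> {}" using submod_0[OF L(1)] by blast
      fix a assume "a \<in> {K +>\<^bsub>R\<^esub> x | x. x \<in> L}"
      then obtain p where p: "a = K +>\<^bsub>R\<^esub> p" "p \<in> L" by blast
      have "\<ominus>\<^bsub>M\<^esub> a = K +>\<^bsub>R\<^esub> (- p)"
        by (rule minus_equality) (use p L sub_neg[OF J_sub, of p] in \<open>auto simp: coset_zero\<close>)
      then show "\<ominus>\<^bsub>M\<^esub> a \<in> {K +>\<^bsub>R\<^esub> x | x. x \<in> L}" using p sub_neg[OF L(1)] by blast
    qed (use L submod_add[OF L(1)] in auto)
    show "a \<odot>\<^bsub>M\<^esub> x \<in> {K +>\<^bsub>R\<^esub> x | x. x \<in> L}"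
      if "a \<in> carrier R" "x \<in> {K +>\<^bsub>R\<^esub> x | x. x \<in> L}" for a x
      using that submod_mult[OF L(1)] by auto
  qed
qed

lemma zero_module_iff: "zero_module M \<longleftrightarrow> J \<subseteq> K"
proof
  assume "zero_module M"
  then have "K +>\<^bsub>R\<^esub> x = K" if "x \<in> J" for x
    using that unfolding zero_module_def M_simps by blast
  then show "J \<subseteq> K" by (auto simp: coset_eq_zero)
next
  assume "J \<subseteq> K"
  then have "{K +>\<^bsub>R\<^esub> x | x. x \<in> J} \<subseteq> {K}" using coset_eq_zero by blast
  moreover have "K \<in> {K +>\<^bsub>R\<^esub> x | x. x \<in> J}"
    using submod_0[OF J_sub] by (intro CollectI exI[of _ 0]) (simp add: coset_zero)
  ultimately show "zero_module M" unfolding zero_module_def M_simps by blast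
qed

lemma annihilator_iff: "annihilator R M = {r \<in> carrier R. \<forall>x\<in>J. r * x \<in> K}"
proof -
  have "(\<forall>x\<in>{K +>\<^bsub>R\<^esub> x | x. x \<in> J}. r \<odot>\<^bsub>M\<^esub> x = K) \<longleftrightarrow> (\<forall>x\<in>J. r * x \<in> K)"
    if r: "r \<in> carrier R" for r
  proof -
    have "r \<odot>\<^bsub>M\<^esub> (K +>\<^bsub>R\<^esub> x) = K \<longleftrightarrow> r * x \<in> K" for x
      by (simp only: M_smult[OF r] coset_eq_zero)
    then show ?thesis by blast
  qed
  then show ?thesis unfolding annihilator_def M_simps by blast
qed

lemma annihilator_ideal: "ideal (annihilator R M) R"
proof (rule mpoly_idealI)
  fix r p assume r: "r \<in> carrier R" and "p \<in> annihilator R M"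
  then have p: "p \<in> carrier R" "\<And>x. x \<in> J \<Longrightarrow> p * x \<in> K" by (simp_all add: annihilator_iff)
  have "r * p * x \<in> K" if "x \<in> J" for x
    unfolding mult.assoc by (rule submod_mult[OF K_sub r p(2)[OF that]])
  then show "r * p \<in> annihilator R M"
    using mpoly_carrier_mult[OF r p(1)] by (simp add: annihilator_iff)
next
  show "0 \<in> annihilator R M" using submod_0[OF K_sub] by (simp add: annihilator_iff mpoly_carrier)
qed (auto simp: annihilator_iff distrib_right intro: mpoly_carrier_add submod_add[OF K_sub])

subsection \<open>Regular sequences\<close>

text \<open>The submodule \<open>K + (f\<^sub>1, \<dots>, f\<^sub>r) J\<close>, formed one factor at a time.\<close>

definition mult_chain :: "(('v \<Rightarrow>\<^sub>0 nat) \<Rightarrow>\<^sub>0 'k) list \<Rightarrow> (('v \<Rightarrow>\<^sub>0 nat) \<Rightarrow>\<^sub>0 'k) set" where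
  "mult_chain fs = foldl (add_mult J) K fs"

lemma foldl_add_mult:
  assumes "submod (carrier R) L" "L \<subseteq> J" "set fs \<subseteq> carrier R"
  shows "submod (carrier R) (foldl (add_mult J) L fs) \<and> L \<subseteq> foldl (add_mult J) L fs \<and>
     foldl (add_mult J) L fs \<subseteq> J \<and> (\<forall>f\<in>set fs. \<forall>x\<in>J. f * x \<in> foldl (add_mult J) L fs)"
  using assms
proof (induction fs arbitrary: L)
  case Nil
  then show ?case by simp
next
  case (Cons f fs)
  \<comment> \<open>an instance without variables, only for its closure properties of submodules\<close>
  interpret koszul "carrier R" "\<lambda>v :: 'v. 0" "{}"
    by unfold_locales (auto intro: neg_one_carrier mpoly_carrier_mult)
  have sub: "submod (carrier R) (add_mult J L f)"
    by (rule add_mult_submod[OF J_sub Cons.prems(1)])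
  have subset: "L \<subseteq> add_mult J L f"
    using submod_0[OF J_sub] unfolding add_mult_def by force
  have f: "f * x \<in> add_mult J L f" if "x \<in> J" for x
    using that submod_0[OF Cons.prems(1)] unfolding add_mult_def by force
  have fc: "f \<in> carrier R" "set fs \<subseteq> carrier R" using Cons.prems(3) by simp_all
  have "add_mult J L f \<subseteq> J"
  proof
    fix z assume "z \<in> add_mult J L f"
    then obtain p q where z: "z = p + f * q" and p: "p \<in> L" and q: "q \<in> J"
      unfolding add_mult_def by blast
    show "z \<in> J"
      unfolding z using Cons.prems(2) p submod_add[OF J_sub _ submod_mult[OF J_sub fc(1) q]] by blast
  qed
  note IH = Cons.IH[OF sub this fc(2)]
  show ?case
  proof (intro conjI ballI)
    fix g x assume "g \<in> set (f # fs)" "x \<in> J"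
    then show "g * x \<in> foldl (add_mult J) L (f # fs)" using IH f by auto
  qed (use IH subset in auto)
qed

lemma foldl_add_mult_least:
  assumes "\<And>p q. p \<in> X \<Longrightarrow> q \<in> X \<Longrightarrow> p + q \<in> X" "L \<subseteq> X"
    "\<And>f x. f \<in> set fs \<Longrightarrow> x \<in> J \<Longrightarrow> f * x \<in> X"
  shows "foldl (add_mult J) L fs \<subseteq> X"
  using assms(2,3)
proof (induction fs arbitrary: L)
  case (Cons f fs)
  have "add_mult J L f \<subseteq> X" using Cons.prems assms(1) by (force simp: add_mult_def)
  then show ?case using Cons by simp
qed simp

text \<open>
  The submodule generated by products is defined as an intersection of submodules of the quotient.
  The preimage in \<open>J\<close> of the smallest one is found explicitly, which makes regular sequences
  accessible to calculations with representatives.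
\<close>

lemma set_times_module_iff:
  assumes "set fs \<subseteq> carrier R" "y \<in> J"
  shows "K +>\<^bsub>R\<^esub> y \<in> set_times_module R (set fs) M \<longleftrightarrow> y \<in> mult_chain fs"
proof
  note fa = foldl_add_mult[OF K_sub KJ assms(1), folded mult_chain_def]
  assume y: "K +>\<^bsub>R\<^esub> y \<in> set_times_module R (set fs) M"
  have "submodule {K +>\<^bsub>R\<^esub> x | x. x \<in> mult_chain fs} R M"
    using fa by (intro coset_submodule) auto
  moreover have "\<forall>a\<in>set fs. \<forall>x\<in>carrier M. a \<odot>\<^bsub>M\<^esub> x \<in> {K +>\<^bsub>R\<^esub> x | x. x \<in> mult_chain fs}"
  proof (intro ballI)
    fix a z assume a: "a \<in> set fs" and "z \<in> carrier M"
    then obtain x where x: "z = K +>\<^bsub>R\<^esub> x" "x \<in> J" by auto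
    have "a \<odot>\<^bsub>M\<^esub> z = K +>\<^bsub>R\<^esub> (a * x)" "a * x \<in> mult_chain fs"
      using a x fa assms(1) M_smult[of a x] by blast+
    then show "a \<odot>\<^bsub>M\<^esub> z \<in> {K +>\<^bsub>R\<^esub> x | x. x \<in> mult_chain fs}" by blast
  qed
  ultimately have "K +>\<^bsub>R\<^esub> y \<in> {K +>\<^bsub>R\<^esub> x | x. x \<in> mult_chain fs}"
    using y unfolding set_times_module_def by blast
  then obtain x where "x \<in> mult_chain fs" "y - x \<in> K" by (auto simp: coset_eq)
  then have "x + (y - x) \<in> mult_chain fs" using fa submod_add by blast
  then show "y \<in> mult_chain fs" by simp
next
  assume y: "y \<in> mult_chain fs"
  show "K +>\<^bsub>R\<^esub> y \<in> set_times_module R (set fs) M"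
    unfolding set_times_module_def
  proof (intro InterI)
    fix N assume "N \<in> {N. submodule N R M \<and> (\<forall>a\<in>set fs. \<forall>x\<in>carrier M. a \<odot>\<^bsub>M\<^esub> x \<in> N)}"
    then have N: "submodule N R M" and fN: "\<And>a x. a \<in> set fs \<Longrightarrow> x \<in> J \<Longrightarrow> a \<odot>\<^bsub>M\<^esub> (K +>\<^bsub>R\<^esub> x) \<in> N"
      by auto
    have sg: "subgroup N (add_monoid M)" using N by (rule submodule.axioms)
    have "mult_chain fs \<subseteq> {x \<in> J. K +>\<^bsub>R\<^esub> x \<in> N}"
      unfolding mult_chain_def
    proof (rule foldl_add_mult_least)
      fix p q assume "p \<in> {x \<in> J. K +>\<^bsub>R\<^esub> x \<in> N}" "q \<in> {x \<in> J. K +>\<^bsub>R\<^esub> x \<in> N}"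
      then show "p + q \<in> {x \<in> J. K +>\<^bsub>R\<^esub> x \<in> N}"
        using subgroup.m_closed[OF sg, of "K +>\<^bsub>R\<^esub> p" "K +>\<^bsub>R\<^esub> q"] submod_add[OF J_sub] by simp
    next
      show "K \<subseteq> {x \<in> J. K +>\<^bsub>R\<^esub> x \<in> N}"
        using subgroup.one_closed[OF sg] KJ by (auto simp: coset_eq_zero[THEN iffD2])
    next
      fix f x assume "f \<in> set fs" "x \<in> J"
      then show "f * x \<in> {x \<in> J. K +>\<^bsub>R\<^esub> x \<in> N}"
        using fN[of f x] assms(1) submod_mult[OF J_sub, of f x] by auto
    qed
    then show "K +>\<^bsub>R\<^esub> y \<in> N" using y by blast
  qed
qed

lemma reg_on_foldl:
  assumes "\<And>i y. i < length fs \<Longrightarrow> y \<in> J \<Longrightarrow> fs ! i * y \<in> foldl (add_mult J) L (take i fs) \<Longrightarrow>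
     y \<in> foldl (add_mult J) L (take i fs)"
  shows "reg_on J L fs"
  using assms
proof (induction fs arbitrary: L)
  case (Cons f fs)
  have "reg_on J (add_mult J L f) fs"
    by (rule Cons.IH) (use Cons.prems[of "Suc _"] in auto)
  then show ?case using Cons.prems[of 0] by simp
qed simp

lemma regular_sequence_reg_on:
  assumes "regular_sequence R M fs"
  shows "reg_on J K fs"
proof (rule reg_on_foldl)
  fix i y assume i: "i < length fs" and y: "y \<in> J"
    and fy: "fs ! i * y \<in> foldl (add_mult J) K (take i fs)"
  have fs: "set fs \<subseteq> carrier R" using assms by (simp add: regular_sequence_def)
  have fsi: "set (take i fs) \<subseteq> carrier R" "fs ! i \<in> carrier R"
    using fs i set_take_subset[of i fs] nth_mem[OF i] by blast+
  have "K +>\<^bsub>R\<^esub> (fs ! i * y) \<in> set_times_module R (set (take i fs)) M"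
    using fy set_times_module_iff[OF fsi(1)] submod_mult[OF J_sub fsi(2) y]
    by (simp add: mult_chain_def)
  then have "fs ! i \<odot>\<^bsub>M\<^esub> (K +>\<^bsub>R\<^esub> y) \<in> set_times_module R (set (take i fs)) M"
    using fsi by simp
  moreover have "K +>\<^bsub>R\<^esub> y \<in> carrier M" using y by auto
  ultimately have "K +>\<^bsub>R\<^esub> y \<in> set_times_module R (set (take i fs)) M"
    using assms i unfolding regular_sequence_def by blast
  then show "y \<in> foldl (add_mult J) K (take i fs)"
    using set_times_module_iff[OF fsi(1) y] by (simp add: mult_chain_def)
qed

lemma depth_nonneg:
  assumes "\<not> zero_module M"
  shows "0 \<le> depth R \<mm> M"
proof -
  have "submodule {K +>\<^bsub>R\<^esub> x | x. x \<in> K} R M"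
    by (rule coset_submodule[OF K_sub _ KJ]) simp
  then have "set_times_module R (set []) M \<subseteq> {K +>\<^bsub>R\<^esub> x | x. x \<in> K}"
    unfolding set_times_module_def by auto
  then have "set_times_module R (set []) M \<subseteq> {K}" using coset_eq_zero by blast
  moreover have "\<not> carrier M \<subseteq> {K}"
    using assms coset_eq_zero unfolding zero_module_iff M_simps by blast
  ultimately have "regular_sequence R M []" unfolding regular_sequence_def by auto
  then have "ereal (real (length [])) \<le> depth R \<mm> M"
    unfolding depth_def by (intro SUP_upper2[of "[]"]) auto
  then show ?thesis by (simp add: zero_ereal_def)
qed

end

section \<open>Primes of a quotient ring and Krull dimension\<close>

lemma (in ring) coset_in_image_iff:
  assumes "ideal A R" "ideal P R" "A \<subseteq> P" "a \<in> carrier R"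
  shows "A +> a \<in> (+>) A ` P \<longleftrightarrow> a \<in> P"
proof -
  have "(+>) A ` P \<subseteq> carrier (R Quot A)"
    using ring_ideal_imp_quot_ideal[OF assms(1,2)] by (meson additive_subgroup.a_subset ideal.axioms(1))
  moreover have "\<Union> ((+>) A ` P) = P" using ideal_incl_iff[OF assms(1,2)] assms(3) by simp
  ultimately show ?thesis using canonical_proj_vimage_mem_iff[OF assms(1) _ assms(4)] by metis
qed

lemma (in ring) quot_carrier: "carrier (R Quot A) = {A +> a | a. a \<in> carrier R}"
  by (auto simp: FactRing_def A_RCOSETS_def')

lemma (in ring) quot_mult:
  assumes "ideal A R" "a \<in> carrier R" "b \<in> carrier R"
  shows "(A +> a) \<otimes>\<^bsub>R Quot A\<^esub> (A +> b) = A +> (a \<otimes> b)"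
  using ideal.rcoset_mult_add[OF assms] by (simp add: FactRing_def)

lemma (in cring) prime_image:
  assumes A: "ideal A R" and P: "primeideal P R" "A \<subseteq> P"
  shows "primeideal ((+>) A ` P) (R Quot A)"
proof -
  interpret P: primeideal P R by (rule P)
  note iff = coset_in_image_iff[OF A P.is_ideal P(2)]
  show ?thesis
  proof (rule primeidealI)
    show "ideal ((+>) A ` P) (R Quot A)" by (rule ring_ideal_imp_quot_ideal[OF A P.is_ideal])
    show "cring (R Quot A)" by (rule ideal.quotient_is_cring[OF A is_cring])
    obtain a where a: "a \<in> carrier R" "a \<notin> P" using P.I_notcarr P.a_subset by blast
    then have "A +> a \<in> carrier (R Quot A)" "A +> a \<notin> (+>) A ` P"
      using iff by (auto simp: quot_carrier)
    then show "carrier (R Quot A) \<noteq> (+>) A ` P" by blast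
    fix X Y assume XY: "X \<in> carrier (R Quot A)" "Y \<in> carrier (R Quot A)"
      "X \<otimes>\<^bsub>R Quot A\<^esub> Y \<in> (+>) A ` P"
    then obtain a b where ab: "X = A +> a" "Y = A +> b" "a \<in> carrier R" "b \<in> carrier R"
      unfolding quot_carrier by blast
    then have "a \<otimes> b \<in> P" using XY(3) iff[of "a \<otimes> b"] quot_mult[OF A] by simp
    then show "X \<in> (+>) A ` P \<or> Y \<in> (+>) A ` P" using P.I_prime ab by blast
  qed
qed

lemma (in cring) prime_preimage:
  assumes A: "ideal A R" and Q: "primeideal Q (R Quot A)"
  shows "primeideal {a \<in> carrier R. A +> a \<in> Q} R" "A \<subseteq> {a \<in> carrier R. A +> a \<in> Q}"
    "Q = (+>) A ` {a \<in> carrier R. A +> a \<in> Q}"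
proof -
  interpret Q: primeideal Q "R Quot A" by (rule Q)
  show Q_eq: "Q = (+>) A ` {a \<in> carrier R. A +> a \<in> Q}"
    using Q.a_subset unfolding quot_carrier by blast
  have AR: "A \<subseteq> carrier R" using A by (meson additive_subgroup.a_subset ideal.axioms(1))
  have zero: "\<zero>\<^bsub>R Quot A\<^esub> = A" by (simp add: FactRing_def)
  have "A \<in> Q" using additive_subgroup.zero_closed[OF Q.is_additive_subgroup] zero by simp
  moreover have "A +> a = A" if "a \<in> A" for a
    using that AR A by (metis a_coset_join2 additive_subgroup.a_subgroup ideal.axioms(1) subsetD)
  ultimately show "A \<subseteq> {a \<in> carrier R. A +> a \<in> Q}" using AR by auto
  show "primeideal {a \<in> carrier R. A +> a \<in> Q} R"
  proof (rule primeidealI)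
    show "ideal {a \<in> carrier R. A +> a \<in> Q} R"
      by (rule ring_hom_ring.ideal_vimage[OF ideal.rcos_ring_hom_ring[OF A] Q.is_ideal])
    show "cring R" by (rule is_cring)
    show "carrier R \<noteq> {a \<in> carrier R. A +> a \<in> Q}"
      using Q.I_notcarr Q_eq unfolding quot_carrier by blast
    show "a \<in> {a \<in> carrier R. A +> a \<in> Q} \<or> b \<in> {a \<in> carrier R. A +> a \<in> Q}"
      if "a \<in> carrier R" "b \<in> carrier R" "a \<otimes> b \<in> {a \<in> carrier R. A +> a \<in> Q}" for a b
      using that Q.I_prime[of "A +> a" "A +> b"] quot_mult[OF A] by (auto simp: quot_carrier)
  qed
qed

lemma (in cring) krull_dim_quot_ge:
  assumes A: "ideal A R" and P: "\<And>i. i \<le> d \<Longrightarrow> primeideal (P i) R" "\<And>i. i \<le> d \<Longrightarrow> A \<subseteq> P i"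
    and chain: "\<And>i j. i < j \<Longrightarrow> j \<le> d \<Longrightarrow> P j \<subset> P i"
  shows "ereal (real d) \<le> krull_dim (R Quot A)"
proof -
  define C where "C = (\<lambda>i. (+>) A ` P i) ` {..d}"
  have idl: "ideal (P i) R" if "i \<le> d" for i using P(1)[OF that] by (rule primeideal.axioms(1))
  have "inj_on (\<lambda>i. (+>) A ` P i) {..d}"
  proof (rule linorder_inj_onI)
    fix i j assume ij: "i < j" "i \<in> {..d}" "j \<in> {..d}"
    then obtain a where a: "a \<in> P i" "a \<notin> P j" using chain[of i j] by auto
    have "a \<in> carrier R" using a(1) idl[of i] ij by (meson atMost_iff ideal.Icarr)
    then have "A +> a \<notin> (+>) A ` P j"
      using coset_in_image_iff[OF A idl[of j] P(2)[of j]] a ij by auto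
    then show "(+>) A ` P i \<noteq> (+>) A ` P j" using a(1) by blast
  qed auto
  then have "card C = Suc d" unfolding C_def by (simp add: card_image)
  moreover have "P i \<subseteq> P j \<or> P j \<subseteq> P i" if "i \<le> d" "j \<le> d" for i j
    using chain[of i j] chain[of j i] that by (cases i j rule: linorder_cases) auto
  then have "(+>) A ` P i \<subseteq> (+>) A ` P j \<or> (+>) A ` P j \<subseteq> (+>) A ` P i" if "i \<le> d" "j \<le> d" for i j
    using that image_mono by metis
  then have "\<forall>X\<in>C. \<forall>Y\<in>C. X \<subseteq> Y \<or> Y \<subseteq> X" by (simp add: C_def)
  moreover have "\<forall>X\<in>C. primeideal X (R Quot A)"
    unfolding C_def using prime_image[OF A P] by auto
  moreover have "finite C" "C \<noteq> {}" by (auto simp: C_def)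
  ultimately show ?thesis unfolding krull_dim_def by (intro SUP_upper2[of C]) auto
qed

lemma (in cring) krull_dim_quot_zero:
  assumes A: "ideal A R" and P: "primeideal P R" "A \<subseteq> P"
    and unique: "\<And>Q. primeideal Q R \<Longrightarrow> A \<subseteq> Q \<Longrightarrow> Q = P"
  shows "krull_dim (R Quot A) = 0"
proof (rule antisym)
  show "0 \<le> krull_dim (R Quot A)"
    using krull_dim_quot_ge[OF A, of 0 "\<lambda>_. P"] P by (simp add: zero_ereal_def)
  have "Q = (+>) A ` P" if "primeideal Q (R Quot A)" for Q
    using prime_preimage[OF A that] unique by metis
  then have "C \<subseteq> {(+>) A ` P}" if "\<forall>Q\<in>C. primeideal Q (R Quot A)" for C using that by blast
  then have "card C - 1 = 0" if "\<forall>Q\<in>C. primeideal Q (R Quot A)" for C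
    using that card_mono[of "{(+>) A ` P}" C] by (simp add: subset_singleton_iff) 
  then show "krull_dim (R Quot A) \<le> 0"
    unfolding krull_dim_def by (intro SUP_least) (auto simp: zero_ereal_def)
qed

section \<open>Depth and dimension of quotients of monomial ideals\<close>

lemma restrict_keys_idem: "(\<And>m. m \<in> keys p \<Longrightarrow> P m) \<Longrightarrow> restrict_keys P p = p"
  by (rule poly_mapping_eqI) (metis lookup_restrict_keys in_keys_iff)

lemma mpoly_var_power: "mpoly_var v ^ N = single (single v N) 1"
  by (induction N) (auto simp: mpoly_var_def mult_single simp flip: single_add)

lemma keys_eq_empty_nat: "keys (m :: 'v \<Rightarrow>\<^sub>0 nat) = {} \<longleftrightarrow> m = 0"
  by (auto simp: poly_mapping_eq_iff fun_eq_iff in_keys_iff set_eq_iff)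

locale mono_pair = ideal_pair V J K
  for V :: "'v::linorder set" and J K :: "(('v \<Rightarrow>\<^sub>0 nat) \<Rightarrow>\<^sub>0 'k::field) set" +
  fixes X Y :: "('v \<Rightarrow>\<^sub>0 nat) \<Rightarrow> bool"
  assumes finite_V: "finite V" and J_eq: "J = mono_ideal V X" and K_eq: "K = mono_ideal V Y"
begin

sublocale koszul "carrier R" mpoly_var V
  by unfold_locales
    (auto simp: finite_V mpoly_var_in intro: neg_one_carrier mpoly_carrier_mult)

text \<open>
  The elements that turn a given cocycle into a coboundary form an ideal, and it contains the
  variables.
\<close>

lemma irrelevant_kills_cohomology:
  assumes K': "submod (carrier R) K'" and f: "f \<in> irrelevant_ideal V"
    and \<omega>: "cocycle V k J K' \<omega>"
  shows "coboundary V k J K' (\<lambda>A. f * \<omega> A)"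
proof -
  interpret cring R by (rule mpoly_cring)
  define U where "U = {f \<in> carrier R. coboundary V k J K' (\<lambda>A. f * \<omega> A)}"
  have "ideal U R"
  proof (rule mpoly_idealI)
    show "0 \<in> U" using coboundary_zero[OF J_sub K'] zero_closed by (simp add: U_def)
    show "p + q \<in> U" if "p \<in> U" "q \<in> U" for p q
      using that coboundary_add[OF J_sub K', of V k "\<lambda>A. p * \<omega> A" "\<lambda>A. q * \<omega> A"]
      by (simp add: U_def mpoly_carrier_add distrib_right)
    show "r * p \<in> U" if "r \<in> carrier R" "p \<in> U" for r p
      using that coboundary_mult[OF J_sub K', of V k "\<lambda>A. p * \<omega> A" r]
      by (simp add: U_def mpoly_carrier_mult mult.assoc)
  qed (auto simp: U_def)
  moreover have "mpoly_var ` V \<subseteq> U"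
    using variable_kills_cohomology[OF K' J_sub _ _ \<omega>] by (auto simp: U_def mpoly_var_in)
  ultimately have "irrelevant_ideal V \<subseteq> U"
    unfolding irrelevant_ideal_def by (rule genideal_minimal)
  then show ?thesis using f by (auto simp: U_def)
qed

lemma mono_exact_remove_variable:
  assumes W: "insert v W \<subseteq> V" "v \<notin> W" and ex: "koszul_exact (insert v W) (Suc k) J K"
  shows "koszul_exact W k J K"
proof (rule exact_remove_variable[OF J_sub K_sub W ex])
  let ?T = "\<lambda>N. restrict_keys (\<lambda>m :: 'v \<Rightarrow>\<^sub>0 nat. lookup m v < N)"
  show "?T N (p - q) = ?T N p - ?T N q" for N and p q :: "('v \<Rightarrow>\<^sub>0 nat) \<Rightarrow>\<^sub>0 'k"
    by (rule restrict_keys_diff)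
  show "?T N (mpoly_var i * p) = mpoly_var i * ?T N p" if "i \<in> W" for N i
    and p :: "('v \<Rightarrow>\<^sub>0 nat) \<Rightarrow>\<^sub>0 'k"
    unfolding mpoly_var_mult
    by (rule restrict_keys_single_mult) (use that W in \<open>auto simp: lookup_add lookup_single when_def\<close>)
  show "?T N (mpoly_var v ^ N * p) = 0" for N and p :: "('v \<Rightarrow>\<^sub>0 nat) \<Rightarrow>\<^sub>0 'k"
  proof -
    have "?T N (mpoly_var v ^ N * p) = single (single v N) 1 * restrict_keys (\<lambda>_. False) p"
      unfolding mpoly_var_power by (rule restrict_keys_single_mult) (simp add: lookup_add)
    moreover have "restrict_keys (\<lambda>_. False) p = 0"
      by (rule poly_mapping_eqI) (simp add: lookup_restrict_keys)
    ultimately show ?thesis by simp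
  qed
  show "\<exists>N0. \<forall>N\<ge>N0. ?T N p = p" for p :: "('v \<Rightarrow>\<^sub>0 nat) \<Rightarrow>\<^sub>0 'k"
  proof (intro exI allI impI)
    fix N assume N: "N \<ge> Suc (\<Sum>m\<in>keys p. lookup m v)"
    have "lookup m v < N" if "m \<in> keys p" for m
      using member_le_sum[OF that, of "\<lambda>m. lookup m v"] N by simp
    then show "?T N p = p" by (rule restrict_keys_idem)
  qed
  show "?T N p \<in> J" if "p \<in> J" for N p using that unfolding J_eq by (rule restrict_keys_mono_ideal)
  show "?T N p \<in> K" if "p \<in> K" for N p using that unfolding K_eq by (rule restrict_keys_mono_ideal)
qed

text \<open>
  Cohomology on all variables vanishes below the length of the sequence. Each variable of \<open>F\<close> that
  is removed costs one degree, and \<open>z\<close> would be a nonzero class in degree zero on the variables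
  outside \<open>F\<close> if the sequence were longer than \<open>|F|\<close>.
\<close>

lemma regular_sequence_length_le:
  assumes F: "F \<subseteq> V" and z: "z \<in> J" "z \<notin> K"
    and kill: "\<And>v. v \<in> V - F \<Longrightarrow> mpoly_var v * z \<in> K"
    and fs: "regular_sequence R M fs" "set fs \<subseteq> irrelevant_ideal V"
  shows "length fs \<le> card F"
proof (rule ccontr)
  assume "\<not> ?thesis"
  then have len: "0 + card F < length fs" by simp
  have finF: "finite F" using F finite_V finite_subset by blast
  have exact: "koszul_exact (V - F) k J K" if "k + card F < length fs" for k
    using finF F that
  proof (induction F arbitrary: k rule: finite_induct)
    case empty
    then show ?case
      using exact_of_regular_sequence[OF J_sub K_sub regular_sequence_reg_on[OF fs(1)], of k]
        irrelevant_kills_cohomology fs(2) by (simp add: subset_iff)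
  next
    case (insert v F)
    have "V - F = insert v (V - insert v F)" using insert by auto
    then have "koszul_exact (insert v (V - insert v F)) (Suc k) J K"
      using insert.IH[of "Suc k"] insert by simp
    then show ?case by (rule mono_exact_remove_variable[rotated 2]) (use insert in auto)
  qed
  have "cocycle (V - F) 0 J K (\<lambda>_. z)"
    unfolding cocycle_def
  proof (intro conjI allI impI)
    fix B assume B: "B \<subseteq> V - F \<and> card B = Suc 0"
    then obtain v where "B = {v}" by (metis One_nat_def card_1_singletonE)
    then show "koszul_d (\<lambda>_. z) B \<in> K"
      using kill[of v] B ksign_mem[OF K_sub, of v "{v}"] by (simp add: koszul_d_def mult.assoc)
  qed (rule z)
  from koszul_exactD[OF exact[OF len] this]
  obtain \<eta> where "\<And>A. A \<subseteq> V - F \<Longrightarrow> card A = 0 \<Longrightarrow> z - koszul_d \<eta> A \<in> K" by metis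
  from this[of "{}"] have "z \<in> K" by (simp add: koszul_d_def)
  then show False using z by simp
qed

lemma depth_le:
  assumes "F \<subseteq> V" "z \<in> J" "z \<notin> K" "\<And>v. v \<in> V - F \<Longrightarrow> mpoly_var v * z \<in> K"
  shows "depth R (irrelevant_ideal V) M \<le> ereal (real (card F))"
  unfolding depth_def
  by (rule SUP_least) (use regular_sequence_length_le[OF assms] in auto)

text \<open>
  An element of the annihilator with a monomial \<open>m\<close> in the variables of \<open>F\<close> would put \<open>g + m\<close>, a
  monomial of its product with \<open>g\<close>, into \<open>K\<close>.
\<close>

lemma annihilator_le_var_prime:
  assumes g: "single g 1 \<in> J" and F: "\<And>m. keys m \<subseteq> F \<Longrightarrow> \<not> Y (g + m)"
  shows "annihilator R M \<subseteq> var_prime V F"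
proof
  fix r assume r: "r \<in> annihilator R M"
  then have "single g 1 * r \<in> K" using g by (auto simp: annihilator_iff mult.commute)
  then have "Y (g + m)" if "m \<in> keys r" for m
    using shift_in_keys[OF that, of g] unfolding K_eq mono_ideal_def by blast
  then show "r \<in> var_prime V F"
    using r F unfolding var_prime_def mono_ideal_def annihilator_iff by blast
qed

lemma dim_ge:
  assumes "F \<subseteq> V" and g: "single g 1 \<in> J" and F: "\<And>m. keys m \<subseteq> F \<Longrightarrow> \<not> Y (g + m)"
  shows "\<not> zero_module M" "ereal (real (card F)) \<le> module_dim R M"
proof -
  interpret cring R by (rule mpoly_cring)
  have "single g 1 \<notin> K" using F[of 0] by (simp add: K_eq single_in_mono_ideal)
  then show nz: "\<not> zero_module M" using g by (auto simp: zero_module_iff)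
  have finF: "finite F" using assms(1) finite_V finite_subset by blast
  then obtain xs where xs: "set xs = F" "distinct xs" using finite_distinct_list by blast
  define P :: "nat \<Rightarrow> (('v \<Rightarrow>\<^sub>0 nat) \<Rightarrow>\<^sub>0 'k) set" where "P i = var_prime V (set (take i xs))" for i
  have anti: "var_prime V F' \<subseteq> (var_prime V F'' :: (('v \<Rightarrow>\<^sub>0 nat) \<Rightarrow>\<^sub>0 'k) set)" if "F'' \<subseteq> F'" for F' F''
    using that by (auto simp: var_prime_def mono_ideal_def)
  have "ereal (real (length xs)) \<le> krull_dim (R Quot annihilator R M)"
  proof (rule krull_dim_quot_ge[OF annihilator_ideal, where P = P])
    show "primeideal (P i) R" for i unfolding P_def by (rule var_prime_primeideal)
    show "annihilator R M \<subseteq> P i" for i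
      using annihilator_le_var_prime[OF g F] anti[of "set (take i xs)" F] xs(1) set_take_subset[of i xs]
      unfolding P_def by blast
    fix i j assume ij: "i < j" "j \<le> length xs"
    have i: "i < length xs" "xs ! i \<in> set (take j xs)" using ij by (auto simp: in_set_conv_nth)
    have "xs ! i \<notin> set (take i xs)" using xs(2) i(1) by (auto simp: in_set_conv_nth nth_eq_iff_index_eq)
    moreover have "xs ! i \<in> V" using i(1) xs(1) assms(1) by auto
    ultimately have "mpoly_var (xs ! i) \<in> P i" "mpoly_var (xs ! i) \<notin> P j"
      using i(2) by (simp_all add: P_def mpoly_var_in_var_prime)
    moreover have "P j \<subseteq> P i" unfolding P_def using ij by (intro anti set_take_subset_set_take) simp
    ultimately show "P j \<subset> P i" by blast
  qed
  then show "ereal (real (card F)) \<le> module_dim R M"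
    using nz distinct_card[OF xs(2)] xs(1) by (simp add: module_dim_def)
qed

lemma monomial_witness:
  assumes "\<not> zero_module M"
  obtains g where "single g 1 \<in> J" "keys g \<subseteq> V" "\<not> Y g"
proof -
  obtain p where p: "p \<in> J" "p \<notin> K" using assms by (auto simp: zero_module_iff)
  then obtain g where "g \<in> keys p" "X g" "\<not> Y g" "keys g \<subseteq> V"
    by (auto simp: J_eq K_eq mono_ideal_def mpoly_carrier)
  then show ?thesis using that by (auto simp: J_eq single_in_mono_ideal)
qed

text \<open>
  Multiplying by the largest power of a variable that does not kill the element makes that variable
  kill the result; the variables treated before still do.
\<close>

lemma socle_element:
  assumes nil: "\<And>v x. v \<in> V \<Longrightarrow> x \<in> J \<Longrightarrow> mpoly_var v ^ N * x \<in> K"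
    and W: "W \<subseteq> V" and z: "z \<in> J" "z \<notin> K"
  obtains z' where "z' \<in> J" "z' \<notin> K" "\<And>v. v \<in> W \<Longrightarrow> mpoly_var v * z' \<in> K"
proof -
  have "finite W" using W finite_V finite_subset by blast
  then have "\<exists>z'. z' \<in> J \<and> z' \<notin> K \<and> (\<forall>v\<in>W. mpoly_var v * z' \<in> K)"
    using W
  proof (induction W rule: finite_induct)
    case empty
    then show ?case using z by blast
  next
    case (insert v W)
    then obtain y where y: "y \<in> J" "y \<notin> K" "\<And>u. u \<in> W \<Longrightarrow> mpoly_var u * y \<in> K" by auto
    have vV: "v \<in> V" using insert by simp
    define n where "n = (LEAST n. mpoly_var v ^ n * y \<in> K)"
    have n: "mpoly_var v ^ n * y \<in> K"
      unfolding n_def by (rule LeastI[of _ N]) (rule nil[OF vV y(1)])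
    then obtain n' where n': "n = Suc n'" using y(2) by (cases n) auto
    define y' where "y' = mpoly_var v ^ n' * y"
    have xn: "mpoly_var v ^ n' \<in> carrier R" by (simp add: mpoly_var_power vV)
    have "y' \<notin> K" using not_less_Least[of n' "\<lambda>n. mpoly_var v ^ n * y \<in> K"] n'
      by (auto simp: y'_def n_def)
    moreover have "y' \<in> J" unfolding y'_def by (rule submod_mult[OF J_sub xn y(1)])
    moreover have "mpoly_var u * y' \<in> K" if u: "u \<in> insert v W" for u
    proof (cases "u = v")
      case True
      then show ?thesis using n by (simp add: y'_def n' mult.assoc)
    next
      case False
      then show ?thesis using submod_mult[OF K_sub xn y(3)[of u]] u by (simp add: y'_def mult_ac)
    qed
    ultimately show ?case by blast
  qed
  then show ?thesis using that by blast
qed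

text \<open>
  A prime above the annihilator contains all variables, so the irrelevant ideal is the only one. The
  depth is zero because of a socle element.
\<close>

lemma nilpotent_variables:
  assumes nz: "\<not> zero_module M"
    and nil: "\<And>v x. v \<in> V \<Longrightarrow> x \<in> J \<Longrightarrow> mpoly_var v ^ N * x \<in> K"
  shows "module_dim R M = 0" "depth R (irrelevant_ideal V) M = 0"
proof -
  interpret cring R by (rule mpoly_cring)
  obtain g where g: "single g 1 \<in> J" "\<not> Y g" using monomial_witness[OF nz] by metis
  have ann: "annihilator R M \<subseteq> var_prime V {}"
    by (rule annihilator_le_var_prime[OF g(1)]) (use g(2) in auto)
  have "Q = var_prime V {}" if Q: "primeideal Q R" "annihilator R M \<subseteq> Q" for Q
  proof -
    interpret Q: primeideal Q R by (rule Q)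
    have Q_sub: "submod (carrier R) Q" by (rule mpoly_ideal_submod[OF Q.is_ideal])
    have var: "mpoly_var v \<in> Q" if v: "v \<in> V" for v
    proof -
      have "mpoly_var v ^ N \<in> annihilator R M"
        using nil v by (simp add: annihilator_iff mpoly_var_power)
      then have "single (single v N) 1 \<in> Q" using Q(2) by (auto simp: mpoly_var_power)
      from monomial_in_prime[OF Q(1) _ this] show ?thesis using v by (cases "N = 0") auto
    qed
    have sub: "var_prime V {} \<subseteq> Q"
    proof
      fix p :: "('v \<Rightarrow>\<^sub>0 nat) \<Rightarrow>\<^sub>0 'k" assume p: "p \<in> var_prime V {}"
      show "p \<in> Q"
      proof (rule ideal_contains_if_monomials[OF Q.is_ideal])
        fix m assume m: "m \<in> keys p"
        then have "m \<noteq> 0" and mV: "keys m \<subseteq> V"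
          using p by (auto simp: var_prime_def mono_ideal_def mpoly_carrier)
        then obtain v where v: "v \<in> keys m" "keys m \<subseteq> V"
          by (metis ex_in_conv keys_eq_empty_nat)
        define m' where "m' = m - single v 1"
        have m': "m = m' + single v 1"
          using v by (intro poly_mapping_eqI)
            (auto simp: m'_def lookup_add lookup_minus lookup_single when_def in_keys_iff)
        then have "keys m' \<subseteq> V" using v by (auto simp: keys_add_nat)
        then have "single m' (lookup p m) * mpoly_var v \<in> Q"
          using v var[of v] by (intro submod_mult[OF Q_sub]) auto
        moreover have "single m c = single m' c * mpoly_var v" for c :: 'k
          unfolding m' by (simp add: mpoly_var_def mult_single)
        ultimately show "single m (lookup p m) \<in> Q" by simp
      qed
    qed
    have "Q \<subseteq> var_prime V {}"
    proof (rule ccontr)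
      assume "\<not> Q \<subseteq> var_prime V {}"
      then obtain q where q: "q \<in> Q" "q \<notin> var_prime V {}" by blast
      have qc: "q \<in> carrier R" using q(1) by (rule Q.Icarr)
      then have c: "lookup q 0 \<noteq> 0"
        using q(2) by (auto simp: var_prime_def mono_ideal_def in_keys_iff)
      have "restrict_keys (\<lambda>m. m \<noteq> 0) q \<in> var_prime V {}"
        using qc by (auto simp: var_prime_def mono_ideal_def mpoly_carrier keys_restrict_keys)
      then have "q - restrict_keys (\<lambda>m. m \<noteq> 0) q \<in> Q"
        using sub q(1) sub_diff[OF Q_sub] by blast
      also have "q - restrict_keys (\<lambda>m. m \<noteq> 0) q = single 0 (lookup q 0)"
        by (rule poly_mapping_eqI) (auto simp: lookup_minus lookup_restrict_keys lookup_single when_def)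
      finally have "single 0 (inverse (lookup q 0)) * single 0 (lookup q 0) \<in> Q"
        by (intro submod_mult[OF Q_sub]) auto
      then have "\<one>\<^bsub>R\<^esub> \<in> Q" using c by (simp add: mult_single)
      then show False using Q.one_imp_carrier Q.I_notcarr by simp
    qed
    then show ?thesis using sub by blast
  qed
  then show "module_dim R M = 0"
    using krull_dim_quot_zero[OF annihilator_ideal var_prime_primeideal ann] nz
    by (simp add: module_dim_def)
  have "single g 1 \<notin> K" using g by (simp add: K_eq single_in_mono_ideal)
  from socle_element[OF nil subset_refl g(1) this] obtain z where
    z: "z \<in> J" "z \<notin> K" "\<And>v. v \<in> V \<Longrightarrow> mpoly_var v * z \<in> K" by metis
  have "depth R (irrelevant_ideal V) M \<le> 0"
    using depth_le[of "{}" z] z by (simp add: zero_ereal_def)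
  then show "depth R (irrelevant_ideal V) M = 0"
    using depth_nonneg[OF nz] by (rule antisym)
qed

end

section \<open>Products of edges and vertex covers\<close>

definition unit_exp :: "'v \<Rightarrow> ('v \<Rightarrow>\<^sub>0 nat)" where
  "unit_exp v = single v 1"

lemma wdeg_unit_exp [simp]: "wdeg w (unit_exp v) = w v"
  and keys_unit_exp [simp]: "keys (unit_exp v) = {v}"
  by (simp_all add: unit_exp_def)

lemma remove_unit_exp:
  assumes "v \<in> keys (m :: 'v \<Rightarrow>\<^sub>0 nat)"
  obtains m' where "m = unit_exp v + m'"
proof
  show "m = unit_exp v + (m - unit_exp v)"
    using assms by (intro poly_mapping_eqI)
      (auto simp: unit_exp_def lookup_add lookup_minus lookup_single when_def in_keys_iff)
qed

text \<open>
  The exponent vectors of the monomials in the \<open>t\<close>-th power of the edge ideal: multiples of a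
  product of \<open>t\<close> edges, with repetitions.
\<close>

fun edge_mult :: "'v set set \<Rightarrow> nat \<Rightarrow> ('v \<Rightarrow>\<^sub>0 nat) \<Rightarrow> bool" where
  "edge_mult E 0 m = True"
| "edge_mult E (Suc t) m =
     (\<exists>i j m'. {i, j} \<in> E \<and> m = unit_exp i + unit_exp j + m' \<and> edge_mult E t m')"

lemma edge_mult_step: "{i, j} \<in> E \<Longrightarrow> edge_mult E t m \<Longrightarrow> edge_mult E (Suc t) (unit_exp i + unit_exp j + m)"
  by auto

lemma edge_mult_add: "edge_mult E t m \<Longrightarrow> edge_mult E t (a + m)"
proof (induction t arbitrary: m)
  case (Suc t)
  then obtain i j m' where m: "{i, j} \<in> E" "m = unit_exp i + unit_exp j + m'" "edge_mult E t (a + m')"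
    by auto
  from edge_mult_step[OF m(1,3)] show ?case unfolding m(2) by (simp only: add_ac)
qed simp

lemma edge_mult_mono: "E' \<subseteq> E \<Longrightarrow> edge_mult E' t m \<Longrightarrow> edge_mult E t m"
proof (induction t arbitrary: m)
  case (Suc t)
  then obtain i j m' where m: "{i, j} \<in> E" "m = unit_exp i + unit_exp j + m'" "edge_mult E t m'"
    by auto
  from edge_mult_step[OF m(1,3)] show ?case unfolding m(2) .
qed simp

text \<open>
  Weak duality between packing edges and covering them. Vertex covers are weights with \<open>c = 1\<close>; the
  half-integral covers that certify the gap at an odd cycle are weights with \<open>c = 2\<close>.
\<close>

lemma edge_mult_weight:
  assumes "\<And>i j. {i, j} \<in> E \<Longrightarrow> c \<le> w i + w j" "edge_mult E t m"
  shows "c * t \<le> wdeg w m"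
  using assms(2)
proof (induction t arbitrary: m)
  case (Suc t)
  then obtain i j m' where m: "{i, j} \<in> E" "m = unit_exp i + unit_exp j + m'" "edge_mult E t m'"
    by auto
  have "c * t \<le> wdeg w m'" using Suc.IH m(3) by blast
  then show ?case using assms(1)[OF m(1)] by (simp add: m(2))
qed simp

definition vertex_cover :: "'v set \<Rightarrow> 'v set set \<Rightarrow> 'v set \<Rightarrow> bool" where
  "vertex_cover V E Q \<longleftrightarrow> Q \<subseteq> V \<and> (\<forall>i j. {i, j} \<in> E \<longrightarrow> i \<in> Q \<or> j \<in> Q)"

abbreviation cdeg :: "'v set \<Rightarrow> ('v \<Rightarrow>\<^sub>0 nat) \<Rightarrow> nat" where
  "cdeg Q \<equiv> wdeg (\<lambda>v. of_bool (v \<in> Q))"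

text \<open>The exponent vectors of the monomials in the \<open>t\<close>-th symbolic power.\<close>

definition cover_mult :: "'v set \<Rightarrow> 'v set set \<Rightarrow> nat \<Rightarrow> ('v \<Rightarrow>\<^sub>0 nat) \<Rightarrow> bool" where
  "cover_mult V E t m \<longleftrightarrow> (\<forall>Q. vertex_cover V E Q \<longrightarrow> t \<le> cdeg Q m)"

lemma cover_mult_add: "cover_mult V E t m \<Longrightarrow> cover_mult V E t (a + m)"
  by (auto simp: cover_mult_def intro: trans_le_add2)

lemma edge_mult_cover_mult:
  assumes "edge_mult E t m" shows "cover_mult V E t m"
  unfolding cover_mult_def
proof (intro allI impI)
  fix Q assume "vertex_cover V E Q"
  then have "1 \<le> of_bool (i \<in> Q) + (of_bool (j \<in> Q) :: nat)" if "{i, j} \<in> E" for i j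
    using that by (auto simp: vertex_cover_def)
  from edge_mult_weight[of E 1, OF this assms] show "t \<le> cdeg Q m" by simp
qed

section \<open>Weighted bipartite graphs\<close>

lemma wdeg_plus: "wdeg w m + wdeg w' m = wdeg (\<lambda>v. w v + w' v) m"
  by (simp add: wdeg_def distrib_right sum.distrib)

lemma cdeg_Un_zero:
  assumes "\<And>v. v \<in> Z \<Longrightarrow> v \<notin> keys m" shows "cdeg (Q \<union> Z) m = cdeg Q m"
  by (rule wdeg_cong) (use assms in auto)

text \<open>
  Some edge \<open>uv\<close> can be split off such that no cover drops below \<open>t\<close>. Fix \<open>u\<close> in the support of \<open>m\<close>
  with a neighbour in the support. If every such neighbour \<open>v\<close> failed, there would be a cover of
  minimal degree that contains both \<open>u\<close> and \<open>v\<close>. In a bipartite graph two minimal covers have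
  again minimal covers as meet and join, where the meet takes the intersection on the side \<open>A\<close> and
  the union on the side \<open>B\<close>. So one minimal cover contains \<open>u\<close> and all its neighbours in the support. In
  this cover \<open>u\<close> can be exchanged for its neighbours outside the support, which have degree zero,
  and the degree drops, a contradiction.
\<close>

lemma bipartite_koenig:
  assumes fin: "finite V" and AB: "A \<union> B = V" "A \<inter> B = {}"
    and E: "\<And>e. e \<in> E \<Longrightarrow> \<exists>a\<in>A. \<exists>b\<in>B. e = {a, b}"
  shows "cover_mult V E t m \<Longrightarrow> edge_mult E t m"
proof (induction t arbitrary: m)
  case (Suc t)
  have cov: "Suc t \<le> cdeg Q m" if "vertex_cover V E Q" for Q
    using Suc.prems that by (auto simp: cover_mult_def)
  have coverI: "vertex_cover V E Q" if "Q \<subseteq> V" "\<And>a b. a \<in> A \<Longrightarrow> b \<in> B \<Longrightarrow> {a, b} \<in> E \<Longrightarrow> a \<in> Q \<or> b \<in> Q" for Q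
    unfolding vertex_cover_def
  proof (intro conjI allI impI)
    fix i j assume ij: "{i, j} \<in> E"
    then obtain a b where ab: "a \<in> A" "b \<in> B" "{i, j} = {a, b}" using E by blast
    then have "a \<in> Q \<or> b \<in> Q" using that(2)[of a b] ij by simp
    then show "i \<in> Q \<or> j \<in> Q" using ab(3) by (auto simp: doubleton_eq_iff)
  qed (rule that(1))
  have coverD: "a \<in> Q \<or> b \<in> Q" if "vertex_cover V E Q" "{a, b} \<in> E" for a b Q
    using that by (auto simp: vertex_cover_def)
  have "\<exists>u\<in>A. \<exists>v\<in>B. {u, v} \<in> E \<and> u \<in> keys m \<and> v \<in> keys m"
  proof (rule ccontr)
    assume "\<not> ?thesis"
    then have "vertex_cover V E (V - keys m)" using AB by (intro coverI) auto
    then have "Suc t \<le> cdeg (V - keys m) m" by (rule cov)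
    then show False by (simp add: wdeg_def)
  qed
  then obtain u v0 where u: "u \<in> A" "u \<in> keys m" and v0: "v0 \<in> B" "{u, v0} \<in> E" "v0 \<in> keys m" by blast
  define N where "N = {v \<in> B. {u, v} \<in> E \<and> v \<in> keys m}"
  have "\<exists>v\<in>N. \<forall>Q. vertex_cover V E Q \<and> u \<in> Q \<and> v \<in> Q \<longrightarrow> Suc t < cdeg Q m"
  proof (rule ccontr)
    assume "\<not> ?thesis"
    then have tight: "v \<in> B \<and> (\<exists>Q. vertex_cover V E Q \<and> u \<in> Q \<and> v \<in> Q \<and> cdeg Q m \<le> Suc t)" if "v \<in> N" for v
      using that by (auto simp: N_def not_less)
    have "finite N" "N \<noteq> {}" using v0 AB fin by (auto simp: N_def)
    then have "\<exists>Q. vertex_cover V E Q \<and> u \<in> Q \<and> N \<subseteq> Q \<and> cdeg Q m \<le> Suc t"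
      using tight
    proof (induction N rule: finite_ne_induct)
      case (singleton v)
      then show ?case by auto
    next
      case (insert v N)
      obtain Q where Q: "vertex_cover V E Q" "u \<in> Q" "N \<subseteq> Q" "cdeg Q m \<le> Suc t"
        using insert.IH insert.prems by auto
      obtain Q' where Q': "vertex_cover V E Q'" "u \<in> Q'" "v \<in> Q'" "cdeg Q' m \<le> Suc t"
        using insert.prems by auto
      \<comment> \<open>meet and join of the two covers\<close>
      define L where "L = (Q \<inter> Q' \<inter> A) \<union> ((Q \<union> Q') \<inter> B)"
      define U where "U = ((Q \<union> Q') \<inter> A) \<union> (Q \<inter> Q' \<inter> B)"
      have QV: "Q \<subseteq> V" "Q' \<subseteq> V" using Q Q' by (auto simp: vertex_cover_def)
      have LU: "L \<subseteq> V" "U \<subseteq> V" using AB by (auto simp: L_def U_def)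
      have "a \<in> L \<or> b \<in> L" "a \<in> U \<or> b \<in> U" if "a \<in> A" "b \<in> B" "{a, b} \<in> E" for a b
        using that coverD[OF Q(1) that(3)] coverD[OF Q'(1) that(3)] by (auto simp: L_def U_def)
      then have L: "vertex_cover V E L" and U: "vertex_cover V E U" using LU coverI by blast+
      have "cdeg L m + cdeg U m = cdeg Q m + cdeg Q' m"
        unfolding wdeg_plus
        by (rule wdeg_cong) (use AB QV in \<open>auto simp: L_def U_def\<close>)
      then have "cdeg L m \<le> Suc t" using cov[OF U] Q Q' by simp
      moreover have "u \<in> L" "insert v N \<subseteq> L"
        using Q Q' u insert.prems by (auto simp: L_def)
      ultimately show ?case using L by blast
    qed
    then obtain Q where Q: "vertex_cover V E Q" "u \<in> Q" "N \<subseteq> Q" "cdeg Q m \<le> Suc t" by blast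
    \<comment> \<open>the neighbours of \<open>u\<close> of degree zero, which replace \<open>u\<close> in the cover\<close>
    define Z where "Z = {v \<in> B. {u, v} \<in> E \<and> v \<notin> keys m}"
    have "vertex_cover V E ((Q - {u}) \<union> Z)"
    proof (rule coverI)
      show "(Q - {u}) \<union> Z \<subseteq> V" using Q(1) AB by (auto simp: Z_def vertex_cover_def)
      fix a b assume ab: "a \<in> A" "b \<in> B" "{a, b} \<in> E"
      have "b \<noteq> u" using ab u AB by blast
      show "a \<in> (Q - {u}) \<union> Z \<or> b \<in> (Q - {u}) \<union> Z"
      proof (cases "a = u")
        case True
        then have "b \<in> N \<or> b \<in> Z" using ab by (simp add: N_def Z_def)
        then show ?thesis using Q(3) \<open>b \<noteq> u\<close> by blast
      next
        case False
        then show ?thesis using coverD[OF Q(1) ab(3)] \<open>b \<noteq> u\<close> by blast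
      qed
    qed
    then have "Suc t \<le> cdeg ((Q - {u}) \<union> Z) m" by (rule cov)
    also have "\<dots> = cdeg (Q - {u}) m" by (rule cdeg_Un_zero) (auto simp: Z_def)
    finally have "Suc t \<le> cdeg (Q - {u}) m" .
    moreover have "cdeg (Q - {u}) m + cdeg {u} m = cdeg Q m"
      unfolding wdeg_plus by (rule wdeg_cong) (use Q in auto)
    moreover have "cdeg {u} m \<noteq> 0" using u by (auto simp: wdeg_eq_0_iff)
    ultimately show False using Q by simp
  qed
  then obtain v where v: "v \<in> N" "\<And>Q. vertex_cover V E Q \<Longrightarrow> u \<in> Q \<Longrightarrow> v \<in> Q \<Longrightarrow> Suc t < cdeg Q m" by blast
  have uv: "u \<noteq> v" using v u AB by (auto simp: N_def)
  obtain m1 where m1: "m = unit_exp u + m1" using u remove_unit_exp by metis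
  have "v \<in> keys m1" using v uv by (simp add: N_def m1 keys_add_nat)
  then obtain m' where m': "m1 = unit_exp v + m'" using remove_unit_exp by metis
  have m: "m = unit_exp u + unit_exp v + m'" by (simp add: m1 m' add.assoc)
  have "cover_mult V E t m'"
    unfolding cover_mult_def
  proof (intro allI impI)
    fix Q assume Q: "vertex_cover V E Q"
    have "cdeg Q m = of_bool (u \<in> Q) + of_bool (v \<in> Q) + cdeg Q m'" by (simp add: m)
    then show "t \<le> cdeg Q m'"
      using cov[OF Q] v(2)[OF Q] by (cases "u \<in> Q"; cases "v \<in> Q") auto
  qed
  then have "edge_mult E t m'" by (rule Suc.IH)
  then show ?case unfolding m using v by (intro edge_mult_step) (auto simp: N_def)
qed simp

text \<open>
  A neighbour \<open>j\<close> of \<open>i\<close> in the support of \<open>m\<close> pairs with one of the \<open>t\<close> copies of \<open>i\<close>, which lowers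
  every cover degree of the rest by at most one. If there is no such neighbour, then adding all
  neighbours of \<open>i\<close> to a cover of the remaining bipartite graph yields a cover of the whole graph
  at no cost.
\<close>

lemma edge_mult_after_inverting_vertex:
  assumes G: "simple_graph V E" and i: "i \<in> V"
    and bip: "bipartite (V - closed_nbhd V E {i}) {e \<in> E. e \<subseteq> V - closed_nbhd V E {i}}"
  shows "cover_mult V E t m \<Longrightarrow> edge_mult E t (single i t + m)"
proof (induction t arbitrary: m)
  case (Suc t)
  show ?case
  proof (cases "\<exists>j\<in>keys m. {i, j} \<in> E")
    case True
    then obtain j where j: "j \<in> keys m" "{i, j} \<in> E" by blast
    obtain m' where m': "m = unit_exp j + m'" using j remove_unit_exp by metis
    have "cover_mult V E t m'"
      unfolding cover_mult_def
    proof (intro allI impI)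
      fix Q assume "vertex_cover V E Q"
      then have "Suc t \<le> cdeg Q m" using Suc.prems by (auto simp: cover_mult_def)
      then show "t \<le> cdeg Q m'" by (cases "j \<in> Q") (auto simp: m')
    qed
    then have "edge_mult E t (single i t + m')" by (rule Suc.IH)
    from edge_mult_step[OF j(2) this]
    have "edge_mult E (Suc t) (unit_exp i + unit_exp j + (single i t + m'))" .
    also have "unit_exp i + unit_exp j + (single i t + m') = (unit_exp i + single i t) + m"
      by (simp add: m' add_ac)
    also have "unit_exp i + single i t = single i (Suc t)"
      by (simp add: unit_exp_def flip: single_add)
    finally show ?thesis .
  next
    case False
    let ?V = "V - closed_nbhd V E {i}" and ?E = "{e \<in> E. e \<subseteq> V - closed_nbhd V E {i}}"
    obtain A B where AB: "A \<union> B = ?V" "A \<inter> B = {}" "\<And>e. e \<in> ?E \<Longrightarrow> \<exists>a\<in>A. \<exists>b\<in>B. e = {a, b}"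
      using bip unfolding bipartite_def by auto
    have "finite ?V" using G by (simp add: simple_graph_def)
    moreover have "cover_mult ?V ?E (Suc t) m"
      unfolding cover_mult_def
    proof (intro allI impI)
      fix Q assume Q: "vertex_cover ?V ?E Q"
      have "vertex_cover V E (Q \<union> open_nbhd V E {i})"
        unfolding vertex_cover_def
      proof (intro conjI allI impI)
        show "Q \<union> open_nbhd V E {i} \<subseteq> V" using Q by (auto simp: vertex_cover_def open_nbhd_def)
        fix a b assume ab: "{a, b} \<in> E"
        then have abV: "a \<in> V" "b \<in> V" using G by (auto simp: simple_graph_def)
        show "a \<in> Q \<union> open_nbhd V E {i} \<or> b \<in> Q \<union> open_nbhd V E {i}"
        proof (rule ccontr)
          assume n: "\<not> ?thesis"
          then have "a \<noteq> i" "b \<noteq> i" using ab abV by (auto simp: open_nbhd_def insert_commute)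
          then have "{a, b} \<in> ?E" using n ab abV by (auto simp: closed_nbhd_def)
          then show False using Q n by (auto simp: vertex_cover_def)
        qed
      qed
      then have "Suc t \<le> cdeg (Q \<union> open_nbhd V E {i}) m" using Suc.prems by (auto simp: cover_mult_def)
      also have "\<dots> = cdeg Q m" by (rule cdeg_Un_zero) (use False in \<open>auto simp: open_nbhd_def\<close>)
      finally show "Suc t \<le> cdeg Q m" .
    qed
    ultimately have "edge_mult ?E (Suc t) m" using bipartite_koenig[OF _ AB] by blast
    then have "edge_mult E (Suc t) m" by (rule edge_mult_mono[rotated]) auto
    then show ?thesis by (rule edge_mult_add)
  qed
qed simp

section \<open>Induced odd cycles\<close>

lemma relpow_symmetric:
  assumes "sym R" shows "(a, b) \<in> R ^^ k \<Longrightarrow> (b, a) \<in> R ^^ k"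
proof (induction k arbitrary: b)
  case (Suc k)
  then obtain c where c: "(a, c) \<in> R ^^ k" "(c, b) \<in> R" by auto
  then have "(b, c) \<in> R" using assms by (auto dest: symD)
  then show ?case using Suc.IH[OF c(1)] by (rule relpow_Suc_I2)
qed simp

text \<open>
  Vertices are coloured by the parity of a walk to a chosen representative of their component.
\<close>

lemma no_odd_closed_walk_bipartite:
  assumes G: "simple_graph V E" and R: "R = {(a, b). {a, b} \<in> E}"
    and noodd: "\<And>u k. (u, u) \<in> R ^^ k \<Longrightarrow> even k"
  shows "bipartite V E"
proof -
  have symR: "sym R" unfolding R by (auto intro: symI simp: insert_commute)
  define r where "r v = (SOME u. (v, u) \<in> R\<^sup>*)" for v
  have r: "(v, r v) \<in> R\<^sup>*" for v unfolding r_def by (rule someI[of _ v]) simp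
  have r_eq: "r a = r b" if "(a, b) \<in> R" for a b
  proof -
    have "(b, a) \<in> R" using that symR by (auto dest: symD)
    then have "(a, u) \<in> R\<^sup>* \<longleftrightarrow> (b, u) \<in> R\<^sup>*" for u
      using that by (meson converse_rtrancl_into_rtrancl)
    then show ?thesis by (simp add: r_def)
  qed
  define A where "A = {v \<in> V. \<exists>k. even k \<and> (v, r v) \<in> R ^^ k}"
  have parity: "a \<in> A \<longleftrightarrow> b \<notin> A" if ab: "{a, b} \<in> E" for a b
  proof -
    have abR: "(a, b) \<in> R" and V: "a \<in> V" "b \<in> V" using ab G by (auto simp: R simple_graph_def)
    obtain k l where k: "(a, r a) \<in> R ^^ k" and l: "(b, r b) \<in> R ^^ l"
      using r rtrancl_power by metis
    have opp: "even k' \<longleftrightarrow> odd l'" if k': "(a, r a) \<in> R ^^ k'" and l': "(b, r b) \<in> R ^^ l'" for k' l'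
    proof -
      have "(r a, b) \<in> R ^^ l'" using relpow_symmetric[OF symR l'] r_eq[OF abR] by simp
      then have "(a, b) \<in> R ^^ (k' + l')" using k' by (auto simp: relpow_add)
      moreover have "(b, a) \<in> R" using abR symR by (auto dest: symD)
      ultimately have "(a, a) \<in> R ^^ Suc (k' + l')" by auto
      then show ?thesis using noodd[of a "Suc (k' + l')"] by simp
    qed
    have "a \<in> A \<longleftrightarrow> even k" unfolding A_def using V k opp[OF _ l] by blast
    moreover have "b \<in> A \<longleftrightarrow> even l" unfolding A_def using V l opp[OF k] by blast
    ultimately show ?thesis using opp[OF k l] by simp
  qed
  show ?thesis
    unfolding bipartite_def
  proof (intro exI conjI ballI)
    show "A \<union> (V - A) = V" "A \<inter> (V - A) = {}" by (auto simp: A_def)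
    fix e assume e: "e \<in> E"
    then obtain a b where ab: "e = {a, b}" "e \<subseteq> V" using G by (auto simp: simple_graph_def card_2_iff)
    show "\<exists>a\<in>A. \<exists>b\<in>V - A. e = {a, b}"
      using parity[of a b] ab e by (cases "a \<in> A") (auto simp: insert_commute)
  qed
qed

text \<open>
  A shortest odd closed walk is an induced cycle: a repeated vertex or a chord splits it into two
  closed walks whose lengths add up to an odd number, and the odd one of them is shorter.
\<close>

lemma nonbipartite_imp_induced_odd_cycle:
  assumes G: "simple_graph V E" and "\<not> bipartite V E"
  obtains C where "induced_odd_cycle V E C"
proof -
  define R where "R = {(a, b). {a, b} \<in> E}"
  have symR: "sym R" unfolding R_def by (auto intro: symI simp: insert_commute)
  have "\<exists>k u. odd k \<and> (u, u) \<in> R ^^ k"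
    using no_odd_closed_walk_bipartite[OF G R_def] assms(2) by blast
  define k where "k = (LEAST k. \<exists>u. odd k \<and> (u, u) \<in> R ^^ k)"
  have "\<exists>u. odd k \<and> (u, u) \<in> R ^^ k"
    unfolding k_def by (rule LeastI_ex) fact
  then obtain u where u: "odd k" "(u, u) \<in> R ^^ k" by blast
  have min: "k \<le> l" if "odd l" "(v, v) \<in> R ^^ l" for l v
    unfolding k_def by (rule Least_le) (use that in blast)
  obtain f where f: "f 0 = u" "f k = u" "\<And>i. i < k \<Longrightarrow> (f i, f (Suc i)) \<in> R"
    using u(2) relpow_fun_conv[of u u k R] by blast
  have seg: "(f i, f (i + d)) \<in> R ^^ d" if "i + d \<le> k" for i d
    using that
  proof (induction d)
    case (Suc d)
    then show ?case using f(3)[of "i + d"] by auto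
  qed simp
  have seg': "(f i, f j) \<in> R ^^ (j - i)" if "i \<le> j" "j \<le> k" for i j
    using seg[of i "j - i"] that by simp
  have outer: "(f j, f i) \<in> R ^^ (k - (j - i))" if "i \<le> j" "j \<le> k" for i j
  proof -
    have "(f j, f k) \<in> R ^^ (k - j)" "(f k, f i) \<in> R ^^ i"
      using seg'[of j k] seg'[of 0 i] f that by auto
    then have "(f j, f i) \<in> R ^^ ((k - j) + i)" by (auto simp: relpow_add)
    then show ?thesis using that by simp
  qed
  have edge: "(f i, f j) \<in> R \<longleftrightarrow> {f i, f j} \<in> E" for i j by (simp add: R_def)
  have loopfree: "(a, a) \<notin> R" for a using G by (auto simp: R_def simple_graph_def)
  have "k \<noteq> 1" using u loopfree by auto
  then have k3: "k \<ge> 3" using u(1) by (cases k rule: nat.exhaust) (auto elim!: oddE)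
  have inj: "f i \<noteq> f j" if ij: "i < j" "j < k" for i j
  proof
    assume eq: "f i = f j"
    have 1: "(f i, f i) \<in> R ^^ (j - i)" using seg'[OF less_imp_le less_imp_le, OF ij] by (simp only: eq)
    have 2: "(f i, f i) \<in> R ^^ (k - (j - i))" using outer[OF less_imp_le less_imp_le, OF ij] by (simp only: eq)
    have "odd ((j - i) + (k - (j - i)))" using u(1) ij by simp
    then have "odd (j - i) \<or> odd (k - (j - i))" unfolding even_add by blast
    then show False
    proof
      assume "odd (j - i)"
      from min[OF this 1] show False using ij by simp
    next
      assume "odd (k - (j - i))"
      from min[OF this 2] show False using ij by simp
    qed
  qed
  have chord: "j = Suc i \<or> i = 0 \<and> j = k - 1" if ij: "i < j" "j < k" and e: "(f i, f j) \<in> R" for i j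
  proof (rule ccontr)
    assume n: "\<not> ?thesis"
    have e': "(f j, f i) \<in> R" using e symR by (auto dest: symD)
    have 1: "(f i, f i) \<in> R ^^ Suc (j - i)"
      by (rule relpow_Suc_I[OF seg'[OF less_imp_le less_imp_le, OF ij] e'])
    have 2: "(f j, f j) \<in> R ^^ Suc (k - (j - i))"
      by (rule relpow_Suc_I[OF outer[OF less_imp_le less_imp_le, OF ij] e])
    have "odd ((j - i) + (k - (j - i)))" using u(1) ij by simp
    then have "odd (Suc (j - i)) \<or> odd (Suc (k - (j - i)))" unfolding even_add even_Suc by blast
    then show False
    proof
      assume "odd (Suc (j - i))"
      from min[OF this 1] show False using ij n by auto
    next
      assume "odd (Suc (k - (j - i)))"
      from min[OF this 2] show False using ij n by auto
    qed
  qed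
  have "induced_odd_cycle V E (f ` {..<k})"
    unfolding induced_odd_cycle_def induced_cycle_def
  proof (intro conjI exI[of _ "map f [0..<k]"] allI impI)
    have injf: "inj_on f {..<k}" using inj by (intro linorder_inj_onI) auto
    then show "distinct (map f [0..<k])" by (simp add: distinct_map lessThan_atLeast0)
    show "set (map f [0..<k]) = f ` {..<k}" by (simp add: lessThan_atLeast0)
    have "f i \<in> V" if "i < k" for i using f(3)[OF that] G by (auto simp: R_def simple_graph_def)
    then show "f ` {..<k} \<subseteq> V" by auto
    show "length (map f [0..<k]) \<ge> 3" using k3 by simp
    show "odd (card (f ` {..<k}))" using injf u(1) by (simp add: card_image)
    fix i j assume ij: "i < j \<and> j < length (map f [0..<k])"
    have "(f i, f j) \<in> R" if "j = Suc i \<or> i = 0 \<and> j = k - 1"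
    proof (cases "j = Suc i")
      case True
      then show ?thesis using f(3)[of i] ij by simp
    next
      case False
      then have "i = 0" "Suc j = k" using that ij by auto
      then show ?thesis using f(3)[of j] f(1,2) symR ij by (auto dest: symD)
    qed
    then show "{map f [0..<k] ! i, map f [0..<k] ! j} \<in> E \<longleftrightarrow>
       j = Suc i \<or> i = 0 \<and> j = length (map f [0..<k]) - 1"
      using chord[of i j] ij edge by auto
  qed
  then show ?thesis by (rule that)
qed

lemma induced_odd_cycle_of_induced_subgraph:
  assumes "U \<subseteq> V" "induced_odd_cycle U {e \<in> E. e \<subseteq> U} C"
  shows "induced_odd_cycle V E C"
proof -
  obtain vs where vs: "distinct vs" "set vs = C" "C \<subseteq> U" "length vs \<ge> 3"
    "\<And>i j. i < j \<and> j < length vs \<Longrightarrow>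
           ({vs ! i, vs ! j} \<in> {e \<in> E. e \<subseteq> U} \<longleftrightarrow> j = Suc i \<or> i = 0 \<and> j = length vs - 1)"
    using assms(2) unfolding induced_odd_cycle_def induced_cycle_def by auto
  have "{vs ! i, vs ! j} \<subseteq> U" if "i < j" "j < length vs" for i j
    using that vs(2,3) nth_mem[of i vs] nth_mem[of j vs] by auto
  then have "\<forall>i j. i < j \<and> j < length vs \<longrightarrow>
           ({vs ! i, vs ! j} \<in> E \<longleftrightarrow> j = Suc i \<or> i = 0 \<and> j = length vs - 1)"
    using vs(5) by blast
  then have "induced_cycle V E C"
    unfolding induced_cycle_def using vs assms(1) by (intro exI[of _ vs]) auto
  then show ?thesis using assms(2) by (simp add: induced_odd_cycle_def)
qed

section \<open>Monomials that grow from an odd cycle\<close>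

text \<open>
  The witnesses for the gap between the two powers. Such a monomial lies in the symbolic power with
  exponent \<open>t + 1\<close>; its degree is one too small for the ordinary power, but any variable of \<open>N[T]\<close>
  moves it there.
\<close>

definition core :: "'v set \<Rightarrow> 'v set set \<Rightarrow> 'v set \<Rightarrow> nat \<Rightarrow> ('v \<Rightarrow>\<^sub>0 nat) \<Rightarrow> bool" where
  "core V E T t g \<longleftrightarrow> T \<subseteq> V \<and> keys g \<subseteq> T \<and> wdeg (\<lambda>_. 1) g = 2 * t + 1 \<and> edge_mult E t g \<and>
     (\<forall>v\<in>closed_nbhd V E T. edge_mult E (Suc t) (unit_exp v + g))"

text \<open>
  The new edge accounts for the vertices of \<open>N[T]\<close>. For a neighbour \<open>y\<close> of \<open>w\<close> the edge \<open>wy\<close> is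
  used instead, and the copy of \<open>v\<close> thus set free completes an edge with \<open>g\<close>.
\<close>

lemma core_extend:
  assumes "core V E T t g" "v \<in> T" "{v, w} \<in> E" "w \<in> V"
  shows "core V E (insert w T) (Suc t) (unit_exp v + unit_exp w + g)"
proof -
  have g: "T \<subseteq> V" "keys g \<subseteq> T" "wdeg (\<lambda>_. 1) g = 2 * t + 1" "edge_mult E t g"
    "\<And>v. v \<in> closed_nbhd V E T \<Longrightarrow> edge_mult E (Suc t) (unit_exp v + g)"
    using assms(1) by (auto simp: core_def)
  have wN: "w \<in> closed_nbhd V E T" using assms by (auto simp: closed_nbhd_def open_nbhd_def)
  have "edge_mult E (Suc (Suc t)) (unit_exp y + (unit_exp v + unit_exp w + g))"
    if y: "y \<in> closed_nbhd V E (insert w T)" for y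
  proof (cases "y \<in> closed_nbhd V E T")
    case True
    from edge_mult_step[OF assms(3) g(5)[OF True]] show ?thesis by (simp only: add_ac)
  next
    case False
    then have "{w, y} \<in> E" using y wN by (auto simp: closed_nbhd_def open_nbhd_def)
    moreover have "edge_mult E (Suc t) (unit_exp v + g)"
      using g(5) assms(2) by (auto simp: closed_nbhd_def)
    ultimately have "edge_mult E (Suc (Suc t)) (unit_exp w + unit_exp y + (unit_exp v + g))"
      by (rule edge_mult_step)
    then show ?thesis by (simp only: add_ac)
  qed
  then show ?thesis
    unfolding core_def using g assms edge_mult_step[OF assms(3) g(4)]
    by (auto simp: keys_add_nat)
qed

text \<open>An edge inside \<open>T\<close> raises the exponent without changing \<open>T\<close>.\<close>

lemma core_pad:
  assumes "core V E T t g" "v \<in> T" "w \<in> T" "{v, w} \<in> E"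
  shows "\<exists>g'. core V E T (t + s) g'"
proof (induction s)
  case (Suc s)
  then obtain g' where g': "core V E T (t + s) g'" by blast
  then have "w \<in> V" using assms(3) by (auto simp: core_def)
  from core_extend[OF g' assms(2,4) this] show ?case using assms(3) by (auto simp: insert_absorb)
qed (use assms in auto)

text \<open>
  A cover that contains \<open>T\<close> has degree \<open>2t + 1\<close> in \<open>g\<close>. Any other cover misses some \<open>v \<in> T\<close>, and
  multiplying by \<open>v\<close> does not change its degree.
\<close>

lemma core_cover_mult:
  assumes "core V E T t g" shows "cover_mult V E (Suc t) g"
  unfolding cover_mult_def
proof (intro allI impI)
  fix Q assume Q: "vertex_cover V E Q"
  show "Suc t \<le> cdeg Q g"
  proof (cases "T \<subseteq> Q")
    case True
    then have "cdeg Q g = wdeg (\<lambda>_. 1) g"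
      using assms by (intro wdeg_cong) (auto simp: core_def)
    then show ?thesis using assms by (simp add: core_def)
  next
    case False
    then obtain v where v: "v \<in> T" "v \<notin> Q" by blast
    then have "cover_mult V E (Suc t) (unit_exp v + g)"
      using assms by (intro edge_mult_cover_mult) (auto simp: core_def closed_nbhd_def)
    then have "Suc t \<le> cdeg Q (unit_exp v + g)" using Q by (simp add: cover_mult_def)
    then show ?thesis using v by simp
  qed
qed

text \<open>
  The weight one on \<open>T\<close>, zero on \<open>F\<close> and two elsewhere gives every edge weight at least two, but the
  monomial has weight \<open>2t + 1\<close> only.
\<close>

lemma core_not_edge_mult:
  assumes core: "core V E T t g" and G: "simple_graph V E"
    and F: "F \<inter> closed_nbhd V E T = {}" "\<And>i j. i \<in> F \<Longrightarrow> j \<in> F \<Longrightarrow> {i, j} \<notin> E"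
    and m: "keys m \<subseteq> F"
  shows "\<not> edge_mult E (Suc t) (g + m)"
proof
  assume em: "edge_mult E (Suc t) (g + m)"
  define w where "w v = (if v \<in> T then 1 else if v \<in> F then 0 else 2 :: nat)" for v
  have TF: "T \<inter> F = {}" using F(1) by (auto simp: closed_nbhd_def)
  have no: "i \<notin> F" if "j \<in> T" "{i, j} \<in> E" for i j
  proof -
    have "{j, i} \<in> E" "i \<in> V" using that(2) G by (auto simp: simple_graph_def insert_commute)
    then show ?thesis using that(1) F(1) by (auto simp: closed_nbhd_def open_nbhd_def)
  qed
  have "2 \<le> w i + w j" if "{i, j} \<in> E" for i j
    using that F(2)[of i j] no[of i j] no[of j i] by (auto simp: w_def insert_commute)
  from edge_mult_weight[of E 2, OF this em] have "2 * Suc t \<le> wdeg w g + wdeg w m" by simp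
  moreover have "wdeg w g = wdeg (\<lambda>_. 1) g"
    using core by (intro wdeg_cong) (auto simp: core_def w_def)
  moreover have "wdeg w m = 0" using m TF by (auto simp: wdeg_eq_0_iff w_def)
  ultimately show False using core by (simp add: core_def)
qed

lemma edge_mult_path:
  "length xs = 2 * k \<Longrightarrow> (\<And>i. Suc i < length xs \<Longrightarrow> {xs ! i, xs ! Suc i} \<in> E) \<Longrightarrow>
     edge_mult E k (sum_list (map unit_exp xs))"
proof (induction k arbitrary: xs)
  case (Suc k)
  then obtain a b ys where xs: "xs = a # b # ys" "length ys = 2 * k"
    by (auto simp: length_Suc_conv numeral_2_eq_2)
  have "{a, b} \<in> E" using Suc.prems(2)[of 0] xs by simp
  moreover have "edge_mult E k (sum_list (map unit_exp ys))"
    using Suc.prems(2)[of "Suc (Suc _)"] xs by (intro Suc.IH) auto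
  ultimately have "edge_mult E (Suc k) (unit_exp a + unit_exp b + sum_list (map unit_exp ys))"
    by (rule edge_mult_step)
  then show ?case by (simp add: xs add.assoc)
qed simp

text \<open>
  An odd cycle without one vertex is a path with a perfect matching. Every vertex of \<open>N[C]\<close>, on the
  cycle or not, has a neighbour on the cycle, and completes an edge with that neighbour.
\<close>

lemma core_odd_cycle:
  assumes "simple_graph V E" "induced_odd_cycle V E C"
  obtains c v w g where "card C = 2 * c + 1" "core V E C c g" "v \<in> C" "w \<in> C" "{v, w} \<in> E"
proof -
  obtain vs where vs: "distinct vs" "set vs = C" "C \<subseteq> V" "length vs \<ge> 3"
    "\<And>i j. i < j \<Longrightarrow> j < length vs \<Longrightarrow>
        ({vs ! i, vs ! j} \<in> E \<longleftrightarrow> j = Suc i \<or> i = 0 \<and> j = length vs - 1)"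
    and odd: "odd (card C)"
    using assms(2) unfolding induced_odd_cycle_def induced_cycle_def by blast
  have len: "length vs = card C" using vs distinct_card by metis
  obtain c where c: "card C = 2 * c + 1" using odd by (rule oddE)
  define g where "g = sum_list (map unit_exp vs)"
  have succ: "{vs ! i, vs ! Suc i} \<in> E" if "Suc i < length vs" for i
    using vs(5)[of i "Suc i"] that by simp
  have wrap: "{vs ! (length vs - 1), vs ! 0} \<in> E"
    using vs(5)[of 0 "length vs - 1"] vs(4) by (simp add: insert_commute)
  have delete: "\<exists>g'. g = unit_exp (vs ! p) + g' \<and> edge_mult E c g'" if p: "p < length vs" for p
  proof (intro exI conjI)
    define ys where "ys = drop (Suc p) vs @ take p vs"
    show "edge_mult E c (sum_list (map unit_exp ys))"
    proof (rule edge_mult_path)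
      show "length ys = 2 * c" using p len c by (simp add: ys_def)
      fix i assume i: "Suc i < length ys"
      define r where "r = length vs - Suc p"
      consider "Suc i < r" | "Suc i = r" | "i \<ge> r" by linarith
      then show "{ys ! i, ys ! Suc i} \<in> E"
      proof cases
        case 1
        then show ?thesis using succ[of "Suc p + i"] p by (simp add: ys_def nth_append r_def)
      next
        case 2
        then have "Suc (p + i) = length vs - 1" using p by (simp add: r_def)
        then have "ys ! i = vs ! (length vs - 1)" "ys ! Suc i = vs ! 0"
          using 2 p i by (auto simp: ys_def nth_append r_def)
        then show ?thesis using wrap by simp
      next
        case 3
        then have "ys ! i = vs ! (i - r)" "ys ! Suc i = vs ! Suc (i - r)" "Suc (i - r) < p"
          using p i by (auto simp: ys_def nth_append r_def Suc_diff_le)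
        then show ?thesis using succ[of "i - r"] p by simp
      qed
    qed
    have "g = sum_list (map unit_exp (take p vs @ vs ! p # drop (Suc p) vs))"
      using id_take_nth_drop[OF p] by (simp add: g_def)
    then show "g = unit_exp (vs ! p) + sum_list (map unit_exp ys)"
      by (simp add: ys_def add_ac)
  qed
  have "core V E C c g"
    unfolding core_def
  proof (intro conjI ballI)
    have keys: "keys (sum_list (map unit_exp xs)) = set xs" for xs :: "'a list"
      by (induction xs) (auto simp: keys_add_nat)
    show "keys g \<subseteq> C" by (simp add: g_def keys vs)
    have "wdeg (\<lambda>_. 1) (sum_list (map unit_exp xs)) = length xs" for xs :: "'a list"
      by (induction xs) auto
    then show "wdeg (\<lambda>_. 1) g = 2 * c + 1" using len c by (simp add: g_def)
    show "edge_mult E c g" using delete[of 0] vs(4) edge_mult_add by fastforce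
    fix v assume v: "v \<in> closed_nbhd V E C"
    have "\<exists>u\<in>C. {u, v} \<in> E"
    proof (cases "v \<in> C")
      case True
      then obtain p where p: "p < length vs" "v = vs ! p" using vs(2) by (metis in_set_conv_nth)
      have "0 < length vs" using vs(4) by auto
      show ?thesis
      proof (cases "Suc p < length vs")
        case True
        then show ?thesis
          using succ[of p] p vs(2) nth_mem[of "Suc p" vs]
          by (intro bexI[of _ "vs ! Suc p"]) (auto simp: insert_commute)
      next
        case False
        then have "p = length vs - 1" using p by simp
        then show ?thesis
          using wrap p vs(2) nth_mem[OF \<open>0 < length vs\<close>]
          by (intro bexI[of _ "vs ! 0"]) (auto simp: insert_commute)
      qed
    qed (use v in \<open>auto simp: closed_nbhd_def open_nbhd_def\<close>)
    then obtain u where u: "u \<in> set vs" "{u, v} \<in> E" using vs(2) by blast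
    then obtain p where p: "p < length vs" "u = vs ! p" by (metis in_set_conv_nth)
    obtain g' where g': "g = unit_exp u + g'" "edge_mult E c g'" using delete[OF p(1)] p(2) by blast
    from edge_mult_step[OF u(2) g'(2)] show "edge_mult E (Suc c) (unit_exp v + g)"
      unfolding g'(1) by (simp only: add_ac)
  qed (rule vs(3))
  moreover have len01: "0 < length vs" "1 < length vs" using vs(4) by auto
  have "vs ! 0 \<in> C" "vs ! 1 \<in> C" using nth_mem[OF len01(1)] nth_mem[OF len01(2)] vs(2) by simp_all
  moreover have "{vs ! 0, vs ! 1} \<in> E" using succ[of 0] len01 by simp
  ultimately show ?thesis by (rule that[OF c])
qed

lemma maximal_independent_set:
  assumes "finite U" "\<And>v. {v} \<notin> E"
  obtains F where "F \<subseteq> U" "\<And>i j. i \<in> F \<Longrightarrow> j \<in> F \<Longrightarrow> {i, j} \<notin> E"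
    "\<And>j. j \<in> U - F \<Longrightarrow> \<exists>f\<in>F. {j, f} \<in> E"
proof -
  have "\<exists>F. F \<subseteq> U \<and> (\<forall>i\<in>F. \<forall>j\<in>F. {i, j} \<notin> E) \<and> (\<forall>j\<in>U - F. \<exists>f\<in>F. {j, f} \<in> E)"
    using assms(1)
  proof (induction U rule: finite_induct)
    case (insert u U)
    then obtain F where F: "F \<subseteq> U" "\<forall>i\<in>F. \<forall>j\<in>F. {i, j} \<notin> E" "\<forall>j\<in>U - F. \<exists>f\<in>F. {j, f} \<in> E" by blast
    show ?case
    proof (cases "\<exists>f\<in>F. {u, f} \<in> E")
      case True
      then show ?thesis using F by (intro exI[of _ F]) auto
    next
      case False
      then show ?thesis using F assms(2) by (intro exI[of _ "insert u F"]) (auto simp: insert_commute)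
    qed
  qed auto
  then show ?thesis using that by blast
qed

text \<open>A path from \<open>C\<close> to a vertex outside \<open>N[C]\<close> has an edge that leaves \<open>N[C]\<close>.\<close>

lemma vertices_beyond_neighbourhood:
  assumes "graph_connected V E" "simple_graph V E" "C \<subseteq> V" "C \<noteq> {}" "closed_nbhd V E C \<noteq> V"
  obtains v w u where "v \<in> C" "{v, w} \<in> E" "{w, u} \<in> E" "w \<in> V" "u \<in> V" "u \<notin> closed_nbhd V E C"
proof -
  have NV: "closed_nbhd V E C \<subseteq> V" using assms(3) by (auto simp: closed_nbhd_def open_nbhd_def)
  then obtain x where x: "x \<in> V" "x \<notin> closed_nbhd V E C" using assms(5) by blast
  obtain c where c: "c \<in> C" using assms(4) by blast
  have "(c, x) \<in> {(a, b). {a, b} \<in> E}\<^sup>*" using assms(1,3) c x by (auto simp: graph_connected_def)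
  moreover have "c \<in> closed_nbhd V E C" using c by (simp add: closed_nbhd_def)
  ultimately have "\<exists>w u. {w, u} \<in> E \<and> w \<in> closed_nbhd V E C \<and> u \<notin> closed_nbhd V E C"
    using x(2) by (induction rule: rtrancl_induct) auto
  then obtain w u where wu: "{w, u} \<in> E" "w \<in> closed_nbhd V E C" "u \<notin> closed_nbhd V E C" by blast
  have V: "w \<in> V" "u \<in> V" using wu(1) assms(2) by (auto simp: simple_graph_def)
  have "w \<notin> C" using wu V by (auto simp: closed_nbhd_def open_nbhd_def)
  then obtain v where "v \<in> C" "{v, w} \<in> E" using wu(2) by (auto simp: closed_nbhd_def open_nbhd_def)
  then show ?thesis using that wu V by blast
qed

section \<open>Ordinary and symbolic powers of edge ideals\<close>

lemma mpoly_var_unit_exp: "mpoly_var v = single (unit_exp v) 1"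
  by (simp add: mpoly_var_def unit_exp_def)

lemma mult_single_unit_exp:
  "single m (c :: 'k::field) * (mpoly_var i * mpoly_var j) = single (unit_exp i + unit_exp j + m) c"
  by (simp add: mpoly_var_unit_exp mult_single add_ac)

lemma edge_mult_edge: "{i, j} \<in> E \<Longrightarrow> edge_mult E (Suc 0) (unit_exp i + unit_exp j)"
  using edge_mult_step[of i j E 0 0] by simp

lemma edge_mult_ideal: "ideal (mono_ideal V (edge_mult E t) :: (('v \<Rightarrow>\<^sub>0 nat) \<Rightarrow>\<^sub>0 'k::field) set) (mpoly_ring V)"
  by (rule mono_ideal_ideal) (rule edge_mult_add)

lemma cover_mult_ideal: "ideal (mono_ideal V (cover_mult V E t) :: (('v \<Rightarrow>\<^sub>0 nat) \<Rightarrow>\<^sub>0 'k::field) set) (mpoly_ring V)"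
  by (rule mono_ideal_ideal) (rule cover_mult_add)

lemma edge_ideal_eq:
  assumes G: "simple_graph V E"
  shows "(edge_ideal V E :: (('v \<Rightarrow>\<^sub>0 nat) \<Rightarrow>\<^sub>0 'k::field) set) = mono_ideal V (edge_mult E 1)"
proof
  interpret cring "mpoly_ring V :: (('v \<Rightarrow>\<^sub>0 nat) \<Rightarrow>\<^sub>0 'k) ring" by (rule mpoly_cring)
  let ?gens = "{mpoly_var i * mpoly_var j | i j. {i, j} \<in> E} :: (('v \<Rightarrow>\<^sub>0 nat) \<Rightarrow>\<^sub>0 'k) set"
  have EV: "i \<in> V \<and> j \<in> V" if "{i, j} \<in> E" for i j using that G by (auto simp: simple_graph_def)
  have gens: "?gens \<subseteq> mono_ideal V (edge_mult E 1)"
  proof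
    fix p assume "p \<in> ?gens"
    then obtain i j where ij: "p = mpoly_var i * mpoly_var j" "{i, j} \<in> E" by blast
    show "p \<in> mono_ideal V (edge_mult E 1)"
      using EV[OF ij(2)] edge_mult_edge[OF ij(2)] by (simp add: ij(1) mpoly_var_unit_exp mult_single single_in_mono_ideal keys_add_nat del: edge_mult.simps)
  qed
  then show "(edge_ideal V E :: (('v \<Rightarrow>\<^sub>0 nat) \<Rightarrow>\<^sub>0 'k) set) \<subseteq> mono_ideal V (edge_mult E 1)"
    unfolding edge_ideal_def by (rule genideal_minimal[OF edge_mult_ideal])
  have gc: "?gens \<subseteq> carrier (mpoly_ring V)" using gens by (auto simp: mono_ideal_def)
  have idl: "ideal (edge_ideal V E :: (('v \<Rightarrow>\<^sub>0 nat) \<Rightarrow>\<^sub>0 'k) set) (mpoly_ring V)"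
    unfolding edge_ideal_def by (rule genideal_ideal[OF gc])
  show "mono_ideal V (edge_mult E 1) \<subseteq> (edge_ideal V E :: (('v \<Rightarrow>\<^sub>0 nat) \<Rightarrow>\<^sub>0 'k) set)"
  proof
    fix p :: "('v \<Rightarrow>\<^sub>0 nat) \<Rightarrow>\<^sub>0 'k" assume p: "p \<in> mono_ideal V (edge_mult E 1)"
    show "p \<in> edge_ideal V E"
    proof (rule ideal_contains_if_monomials[OF idl])
      fix m assume m: "m \<in> keys p"
      then have mV: "keys m \<subseteq> V" and "edge_mult E (Suc 0) m"
        using p by (auto simp: mono_ideal_def mpoly_carrier)
      then obtain i j m' where ij: "{i, j} \<in> E" "m = unit_exp i + unit_exp j + m'" by auto
      have "mpoly_var i * mpoly_var j \<in> (edge_ideal V E :: (('v \<Rightarrow>\<^sub>0 nat) \<Rightarrow>\<^sub>0 'k) set)"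
        unfolding edge_ideal_def using genideal_self[OF gc] ij(1) by blast
      moreover have "single m' (lookup p m) \<in> carrier (mpoly_ring V)"
        using mV ij(2) by (auto simp: keys_add_nat)
      ultimately have "single m' (lookup p m) * (mpoly_var i * mpoly_var j) \<in> edge_ideal V E"
        using submod_mult[OF mpoly_ideal_submod[OF idl]] by blast
      then show "single m (lookup p m) \<in> edge_ideal V E"
        by (simp add: mult_single_unit_exp flip: ij(2))
    qed
  qed
qed

lemma edge_ideal_power_eq:
  assumes G: "simple_graph V E"
  shows "ideal_power (mpoly_ring V) (edge_ideal V E) t =
    (mono_ideal V (edge_mult E t) :: (('v \<Rightarrow>\<^sub>0 nat) \<Rightarrow>\<^sub>0 'k::field) set)"
proof (induction t)
  case 0
  show ?case by (auto simp: ideal_power_def ideals_set_def mono_ideal_def)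
next
  case (Suc t)
  let ?R = "mpoly_ring V :: (('v \<Rightarrow>\<^sub>0 nat) \<Rightarrow>\<^sub>0 'k) ring"
  let ?I = "\<lambda>t. mono_ideal V (edge_mult E t) :: (('v \<Rightarrow>\<^sub>0 nat) \<Rightarrow>\<^sub>0 'k) set"
  interpret cring ?R by (rule mpoly_cring)
  have EV: "i \<in> V \<and> j \<in> V" if "{i, j} \<in> E" for i j using that G by (auto simp: simple_graph_def)
  have "ideal_power ?R (edge_ideal V E) (Suc t) =
      ideal_prod ?R (ideal_power ?R (edge_ideal V E) t) (edge_ideal V E)"
    by (simp add: ideal_power_def ideals_set_def)
  also have "\<dots> = ideal_prod ?R (?I t) (?I 1)" by (rule arg_cong2[OF Suc edge_ideal_eq[OF G]])
  also have "\<dots> = ?I (Suc t)"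
  proof
    show "ideal_prod ?R (?I t) (?I 1) \<subseteq> ?I (Suc t)"
    proof
      fix p assume "p \<in> ideal_prod ?R (?I t) (?I 1)"
      then show "p \<in> ?I (Suc t)"
      proof (induction rule: ideal_prod.induct)
        case (prod f g)
        have "edge_mult E (Suc t) m" if m: "m \<in> keys (f * g)" for m
        proof -
          obtain a b where ab: "m = a + b" "a \<in> keys f" "b \<in> keys g" using keys_mult[of f g] m by blast
          then have "edge_mult E t a" "edge_mult E (Suc 0) b" using prod by (auto simp: mono_ideal_def)
          then obtain i j b' where b: "{i, j} \<in> E" "b = unit_exp i + unit_exp j + b'" by auto
          from edge_mult_step[OF b(1) edge_mult_add[OF \<open>edge_mult E t a\<close>, of b']]
          show ?thesis unfolding ab(1) b(2) by (simp only: add_ac)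
        qed
        then show ?case using prod by (simp add: mono_ideal_def mpoly_carrier_mult del: edge_mult.simps)
      next
        case (sum f g)
        from submod_add[OF mpoly_ideal_submod[OF edge_mult_ideal] sum.IH]
        show ?case by (simp only: mpoly_ring_simps)
      qed
    qed
    have idl: "ideal (ideal_prod ?R (?I t) (?I 1)) ?R"
      by (rule ideal_prod_is_ideal[OF edge_mult_ideal edge_mult_ideal])
    show "?I (Suc t) \<subseteq> ideal_prod ?R (?I t) (?I 1)"
    proof
      fix p assume p: "p \<in> ?I (Suc t)"
      show "p \<in> ideal_prod ?R (?I t) (?I 1)"
      proof (rule ideal_contains_if_monomials[OF idl])
        fix m assume m: "m \<in> keys p"
        then have mV: "keys m \<subseteq> V" and "edge_mult E (Suc t) m"
          using p by (auto simp: mono_ideal_def mpoly_carrier)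
        then obtain i j m' where ij: "{i, j} \<in> E" "m = unit_exp i + unit_exp j + m'" "edge_mult E t m'"
          by auto
        have "single m' (lookup p m) \<in> ?I t"
          using mV ij by (auto simp: single_in_mono_ideal keys_add_nat)
        moreover have "mpoly_var i * mpoly_var j \<in> ?I 1"
          using EV[OF ij(1)] edge_mult_edge[OF ij(1)]
          by (simp add: mpoly_var_unit_exp mult_single single_in_mono_ideal keys_add_nat del: edge_mult.simps)
        ultimately have "single m' (lookup p m) \<otimes>\<^bsub>?R\<^esub> (mpoly_var i * mpoly_var j) \<in> ideal_prod ?R (?I t) (?I 1)"
          by (rule ideal_prod.prod)
        then show "single m (lookup p m) \<in> ideal_prod ?R (?I t) (?I 1)"
          by (simp add: mult_single_unit_exp flip: ij(2))
      qed
    qed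
  qed
  finally show ?case .
qed

text \<open>An element contracts from a localized ideal if and only if some denominator moves it into the ideal.\<close>

lemma loc_contraction_iff:
  fixes P J :: "(('v \<Rightarrow>\<^sub>0 nat) \<Rightarrow>\<^sub>0 'k::field) set"
  assumes P: "primeideal P (mpoly_ring V)" and J: "ideal J (mpoly_ring V)"
  shows "f \<in> loc_contraction (mpoly_ring V) P J \<longleftrightarrow>
    f \<in> carrier (mpoly_ring V) \<and> (\<exists>s\<in>carrier (mpoly_ring V) - P. s * f \<in> J)"
proof -
  let ?R = "mpoly_ring V :: (('v \<Rightarrow>\<^sub>0 nat) \<Rightarrow>\<^sub>0 'k) ring"
  interpret P: primeideal P ?R by (rule P)
  interpret J: ideal J ?R by (rule J)
  have J_sub: "submod (carrier ?R) J" by (rule mpoly_ideal_submod[OF J])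
  have one: "1 \<in> carrier ?R - P" using P.one_imp_carrier P.I_notcarr P.one_closed by auto
  have mult: "s * u \<in> carrier ?R - P" if "s \<in> carrier ?R - P" "u \<in> carrier ?R - P" for s u
    using that P.I_prime[of s u] mpoly_carrier_mult[of s V u] by auto
  have frac: "(b, t) \<in> loc_frac ?R P a s \<longleftrightarrow> b \<in> carrier ?R \<and> t \<in> carrier ?R - P \<and>
      (\<exists>u\<in>carrier ?R - P. u * (t * a - s * b) = 0)" if "s \<in> carrier ?R" for a b s t
    using mpoly_minus[OF mpoly_carrier_mult[OF that, of b]] by (auto simp: loc_frac_def)
  show ?thesis
  proof
    assume "f \<in> loc_contraction ?R P J"
    then have f: "f \<in> carrier ?R" and "loc_frac ?R P f 1 \<in> loc_ideal ?R P J"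
      by (auto simp: loc_contraction_def)
    then obtain a s where a: "a \<in> J" and s: "s \<in> carrier ?R - P" and eq: "loc_frac ?R P f 1 = loc_frac ?R P a s"
      by (auto simp: loc_ideal_def)
    have "(f, 1) \<in> loc_frac ?R P f 1" using f one by (subst frac) auto
    then have "(f, 1) \<in> loc_frac ?R P a s" by (simp only: eq)
    then obtain u where u: "u \<in> carrier ?R - P" "u * (1 * a - s * f) = 0"
      using s by (subst (asm) frac) auto
    have "(s * u) * f = u * a" using u(2) by (simp add: algebra_simps)
    also have "\<dots> \<in> J" using u(1) a submod_mult[OF J_sub] by blast
    finally show "f \<in> carrier ?R \<and> (\<exists>s\<in>carrier ?R - P. s * f \<in> J)"
      using f mult[OF s u(1)] by blast
  next
    assume "f \<in> carrier ?R \<and> (\<exists>s\<in>carrier ?R - P. s * f \<in> J)"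
    then obtain s where f: "f \<in> carrier ?R" and s: "s \<in> carrier ?R - P" "s * f \<in> J" by blast
    have "(b, t) \<in> loc_frac ?R P f 1 \<longleftrightarrow> (b, t) \<in> loc_frac ?R P (s * f) s" for b t
    proof -
      have "(\<exists>u\<in>carrier ?R - P. u * (t * f - 1 * b) = 0) \<longleftrightarrow>
            (\<exists>u\<in>carrier ?R - P. u * (t * (s * f) - s * b) = 0)"
      proof
        assume "\<exists>u\<in>carrier ?R - P. u * (t * f - 1 * b) = 0"
        then obtain u where u: "u \<in> carrier ?R - P" "u * (t * f - 1 * b) = 0" by blast
        have "u * (t * (s * f) - s * b) = s * (u * (t * f - 1 * b))" by (simp add: algebra_simps)
        then show "\<exists>u\<in>carrier ?R - P. u * (t * (s * f) - s * b) = 0" using u by auto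
      next
        assume "\<exists>u\<in>carrier ?R - P. u * (t * (s * f) - s * b) = 0"
        then obtain u where u: "u \<in> carrier ?R - P" "u * (t * (s * f) - s * b) = 0" by blast
        have "(s * u) * (t * f - 1 * b) = u * (t * (s * f) - s * b)" by (simp add: algebra_simps)
        then show "\<exists>u\<in>carrier ?R - P. u * (t * f - 1 * b) = 0" using u mult[OF s(1)] by metis
      qed
      then show ?thesis using one s(1) by (simp add: frac)
    qed
    then have "loc_frac ?R P f 1 = loc_frac ?R P (s * f) s" by auto
    then show "f \<in> loc_contraction ?R P J"
      using f s by (auto simp: loc_contraction_def loc_ideal_def)
  qed
qed

lemma associated_primes_iff:
  fixes P I :: "(('v::linorder \<Rightarrow>\<^sub>0 nat) \<Rightarrow>\<^sub>0 'k::field) set"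
  assumes I: "ideal I (mpoly_ring V)"
  shows "P \<in> associated_primes (mpoly_ring V) (quot_module (mpoly_ring V) (carrier (mpoly_ring V)) I) \<longleftrightarrow>
    primeideal P (mpoly_ring V) \<and>
    (\<exists>h\<in>carrier (mpoly_ring V). P = {r \<in> carrier (mpoly_ring V). r * h \<in> I})"
proof -
  interpret cring "mpoly_ring V :: (('v \<Rightarrow>\<^sub>0 nat) \<Rightarrow>\<^sub>0 'k) ring" by (rule mpoly_cring)
  interpret ideal_pair V "carrier (mpoly_ring V)" I
    using I oneideal by (intro ideal_pair.intro) (auto dest: ideal.Icarr)
  have "{r \<in> carrier R. r \<odot>\<^bsub>M\<^esub> (I +>\<^bsub>R\<^esub> h) = I} = {r \<in> carrier R. r * h \<in> I}" for h
    by (rule Collect_cong, rule conj_cong[OF refl]) (simp only: M_smult coset_eq_zero)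
  then show ?thesis unfolding associated_primes_def by auto
qed

lemma edge_mult_1_iff:
  assumes "simple_graph V E"
  shows "edge_mult E 1 m \<longleftrightarrow> (\<exists>i j. {i, j} \<in> E \<and> i \<in> keys m \<and> j \<in> keys m)"
proof
  assume "edge_mult E 1 m"
  then obtain i j m' where "{i, j} \<in> E" "m = unit_exp i + unit_exp j + m'" by auto
  then show "\<exists>i j. {i, j} \<in> E \<and> i \<in> keys m \<and> j \<in> keys m"
    by (intro exI[of _ i] exI[of _ j]) (simp add: keys_add_nat)
next
  assume "\<exists>i j. {i, j} \<in> E \<and> i \<in> keys m \<and> j \<in> keys m"
  then obtain i j where ij: "{i, j} \<in> E" "i \<in> keys m" "j \<in> keys m" by blast
  have "i \<noteq> j" using ij(1) assms by (auto simp: simple_graph_def)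
  obtain m1 where m1: "m = unit_exp i + m1" using ij(2) remove_unit_exp by metis
  have "j \<in> keys m1" using ij(3) \<open>i \<noteq> j\<close> by (simp add: m1 keys_add_nat)
  then obtain m2 where m2: "m1 = unit_exp j + m2" using remove_unit_exp by metis
  show "edge_mult E 1 m"
    using edge_mult_step[OF ij(1), of 0 m2] by (simp add: m1 m2 add.assoc del: edge_mult.simps(2))
qed

lemma minimal_vertex_cover:
  assumes "finite V" "vertex_cover V E Q"
  obtains Q' where "Q' \<subseteq> Q" "vertex_cover V E Q'"
    "\<And>v. v \<in> Q' \<Longrightarrow> \<not> vertex_cover V E (Q' - {v})"
proof -
  let ?P = "\<lambda>Q'. Q' \<subseteq> Q \<and> vertex_cover V E Q'"
  define Q' where "Q' = arg_min card ?P"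
  have Q': "?P Q'" unfolding Q'_def using assms(2) by (intro arg_min_natI[of ?P Q]) auto
  have fin: "finite Q'" using Q' assms by (auto simp: vertex_cover_def intro: finite_subset)
  have "\<not> vertex_cover V E (Q' - {v})" if v: "v \<in> Q'" for v
  proof
    assume "vertex_cover V E (Q' - {v})"
    then have "card Q' \<le> card (Q' - {v})"
      unfolding Q'_def by (intro arg_min_nat_le) (use Q' in \<open>auto simp: Q'_def\<close>)
    then show False using card_Diff1_less[OF fin v] by simp
  qed
  then show ?thesis using Q' that by blast
qed

text \<open>
  Each of the \<open>t\<close> factors of \<open>m\<close> in \<open>Q\<close> pairs with a neighbour in \<open>A\<close>, and \<open>t\<close> copies of every
  vertex of \<open>A\<close> suffice for that.
\<close>

lemma cover_complement_power:
  assumes "finite A" "\<And>v. v \<in> Q \<Longrightarrow> \<exists>y\<in>A. {v, y} \<in> E"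
  shows "t \<le> cdeg Q m \<Longrightarrow> edge_mult E t ((\<Sum>a\<in>A. single a t) + m)"
proof (induction t arbitrary: m)
  case (Suc t)
  then have "cdeg Q m \<noteq> 0" by simp
  then obtain v where v: "v \<in> keys m" "v \<in> Q" by (auto simp: wdeg_eq_0_iff)
  obtain m' where m': "m = unit_exp v + m'" using v(1) remove_unit_exp by metis
  obtain y where y: "y \<in> A" "{v, y} \<in> E" using assms(2) v(2) by blast
  have "t \<le> cdeg Q m'" using Suc.prems v by (simp add: m')
  then have "edge_mult E t ((\<Sum>a\<in>A - {y}. unit_exp a) + ((\<Sum>a\<in>A. single a t) + m'))"
    by (intro edge_mult_add Suc.IH)
  note edge_mult_step[OF y(2) this]
  also have "unit_exp v + unit_exp y + ((\<Sum>a\<in>A - {y}. unit_exp a) + ((\<Sum>a\<in>A. single a t) + m')) =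
     ((unit_exp y + (\<Sum>a\<in>A - {y}. unit_exp a)) + (\<Sum>a\<in>A. single a t)) + m"
    by (simp only: m' add_ac)
  also have "unit_exp y + (\<Sum>a\<in>A - {y}. unit_exp a) = (\<Sum>a\<in>A. unit_exp a)"
    using assms(1) y(1) by (simp add: sum.remove)
  also have "(\<Sum>a\<in>A. unit_exp a) + (\<Sum>a\<in>A. single a t) = (\<Sum>a\<in>A. single a (Suc t))"
    by (simp add: unit_exp_def flip: sum.distrib single_add)
  finally show ?case .
qed simp

lemma keys_sum_nat:
  "finite A \<Longrightarrow> keys (\<Sum>a\<in>A. g a :: 'v \<Rightarrow>\<^sub>0 nat) = (\<Union>a\<in>A. keys (g a))"
  by (induction A rule: finite_induct) (auto simp: keys_add_nat)

text \<open>
  One inclusion takes the associated prime of a minimal vertex cover \<open>Q\<close>: modulo the edge ideal it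
  is the annihilator of the product of the variables outside \<open>Q\<close>, and a denominator outside it contains a monomial of degree
  zero in \<open>Q\<close>, so denominators cannot repair a monomial of small degree. For the other inclusion, the
  variables in an associated prime form a cover \<open>Q\<close>, each element of which has a neighbour outside
  \<open>Q\<close>. A power of the product of the variables outside \<open>Q\<close> then serves as denominator.
\<close>

lemma symbolic_power_eq:
  fixes E :: "'v::linorder set set"
  assumes G: "simple_graph V E"
  shows "symbolic_power (mpoly_ring V) (edge_ideal V E) t =
    (mono_ideal V (cover_mult V E t) :: (('v \<Rightarrow>\<^sub>0 nat) \<Rightarrow>\<^sub>0 'k::field) set)"
proof -
  let ?R = "mpoly_ring V :: (('v \<Rightarrow>\<^sub>0 nat) \<Rightarrow>\<^sub>0 'k) ring"
  define I where "I = (mono_ideal V (edge_mult E 1) :: (('v \<Rightarrow>\<^sub>0 nat) \<Rightarrow>\<^sub>0 'k) set)"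
  define It where "It = (mono_ideal V (edge_mult E t) :: (('v \<Rightarrow>\<^sub>0 nat) \<Rightarrow>\<^sub>0 'k) set)"
  have idlI: "ideal I ?R" and idlIt: "ideal It ?R" unfolding I_def It_def by (rule edge_mult_ideal)+
  have finV: "finite V" using G by (simp add: simple_graph_def)
  have EV: "i \<in> V \<and> j \<in> V" if "{i, j} \<in> E" for i j using that G by (auto simp: simple_graph_def)
  have em1: "edge_mult E 1 m \<longleftrightarrow> (\<exists>i j. {i, j} \<in> E \<and> i \<in> keys m \<and> j \<in> keys m)" for m
    by (rule edge_mult_1_iff[OF G])
  have sp: "f \<in> symbolic_power ?R (edge_ideal V E) t \<longleftrightarrow> f \<in> carrier ?R \<and>
     (\<forall>P. primeideal P ?R \<and> (\<exists>h\<in>carrier ?R. P = {r \<in> carrier ?R. r * h \<in> I}) \<longrightarrow>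
        (\<exists>s\<in>carrier ?R - P. s * f \<in> It))" for f
  proof -
    let ?Ass = "associated_primes ?R (quot_module ?R (carrier ?R) I)"
    have pw: "ideal_power ?R (edge_ideal V E) t = It" "edge_ideal V E = I"
      unfolding I_def It_def by (rule edge_ideal_power_eq[OF G], rule edge_ideal_eq[OF G])
    have *: "(P \<in> ?Ass \<longrightarrow> f \<in> loc_contraction ?R P It) \<longleftrightarrow>
       (primeideal P ?R \<and> (\<exists>h\<in>carrier ?R. P = {r \<in> carrier ?R. r * h \<in> I}) \<longrightarrow>
        (\<exists>s\<in>carrier ?R - P. s * f \<in> It))" if "f \<in> carrier ?R" for P
      using associated_primes_iff[OF idlI, of P] loc_contraction_iff[OF _ idlIt, of P f] that
      by blast
    have "f \<in> symbolic_power ?R (edge_ideal V E) t \<longleftrightarrow>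
       f \<in> carrier ?R \<and> (\<forall>P. P \<in> ?Ass \<longrightarrow> f \<in> loc_contraction ?R P It)"
      unfolding symbolic_power_def pw(1) unfolding pw(2) by (simp add: Ball_def)
    then show ?thesis by (cases "f \<in> carrier ?R") (simp_all only: * simp_thms)
  qed
  show ?thesis
  proof (rule subset_antisym; rule subsetI)
    fix f assume f: "f \<in> symbolic_power ?R (edge_ideal V E) t"
    have "cover_mult V E t m" if m: "m \<in> keys f" for m
      unfolding cover_mult_def
    proof (intro allI impI)
      fix Q0 assume "vertex_cover V E Q0"
      from minimal_vertex_cover[OF finV this] obtain Q where
        Q: "Q \<subseteq> Q0" "vertex_cover V E Q" "\<And>v. v \<in> Q \<Longrightarrow> \<not> vertex_cover V E (Q - {v})" by metis
      have QV: "Q \<subseteq> V" using Q(2) by (simp add: vertex_cover_def)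
      define A where "A = V - Q"
      have finA: "finite A" using finV by (simp add: A_def)
      have nb: "\<exists>y\<in>A. {v, y} \<in> E" if v: "v \<in> Q" for v
      proof -
        obtain i j where ij: "{i, j} \<in> E" "i \<notin> Q - {v}" "j \<notin> Q - {v}"
          using Q(3)[OF v] QV by (auto simp: vertex_cover_def)
        have "i \<noteq> j" using ij(1) G by (auto simp: simple_graph_def)
        moreover have "i \<in> Q \<or> j \<in> Q" using Q(2) ij(1) by (auto simp: vertex_cover_def)
        ultimately consider "i = v" "j \<notin> Q" | "j = v" "i \<notin> Q" using ij(2,3) by auto
        then show ?thesis
        proof cases
          case 1
          then show ?thesis using ij(1) EV[OF ij(1)] by (intro bexI[of _ j]) (auto simp: A_def)
        next
          case 2
          then show ?thesis
            using ij(1) EV[OF ij(1)] by (intro bexI[of _ i]) (auto simp: A_def insert_commute)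
        qed
      qed
      define xA where "xA = (\<Sum>a\<in>A. unit_exp a)"
      have keysA: "keys xA = A" unfolding xA_def using finA by (simp add: keys_sum_nat)
      define P where "P = (var_prime V A :: (('v \<Rightarrow>\<^sub>0 nat) \<Rightarrow>\<^sub>0 'k) set)"
      have mono: "edge_mult E 1 (xA + m') \<longleftrightarrow> \<not> keys m' \<subseteq> A" if m': "keys m' \<subseteq> V" for m'
      proof
        assume "edge_mult E 1 (xA + m')"
        then obtain i j where "{i, j} \<in> E" "i \<in> A \<union> keys m'" "j \<in> A \<union> keys m'"
          unfolding em1 keys_add_nat keysA by blast
        then show "\<not> keys m' \<subseteq> A" using Q(2) by (auto simp: A_def vertex_cover_def)
      next
        assume "\<not> keys m' \<subseteq> A"
        then obtain v where v: "v \<in> keys m'" "v \<in> Q" using m' by (auto simp: A_def)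
        then show "edge_mult E 1 (xA + m')" using nb[of v] unfolding em1 keys_add_nat keysA by blast
      qed
      have "P = {r \<in> carrier ?R. r * single xA 1 \<in> I}"
      proof (rule Set.set_eqI)
        fix r :: "('v \<Rightarrow>\<^sub>0 nat) \<Rightarrow>\<^sub>0 'k"
        show "r \<in> P \<longleftrightarrow> r \<in> {r \<in> carrier ?R. r * single xA 1 \<in> I}"
        proof (cases "r \<in> carrier ?R")
          case True
          have "r * single xA 1 \<in> I \<longleftrightarrow> (\<forall>m\<in>keys r. edge_mult E 1 (xA + m))"
            using mono_ideal_single_mult[OF True, of xA] keysA by (simp add: I_def A_def mult.commute)
          also have "\<dots> \<longleftrightarrow> r \<in> P"
            using True mono by (simp add: P_def var_prime_def mono_ideal_def mpoly_carrier)
          finally show ?thesis using True by simp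
        qed (simp add: P_def var_prime_def mono_ideal_def)
      qed
      moreover have "single xA 1 \<in> carrier ?R" using keysA by (simp add: A_def)
      moreover have "primeideal P ?R" unfolding P_def by (rule var_prime_primeideal)
      ultimately obtain s where s: "s \<in> carrier ?R - P" "s * f \<in> It"
        using f unfolding sp by blast
      then obtain m' where m': "m' \<in> keys s" "keys m' \<subseteq> A"
        by (auto simp: P_def var_prime_def mono_ideal_def)
      have s0: "\<exists>m\<in>keys s. cdeg Q m = 0"
        using m' by (intro bexI[of _ m']) (auto simp: wdeg_eq_0_iff A_def)
      have "t \<le> cdeg Q m"
      proof (rule ccontr)
        assume "\<not> t \<le> cdeg Q m"
        then have "\<exists>m\<in>keys f. cdeg Q m < t" using m by (meson not_le)
        from low_weight_in_product[OF s0 this]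
        obtain m2 where "m2 \<in> keys (s * f)" "cdeg Q m2 < t" by blast
        moreover have "cover_mult V E t m2"
          using s(2) \<open>m2 \<in> keys (s * f)\<close> by (intro edge_mult_cover_mult) (simp add: It_def mono_ideal_def)
        ultimately show False using Q(2) by (auto simp: cover_mult_def)
      qed
      also have "cdeg Q m \<le> cdeg Q0 m"
        unfolding wdeg_def by (rule sum_mono) (use Q(1) in auto)
      finally show "t \<le> cdeg Q0 m" .
    qed
    then show "f \<in> mono_ideal V (cover_mult V E t)"
      using f unfolding sp by (simp add: mono_ideal_def)
  next
    fix f :: "('v \<Rightarrow>\<^sub>0 nat) \<Rightarrow>\<^sub>0 'k" assume f: "f \<in> mono_ideal V (cover_mult V E t)"
    have fc: "f \<in> carrier ?R" using f by (simp add: mono_ideal_def)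
    have "\<exists>s\<in>carrier ?R - P. s * f \<in> It"
      if P: "primeideal P ?R" and h: "h \<in> carrier ?R" and Ph: "P = {r \<in> carrier ?R. r * h \<in> I}" for P h
    proof -
      interpret P: primeideal P ?R by (rule P)
      define Q where "Q = {v \<in> V. mpoly_var v \<in> P}"
      define A where "A = V - Q"
      have finA: "finite A" using finV by (simp add: A_def)
      have var_iff: "v \<in> Q \<longleftrightarrow> (\<forall>m\<in>keys h. edge_mult E 1 (unit_exp v + m))" if v: "v \<in> V" for v
      proof -
        have "mpoly_var v \<in> P \<longleftrightarrow> mpoly_var v * h \<in> I"
          unfolding Ph mem_Collect_eq using v by (simp only: mpoly_var_in simp_thms)
        also have "\<dots> \<longleftrightarrow> (\<forall>m\<in>keys h. edge_mult E 1 (unit_exp v + m))"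
          unfolding mpoly_var_unit_exp I_def by (rule mono_ideal_single_mult[OF h]) (simp add: v)
        finally show ?thesis unfolding Q_def mem_Collect_eq using v by (simp only: simp_thms)
      qed
      have cover: "vertex_cover V E Q"
        unfolding vertex_cover_def
      proof (intro conjI allI impI)
        fix i j assume ij: "{i, j} \<in> E"
        note V = EV[OF ij]
        have ijc: "mpoly_var i \<in> carrier ?R" "mpoly_var j \<in> carrier ?R" using V by (simp_all add: mpoly_var_in)
        have "mpoly_var i * mpoly_var j \<in> I"
          using V edge_mult_edge[OF ij] by (simp add: I_def mpoly_var_unit_exp mult_single single_in_mono_ideal keys_add_nat del: edge_mult.simps)
        then have "h * (mpoly_var i * mpoly_var j) \<in> I"
          by (rule submod_mult[OF mpoly_ideal_submod[OF idlI] h])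
        then have "mpoly_var i * mpoly_var j \<in> P"
          unfolding Ph mem_Collect_eq using mpoly_carrier_mult[OF ijc] by (simp only: mult.commute simp_thms)
        then have "mpoly_var i \<in> P \<or> mpoly_var j \<in> P" using P.I_prime[OF ijc] by simp
        then show "i \<in> Q \<or> j \<in> Q" using V by (simp add: Q_def)
      qed (auto simp: Q_def)
      have "h \<notin> I"
      proof
        assume "h \<in> I"
        then have "1 * h \<in> I" by simp
        then have "\<one>\<^bsub>?R\<^esub> \<in> P" unfolding Ph mem_Collect_eq using P.one_closed by (simp only: mpoly_ring_simps simp_thms)
        then show False using P.one_imp_carrier P.I_notcarr by simp
      qed
      then obtain m0 where m0: "m0 \<in> keys h" "\<not> edge_mult E 1 m0"
        using h by (auto simp: I_def mono_ideal_def)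
      have m0V: "keys m0 \<subseteq> V" using m0(1) h by (simp add: mpoly_carrier)
      have nb: "\<exists>y\<in>A. {v, y} \<in> E" if v: "v \<in> Q" for v
      proof -
        have "edge_mult E 1 (unit_exp v + m0)" using var_iff[of v] v m0(1) by (auto simp: Q_def)
        then obtain i j where ij: "{i, j} \<in> E" "i \<in> insert v (keys m0)" "j \<in> insert v (keys m0)"
          unfolding em1 keys_add_nat by auto
        have "i \<noteq> j" using ij(1) G by (auto simp: simple_graph_def)
        have "\<not> (i \<in> keys m0 \<and> j \<in> keys m0)" using m0(2) ij(1) unfolding em1 by blast
        then have "\<exists>y\<in>keys m0. {v, y} \<in> E"
          using ij \<open>i \<noteq> j\<close> by (auto simp: insert_commute)
        then obtain y where y: "y \<in> keys m0" "{v, y} \<in> E" by blast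
        have "y \<notin> Q"
        proof
          assume "y \<in> Q"
          then have "edge_mult E 1 (unit_exp y + m0)"
            using var_iff[of y] m0(1) by (auto simp: Q_def)
          then have "edge_mult E 1 m0" unfolding em1 keys_add_nat using y(1) by auto
          then show False using m0(2) by simp
        qed
        then show ?thesis using y m0V by (auto simp: A_def)
      qed
      define a where "a = (\<Sum>y\<in>A. single y t)"
      have keys_a: "keys a \<subseteq> A" unfolding a_def using finA by (auto simp: keys_sum_nat split: if_splits)
      show ?thesis
      proof (rule bexI)
        have "edge_mult E t (a + m)" if "m \<in> keys f" for m
          unfolding a_def
          by (rule cover_complement_power[OF finA nb])
            (use that f cover in \<open>auto simp: mono_ideal_def cover_mult_def\<close>)
        then show "single a 1 * f \<in> It"
          using mono_ideal_single_mult[OF fc, of a] keys_a by (auto simp: It_def A_def)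
        have "single a 1 \<notin> P"
        proof
          assume "single a 1 \<in> P"
          from monomial_in_prime[OF P _ this] show False
            using keys_a by (auto simp: A_def Q_def)
        qed
        then show "single a 1 \<in> carrier ?R - P" using keys_a by (auto simp: A_def)
      qed
    qed
    then show "f \<in> symbolic_power ?R (edge_ideal V E) t" unfolding sp using fc by blast
  qed
qed

section \<open>Cohen-Macaulayness of the quotient of the symbolic by the ordinary power\<close>

lemma edge_ideal_mono_pair:
  fixes E :: "'v::linorder set set"
  assumes "simple_graph V E"
  shows "mono_pair V (mono_ideal V (cover_mult V E t) :: (('v \<Rightarrow>\<^sub>0 nat) \<Rightarrow>\<^sub>0 'k::field) set)
    (mono_ideal V (edge_mult E t)) (cover_mult V E t) (edge_mult E t)"
proof -
  have "mono_ideal V (edge_mult E t) \<subseteq> (mono_ideal V (cover_mult V E t) :: (('v \<Rightarrow>\<^sub>0 nat) \<Rightarrow>\<^sub>0 'k) set)"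
    by (auto simp: mono_ideal_def intro: edge_mult_cover_mult)
  then show ?thesis
    using assms cover_mult_ideal edge_mult_ideal
    by (intro mono_pair.intro ideal_pair.intro mono_pair_axioms.intro) (auto simp: simple_graph_def)
qed

lemma symbolic_quotient_eq:
  fixes E :: "'v::linorder set set"
  assumes "simple_graph V E"
  shows "symbolic_quotient (mpoly_ring V :: (('v \<Rightarrow>\<^sub>0 nat) \<Rightarrow>\<^sub>0 'k::field) ring) (edge_ideal V E) t =
    quot_module (mpoly_ring V) (mono_ideal V (cover_mult V E t)) (mono_ideal V (edge_mult E t))"
  unfolding symbolic_quotient_def symbolic_power_eq[OF assms] edge_ideal_power_eq[OF assms] ..

text \<open>An induced odd cycle in the rest of the graph would be one of the whole graph, but it would not dominate \<open>i\<close>.\<close>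

lemma bipartite_away_from_vertex:
  assumes G: "simple_graph V E" and i: "i \<in> V"
    and dom: "\<And>C. induced_odd_cycle V E C \<Longrightarrow> closed_nbhd V E C = V"
  shows "bipartite (V - closed_nbhd V E {i}) {e \<in> E. e \<subseteq> V - closed_nbhd V E {i}}"
proof (rule ccontr)
  let ?U = "V - closed_nbhd V E {i}"
  assume nb: "\<not> ?thesis"
  have "simple_graph ?U {e \<in> E. e \<subseteq> ?U}" using G by (auto simp: simple_graph_def)
  from nonbipartite_imp_induced_odd_cycle[OF this nb]
  obtain C where C: "induced_odd_cycle ?U {e \<in> E. e \<subseteq> ?U} C" .
  then have CU: "C \<subseteq> ?U" by (auto simp: induced_odd_cycle_def induced_cycle_def)
  have "induced_odd_cycle V E C" by (rule induced_odd_cycle_of_induced_subgraph[OF _ C]) auto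
  then have "i \<in> closed_nbhd V E C" using dom i by simp
  moreover have "i \<notin> C" using CU by (auto simp: closed_nbhd_def)
  ultimately obtain u where "u \<in> C" "{u, i} \<in> E" by (auto simp: closed_nbhd_def open_nbhd_def)
  then have "u \<in> closed_nbhd V E {i}"
    using CU by (auto simp: closed_nbhd_def open_nbhd_def insert_commute)
  then show False using \<open>u \<in> C\<close> CU by blast
qed

lemma dominating_imp_finite_length:
  fixes E :: "'v::linorder set set" and t :: nat
  assumes G: "simple_graph V E"
    and dom: "\<And>C. induced_odd_cycle V E C \<Longrightarrow> closed_nbhd V E C = V"
  defines "R \<equiv> mpoly_ring V :: (('v \<Rightarrow>\<^sub>0 nat) \<Rightarrow>\<^sub>0 'k::field) ring"
  defines "M \<equiv> symbolic_quotient R (edge_ideal V E) t"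
  assumes nz: "\<not> zero_module M"
  shows "module_dim R M = 0" "depth R (irrelevant_ideal V) M = 0"
proof -
  interpret mp: mono_pair V "mono_ideal V (cover_mult V E t) :: (('v \<Rightarrow>\<^sub>0 nat) \<Rightarrow>\<^sub>0 'k) set"
    "mono_ideal V (edge_mult E t)" "cover_mult V E t" "edge_mult E t"
    by (rule edge_ideal_mono_pair[OF G])
  have M: "M = mp.M" unfolding M_def R_def by (rule symbolic_quotient_eq[OF G])
  have nil: "mpoly_var v ^ t * x \<in> mono_ideal V (edge_mult E t)"
    if v: "v \<in> V" and x: "x \<in> mono_ideal V (cover_mult V E t)" for v and x :: "('v \<Rightarrow>\<^sub>0 nat) \<Rightarrow>\<^sub>0 'k"
  proof -
    have "x \<in> carrier (mpoly_ring V)" "keys (single v t) \<subseteq> V" using v x by (auto simp: mono_ideal_def)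
    moreover have "edge_mult E t (single v t + m)" if "m \<in> keys x" for m
      using edge_mult_after_inverting_vertex[OF G v bipartite_away_from_vertex[OF G v dom]] x that
      by (auto simp: mono_ideal_def)
    ultimately show ?thesis unfolding mpoly_var_power by (subst mono_ideal_single_mult) auto
  qed
  show "module_dim R M = 0" "depth R (irrelevant_ideal V) M = 0"
    using mp.nilpotent_variables[OF _ nil] nz unfolding M R_def by blast+
qed

lemma dim_ge_of_core:
  fixes E :: "'v::linorder set set"
  assumes G: "simple_graph V E" and core: "core V E T t g"
    and F: "F \<subseteq> V" "F \<inter> closed_nbhd V E T = {}" "\<And>i j. i \<in> F \<Longrightarrow> j \<in> F \<Longrightarrow> {i, j} \<notin> E"
  defines "R \<equiv> mpoly_ring V :: (('v \<Rightarrow>\<^sub>0 nat) \<Rightarrow>\<^sub>0 'k::field) ring"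
  defines "M \<equiv> symbolic_quotient R (edge_ideal V E) (Suc t)"
  shows "\<not> zero_module M" "ereal (real (card F)) \<le> module_dim R M"
proof -
  interpret mp: mono_pair V "mono_ideal V (cover_mult V E (Suc t)) :: (('v \<Rightarrow>\<^sub>0 nat) \<Rightarrow>\<^sub>0 'k) set"
    "mono_ideal V (edge_mult E (Suc t))" "cover_mult V E (Suc t)" "edge_mult E (Suc t)"
    by (rule edge_ideal_mono_pair[OF G])
  have M: "M = mp.M" unfolding M_def R_def by (rule symbolic_quotient_eq[OF G])
  have "single g 1 \<in> (mono_ideal V (cover_mult V E (Suc t)) :: (('v \<Rightarrow>\<^sub>0 nat) \<Rightarrow>\<^sub>0 'k) set)"
    using core core_cover_mult[OF core] by (auto simp: single_in_mono_ideal core_def)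
  note dim = mp.dim_ge[OF F(1) this core_not_edge_mult[OF core G F(2,3)]]
  show "\<not> zero_module M" "ereal (real (card F)) \<le> module_dim R M"
    using dim unfolding M R_def by blast+
qed

text \<open>
  The element is the product of \<open>g\<close> and the variables of \<open>F\<close>. A variable in \<open>N[T]\<close> kills it because
  of \<open>g\<close>, and one outside \<open>N[T]\<close> because it is adjacent to \<open>F\<close>, by maximality.
\<close>

lemma depth_le_of_core:
  fixes E :: "'v::linorder set set"
  assumes G: "simple_graph V E" and core: "core V E T t g"
    and F: "F \<subseteq> V - closed_nbhd V E T" "\<And>i j. i \<in> F \<Longrightarrow> j \<in> F \<Longrightarrow> {i, j} \<notin> E"
      "\<And>j. j \<in> V - closed_nbhd V E T - F \<Longrightarrow> \<exists>f\<in>F. {j, f} \<in> E"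
  defines "R \<equiv> mpoly_ring V :: (('v \<Rightarrow>\<^sub>0 nat) \<Rightarrow>\<^sub>0 'k::field) ring"
  defines "M \<equiv> symbolic_quotient R (edge_ideal V E) (Suc t)"
  shows "depth R (irrelevant_ideal V) M \<le> ereal (real (card F))"
proof -
  interpret mp: mono_pair V "mono_ideal V (cover_mult V E (Suc t)) :: (('v \<Rightarrow>\<^sub>0 nat) \<Rightarrow>\<^sub>0 'k) set"
    "mono_ideal V (edge_mult E (Suc t))" "cover_mult V E (Suc t)" "edge_mult E (Suc t)"
    by (rule edge_ideal_mono_pair[OF G])
  have M: "M = mp.M" unfolding M_def R_def by (rule symbolic_quotient_eq[OF G])
  have finF: "finite F" using F(1) G by (auto simp: simple_graph_def intro: finite_subset)
  define h where "h = (\<Sum>f\<in>F. unit_exp f) + g"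
  have keys_F: "keys (\<Sum>f\<in>F. unit_exp f) = F" using finF by (simp add: keys_sum_nat)
  have hV: "keys h \<subseteq> V" using core F(1) keys_F by (auto simp: h_def keys_add_nat core_def)
  have "single h 1 \<in> (mono_ideal V (cover_mult V E (Suc t)) :: (('v \<Rightarrow>\<^sub>0 nat) \<Rightarrow>\<^sub>0 'k) set)"
    using hV cover_mult_add[OF core_cover_mult[OF core]] by (auto simp: single_in_mono_ideal h_def)
  moreover have "\<not> edge_mult E (Suc t) h"
    unfolding h_def add.commute[of _ g]
  proof (rule core_not_edge_mult[OF core G])
    show "F \<inter> closed_nbhd V E T = {}" using F(1) by blast
  qed (use F(2) keys_F in simp_all)
  then have "single h 1 \<notin> (mono_ideal V (edge_mult E (Suc t)) :: (('v \<Rightarrow>\<^sub>0 nat) \<Rightarrow>\<^sub>0 'k) set)"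
    by (simp add: single_in_mono_ideal del: edge_mult.simps)
  moreover have "mpoly_var v * single h 1 \<in> (mono_ideal V (edge_mult E (Suc t)) :: (('v \<Rightarrow>\<^sub>0 nat) \<Rightarrow>\<^sub>0 'k) set)"
    if v: "v \<in> V - F" for v
  proof -
    have "edge_mult E (Suc t) (unit_exp v + h)"
    proof (cases "v \<in> closed_nbhd V E T")
      case True
      then have "edge_mult E (Suc t) (unit_exp v + g)" using core by (simp add: core_def del: edge_mult.simps)
      from edge_mult_add[OF this, of "\<Sum>f\<in>F. unit_exp f"]
      show ?thesis unfolding h_def by (simp only: add_ac)
    next
      case False
      then obtain f where f: "f \<in> F" "{v, f} \<in> E" using F(3) v by blast
      have "edge_mult E t g" using core by (simp add: core_def)
      from edge_mult_step[OF f(2) edge_mult_add[OF this, of "\<Sum>f\<in>F - {f}. unit_exp f"]]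
      have "edge_mult E (Suc t) (unit_exp v + ((unit_exp f + (\<Sum>f\<in>F - {f}. unit_exp f)) + g))"
        by (simp only: add_ac)
      also have "unit_exp f + (\<Sum>f\<in>F - {f}. unit_exp f) = (\<Sum>f\<in>F. unit_exp f)"
        using finF f(1) by (simp add: sum.remove)
      finally show ?thesis unfolding h_def .
    qed
    then show ?thesis
      using v hV by (simp add: mpoly_var_unit_exp mult_single single_in_mono_ideal keys_add_nat del: edge_mult.simps)
  qed
  moreover have "F \<subseteq> V" using F(1) by blast
  ultimately show ?thesis unfolding M R_def by (intro mp.depth_le)
qed

lemma not_dominating_imp_dim_pos:
  fixes E :: "'v::linorder set set"
  assumes G: "simple_graph V E" and C: "induced_odd_cycle V E C" "closed_nbhd V E C \<noteq> V"
  defines "R \<equiv> mpoly_ring V :: (('v \<Rightarrow>\<^sub>0 nat) \<Rightarrow>\<^sub>0 'k::field) ring"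
  obtains t where "t \<ge> 1" "\<not> zero_module (symbolic_quotient R (edge_ideal V E) t)"
    "module_dim R (symbolic_quotient R (edge_ideal V E) t) \<noteq> 0"
proof -
  obtain c g where core: "core V E C c g" using core_odd_cycle[OF G C(1)] by metis
  have "C \<subseteq> V" using core by (simp add: core_def)
  then obtain u where u: "u \<in> V" "u \<notin> closed_nbhd V E C"
    using C(2) by (auto simp: closed_nbhd_def open_nbhd_def)
  have "{u, u} \<notin> E" using G by (auto simp: simple_graph_def)
  then have "\<not> zero_module (symbolic_quotient R (edge_ideal V E) (Suc c))"
    "ereal (real (card {u})) \<le> module_dim R (symbolic_quotient R (edge_ideal V E) (Suc c))"
    unfolding R_def using dim_ge_of_core[OF G core, of "{u}"] u by auto
  then show ?thesis by (intro that[of "Suc c"]) (auto simp: zero_ereal_def one_ereal_def)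
qed

text \<open>
  The same exponent is reached by two monomials. The one on \<open>C\<close> bounds the dimension from below by
  \<open>|F| + 1\<close>, and the one on \<open>C \<union> {w, u}\<close> bounds the depth from above by \<open>|F|\<close>; they spend their
  last two edges on staying inside \<open>C\<close> and on walking along \<open>w\<close> to \<open>u\<close>.
\<close>

lemma not_dominating_imp_not_cohen_macaulay:
  fixes E :: "'v::linorder set set"
  assumes G: "simple_graph V E" and conn: "graph_connected V E"
    and C: "induced_odd_cycle V E C" "closed_nbhd V E C \<noteq> V" "card C = 2 * c + 1" and t: "t \<ge> c + 3"
  defines "R \<equiv> mpoly_ring V :: (('v \<Rightarrow>\<^sub>0 nat) \<Rightarrow>\<^sub>0 'k::field) ring"
  shows "\<not> cohen_macaulay R (irrelevant_ideal V) (symbolic_quotient R (edge_ideal V E) t)"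
proof -
  obtain c' a b g where "card C = 2 * c' + 1" and g: "core V E C c' g" and ab: "a \<in> C" "b \<in> C" "{a, b} \<in> E"
    using core_odd_cycle[OF G C(1)] by metis
  then have c': "c' = c" using C(3) by simp
  have CV: "C \<subseteq> V" using g by (simp add: core_def)
  have "C \<noteq> {}" using ab(1) by blast
  from vertices_beyond_neighbourhood[OF conn G CV this C(2)]
  obtain v w u where vwu: "v \<in> C" "{v, w} \<in> E" "{w, u} \<in> E" "w \<in> V" "u \<in> V" "u \<notin> closed_nbhd V E C" .
  obtain s where s: "t = Suc (Suc (Suc (c + s)))"
    using that[of "t - c - 3"] t by simp
  obtain g1 where g1: "core V E C (c + s) g1" using core_pad[OF g ab, of s] c' by blast
  obtain g' where g': "core V E C (Suc (Suc (c + s))) g'"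
    using core_pad[OF g ab, of "Suc (Suc s)"] c' by auto
  define T where "T = insert u (insert w C)"
  from core_extend[OF core_extend[OF g1 vwu(1,2,4)] insertI1 vwu(3,5)]
  obtain g3 where g3: "core V E T (Suc (Suc (c + s))) g3" unfolding T_def by blast
  have loop: "{v} \<notin> E" for v using G by (auto simp: simple_graph_def)
  have "finite (V - closed_nbhd V E T)" using G by (simp add: simple_graph_def)
  from maximal_independent_set[OF this loop] obtain F where
    F: "F \<subseteq> V - closed_nbhd V E T" "\<And>i j. i \<in> F \<Longrightarrow> j \<in> F \<Longrightarrow> {i, j} \<notin> E"
      "\<And>j. j \<in> V - closed_nbhd V E T - F \<Longrightarrow> \<exists>f\<in>F. {j, f} \<in> E" by metis
  have depth: "depth R (irrelevant_ideal V) (symbolic_quotient R (edge_ideal V E) t) \<le> ereal (real (card F))"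
    unfolding R_def s by (rule depth_le_of_core[OF G g3 F])
  have uF: "u \<notin> F" "{u, f} \<notin> E" "{f, u} \<notin> E" if "f \<in> F" for f
    using F(1) that by (auto simp: T_def closed_nbhd_def open_nbhd_def insert_commute)
  have indep: "{i, j} \<notin> E" if "i \<in> insert u F" "j \<in> insert u F" for i j
    using that F(2) uF loop[of u] by auto
  have "closed_nbhd V E C \<subseteq> closed_nbhd V E T" by (auto simp: T_def closed_nbhd_def open_nbhd_def)
  then have off: "insert u F \<inter> closed_nbhd V E C = {}" using F(1) vwu(6) by blast
  have "insert u F \<subseteq> V" using F(1) vwu(5) by auto
  note dim = dim_ge_of_core[OF G g' this off indep, folded s, where 'k = 'k, folded R_def]
  have "u \<notin> F" using F(1) by (auto simp: T_def closed_nbhd_def)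
  moreover have "finite F" using F(1) G by (auto simp: simple_graph_def intro: finite_subset)
  ultimately have "ereal (real (Suc (card F))) \<le> module_dim R (symbolic_quotient R (edge_ideal V E) t)"
    using dim(2) by simp
  moreover have "ereal (real (card F)) < ereal (real (Suc (card F)))" by simp
  ultimately have "depth R (irrelevant_ideal V) (symbolic_quotient R (edge_ideal V E) t) \<noteq>
      module_dim R (symbolic_quotient R (edge_ideal V E) t)"
    using depth by (metis leD order_trans)
  then show ?thesis using dim(1) by (simp add: cohen_macaulay_def)
qed

lemma c_number_ge:
  assumes "finite V" "\<not> bipartite V E" "induced_odd_cycle V E C" "card C = 2 * c + 1"
  shows "c \<le> c_number V E"
proof -
  let ?S = "{card C | C. induced_odd_cycle V E C}"
  have "?S \<subseteq> card ` Pow V" by (auto simp: induced_odd_cycle_def induced_cycle_def)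
  then have fin: "finite ?S" using assms(1) finite_subset by blast
  moreover have "?S \<noteq> {}" using assms(3) by blast
  ultimately have "Max ?S \<in> ?S" by (rule Max_in)
  then obtain C' where "Max ?S = card C'" "induced_odd_cycle V E C'" by blast
  then have "odd (Max ?S)" by (simp add: induced_odd_cycle_def)
  then obtain c' where c': "Max ?S = 2 * c' + 1" by (rule oddE)
  have "c_number V E = c'" unfolding c_number_def using assms(2) c' by auto
  moreover have "2 * c + 1 \<le> Max ?S" using fin assms(3,4) by (intro Max_ge) (auto intro!: exI[of _ C])
  ultimately show ?thesis using c' by simp
qed

theorem theorem8p4:
  fixes n :: nat and E :: "nat set set"
    and S :: "((nat \<Rightarrow>\<^sub>0 nat) \<Rightarrow>\<^sub>0 'k::field) ring"
    and \<mm> I :: "((nat \<Rightarrow>\<^sub>0 nat) \<Rightarrow>\<^sub>0 'k) set"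
    and t\<^sub>0 :: nat
  assumes "simple_graph {1..n} E"
    and "graph_connected {1..n} E"
    and "\<not> bipartite {1..n} E"
    and S: "S = mpoly_ring {1..n}"
    and \<mm>: "\<mm> = irrelevant_ideal {1..n}"
    and I: "I = edge_ideal {1..n} E"
    and t\<^sub>0: "t\<^sub>0 = max (t_number S I) (c_number {1..n} E) + 3"
  shows "((\<forall>t\<ge>1. cohen_macaulay S \<mm> (symbolic_quotient S I t)) \<longleftrightarrow>
          (\<exists>t\<ge>t\<^sub>0. cohen_macaulay S \<mm> (symbolic_quotient S I t))) \<and>
         ((\<exists>t\<ge>t\<^sub>0. cohen_macaulay S \<mm> (symbolic_quotient S I t)) \<longleftrightarrow>
          (\<forall>t\<ge>1. zero_module (symbolic_quotient S I t) \<or>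
                  module_dim S (symbolic_quotient S I t) = 0)) \<and>
         ((\<forall>t\<ge>1. zero_module (symbolic_quotient S I t) \<or>
                  module_dim S (symbolic_quotient S I t) = 0) \<longleftrightarrow>
          (\<forall>C. induced_odd_cycle {1..n} E C \<longrightarrow> closed_nbhd {1..n} E C = {1..n}))"
    (is "(?one \<longleftrightarrow> ?two) \<and> (?two \<longleftrightarrow> ?three) \<and> (?three \<longleftrightarrow> ?four)")
proof -
  note G = assms(1)
  have "?one \<and> ?three" if four: ?four
  proof -
    have "cohen_macaulay S \<mm> (symbolic_quotient S I t) \<and>
       (zero_module (symbolic_quotient S I t) \<or> module_dim S (symbolic_quotient S I t) = 0)" for t
    proof (cases "zero_module (symbolic_quotient S I t)")
      case True
      then show ?thesis by (simp add: cohen_macaulay_def)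
    next
      case False
      have dom: "closed_nbhd {1..n} E C = {1..n}" if "induced_odd_cycle {1..n} E C" for C
        using four that by blast
      have "module_dim S (symbolic_quotient S I t) = 0" "depth S \<mm> (symbolic_quotient S I t) = 0"
        unfolding S I \<mm> by (rule dominating_imp_finite_length[OF G dom False[unfolded S I]], assumption)+
      then show ?thesis by (simp add: cohen_macaulay_def)
    qed
    then show ?thesis by blast
  qed
  moreover have ?two if ?one
    using that t\<^sub>0 by (intro exI[of _ t\<^sub>0]) auto
  moreover have ?four if two: ?two
  proof (rule ccontr)
    assume "\<not> ?four"
    then obtain C where C: "induced_odd_cycle {1..n} E C" "closed_nbhd {1..n} E C \<noteq> {1..n}" by blast
    then have "odd (card C)" by (simp add: induced_odd_cycle_def)
    then obtain c where c: "card C = 2 * c + 1" by (rule oddE)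
    obtain t where t: "t \<ge> t\<^sub>0" "cohen_macaulay S \<mm> (symbolic_quotient S I t)" using two by blast
    have "c \<le> c_number {1..n} E" by (rule c_number_ge[OF _ assms(3) C(1) c]) simp
    then have "c + 3 \<le> t" using t(1) t\<^sub>0 by simp
    from not_dominating_imp_not_cohen_macaulay[OF G assms(2) C c this] show False
      using t(2) unfolding S \<mm> I by blast
  qed
  moreover have ?four if three: ?three
  proof (rule ccontr)
    assume "\<not> ?four"
    then obtain C where C: "induced_odd_cycle {1..n} E C" "closed_nbhd {1..n} E C \<noteq> {1..n}" by blast
    from not_dominating_imp_dim_pos[OF G C, where 'k = 'k, folded S I]
    obtain t where "t \<ge> 1" "\<not> zero_module (symbolic_quotient S I t)"
      "module_dim S (symbolic_quotient S I t) \<noteq> 0" .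
    then show False using three by blast
  qed
  ultimately show ?thesis by blast
qed

end
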